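(* Let $\Omega \subset \mathbb{C}^{n+1}$ be a strictly pseudoconvex domain, let $p \in \partial\Omega$, and suppose $\partial\Omega$ is smooth near $p$. Let $P(z,\partial)=\sum_{|\alpha|\le m}a_\alpha(z)\left(\frac{\partial}{\partial z}\right)^\alpha$ be a linear partial differential operator with coefficients $a_\alpha$ holomorphic near $p$, and assume that $\partial\Omega$ is simply characteristic with respect to $P$ at $p$. If condition (Pos) holds at $p$, then $\Omega$ is strongly $P$-convex at $p$.
   Context: Coordinates on $\mathbb{C}^{n+1}$ are $z=(z_1,\dots,z_{n+1})$. The principal symbol of $P$ is $P_m(z,\zeta)=\sum_{|\alpha|=m}a_\alpha(z)\zeta^\alpha$. Write $P_{m,j}=\frac{\partial P_m}{\partial z_j}$ and $P_m^{(j)}=\frac{\partial P_m}{\partial \zeta_j}$, and $\partial_\zeta P_m=(P_m^{(1)},\dots,P_m^{(n+1)})$. Let $\rho(z,\bar z)$ be a smooth real-valued defining function of $\Omega$ near $p$: $\Omega=\{\rho<0\}$ near $p$ and the holomorphic gradient $\partial\rho=(\rho_{z_1},\dots,\rho_{z_{n+1}})$ is nonzero on $\partial\Omega$. Characteristic: $\partial\Omega$ is characteristic at $p$ with respect to $P$ if $P_m(p,\partial\rho(p,\bar p))=0$; it is simply characteristic at $p$ if in addition $\partial_\zeta P_m(p,\partial\rho(p,\bar p))\neq(0,\dots,0)$. A (nonsingular) complex analytic hypersurface $S$ with holomorphic defining function $f$ ($S=\{f=0\}$, $\partial f=(f_{z_1},\dots,f_{z_{n+1}})\ne 0$ on $S$)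 is everywhere characteristic if $P_m(z,\partial f(z))=0$ for all $z\in S$. Strong $P$-convexity: $\Omega$ is strongly $P$-convex at $p\in\partial\Omega$ if there is an everywhere characteristic complex analytic hypersurface $S$ in some open neighborhood $U$ of $p$ such that $S\cap\overline{\Omega}\cap U=\{p\}$. Condition (Pos): for $z$ near $p$ define the Hermitian form $Q_z(t,\bar t)=\sum_{0\le j,k\le n+1}q_{j,k}(z,\bar z)t_j\bar t_k$, $t=(t_0,\dots,t_{n+1})\in\mathbb{C}^{n+2}$, where $q_{j,k}=\rho_{z_j\bar z_k}$ for $1\le j,k\le n+1$; $q_{j,0}=P_{m,j}(z,\partial\rho)+\sum_{k=1}^{n+1}P_m^{(k)}(z,\partial\rho)\rho_{z_jz_k}$ and $q_{0,j}=\overline{q_{j,0}}$ for $1\le j\le n+1$; $q_{0,0}=\sum_{1\le j,k\le n+1}P_m^{(j)}(z,\partial\rho)\overline{P_m^{(k)}(z,\partial\rho)}\rho_{z_j\bar z_k}$, with $\rho$ and its derivatives evaluated at $(z,\bar z)$. Condition (Pos) holds at $p$ if $Q_p$ is positive definite on $\mathbb{C}\times T^{1,0}_p\partial\Omega$, i.e. $\sum_{j,k=0}^{n+1}q_{j,k}(p,\bar p)t_j\bar t_k>0$ for every $t\in\mathbb{C}^{n+2}$ with $t\ne0$ and $\sum_{j=1}^{n+1}\rho_{z_j}(p,\bar p)t_j=0$. *)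

theory Defs
  imports "HOL-Analysis.Analysis"
begin

text \<open>
  \<open>\<complex>\<^sup>n\<^sup>+\<^sup>1\<close> is \<open>complex ^ 'n\<close> with \<open>CARD('n) = n + 1\<close>.
\<close>

text \<open>
  The class \<open>C\<^sup>k\<close> on an open set: all iterated directional derivatives up to order \<open>k\<close>
  exist and are continuous (derivatives are over the reals).
\<close>

primrec Ck_on ::
  "nat \<Rightarrow> ('a::euclidean_space \<Rightarrow> 'b::real_normed_vector) \<Rightarrow> 'a set \<Rightarrow> bool" where
  "Ck_on 0 f U \<longleftrightarrow> continuous_on U f"
| "Ck_on (Suc k) f U \<longleftrightarrow>
     (\<forall>x\<in>U. f differentiable (at x)) \<and>
     (\<forall>v. Ck_on k (\<lambda>x. frechet_derivative f (at x) v) U)"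

definition smooth_on ::
  "('a::euclidean_space \<Rightarrow> 'b::real_normed_vector) \<Rightarrow> 'a set \<Rightarrow> bool" where
  "smooth_on f U \<longleftrightarrow> (\<forall>k. Ck_on k f U)"

text \<open>
  Holomorphy in several variables on an open set: real differentiability with a
  complex linear differential.
\<close>

definition cholomorphic_on :: "(complex ^ 'n \<Rightarrow> complex) \<Rightarrow> (complex ^ 'n) set \<Rightarrow> bool" where
  "cholomorphic_on f U \<longleftrightarrow>
     (\<forall>z\<in>U. \<exists>f'. (f has_derivative f') (at z) \<and> (\<forall>c v. f' (c *s v) = c * f' v))"

text \<open>
  The Wirtinger derivatives \<open>\<partial>/\<partial>z\<^sub>j = (\<partial>/\<partial>x\<^sub>j - \<i> \<partial>/\<partial>y\<^sub>j)/2\<close> and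
  \<open>\<partial>/\<partial>\<bar>z\<^sub>j = (\<partial>/\<partial>x\<^sub>j + \<i> \<partial>/\<partial>y\<^sub>j)/2\<close>. On holomorphic functions, \<open>d_z j\<close> is the
  complex partial derivative.
\<close>

definition d_z :: "'n \<Rightarrow> (complex ^ 'n \<Rightarrow> complex) \<Rightarrow> complex ^ 'n \<Rightarrow> complex" where
  "d_z j g z =
     (frechet_derivative g (at z) (axis j 1) - \<i> * frechet_derivative g (at z) (axis j \<i>)) / 2"

definition d_zbar :: "'n \<Rightarrow> (complex ^ 'n \<Rightarrow> complex) \<Rightarrow> complex ^ 'n \<Rightarrow> complex" where
  "d_zbar j g z =
     (frechet_derivative g (at z) (axis j 1) + \<i> * frechet_derivative g (at z) (axis j \<i>)) / 2"

definition hol_grad :: "(complex ^ 'n \<Rightarrow> complex) \<Rightarrow> complex ^ 'n \<Rightarrow> complex ^ 'n" where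
  "hol_grad g z = (\<chi> j. d_z j g z)"

abbreviation cplx :: "(complex ^ 'n \<Rightarrow> real) \<Rightarrow> complex ^ 'n \<Rightarrow> complex" where
  "cplx \<rho> \<equiv> (\<lambda>z. complex_of_real (\<rho> z))"


text \<open>
  An operator \<open>P(z,\<partial>) = \<Sum>\<^bsub>|\<alpha>| \<le> m\<^esub> a\<^sub>\<alpha>(z) (\<partial>/\<partial>z)\<^sup>\<alpha>\<close> is given by its order bound \<open>m\<close> and its
  coefficients \<open>a\<close>. A multi-index is a function \<open>\<alpha> :: 'n \<Rightarrow> nat\<close>, with \<open>|\<alpha>| = sum \<alpha> UNIV\<close>;
  values of \<open>a\<close> at multi-indices with \<open>|\<alpha>| > m\<close> are irrelevant.
\<close>

definition coeffs_holomorphic_near ::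
  "nat \<Rightarrow> (('n \<Rightarrow> nat) \<Rightarrow> complex ^ 'n \<Rightarrow> complex) \<Rightarrow> complex ^ 'n \<Rightarrow> bool" where
  "coeffs_holomorphic_near m a p \<longleftrightarrow>
     (\<forall>\<alpha>. sum \<alpha> UNIV \<le> m \<longrightarrow> (\<exists>V. open V \<and> p \<in> V \<and> cholomorphic_on (a \<alpha>) V))"

definition principal_symbol ::
  "nat \<Rightarrow> (('n \<Rightarrow> nat) \<Rightarrow> complex ^ 'n \<Rightarrow> complex) \<Rightarrow> complex ^ 'n \<Rightarrow> complex ^ 'n \<Rightarrow> complex" where
  "principal_symbol m a z \<zeta> = (\<Sum>\<alpha> | sum \<alpha> UNIV = m. a \<alpha> z * (\<Prod>j\<in>UNIV. (\<zeta> $ j) ^ \<alpha> j))"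

text \<open>The index set of the sum in \<open>principal_symbol\<close> is finite, so the sum is not a junk value.\<close>

lemma finite_multi_indices: "finite {\<alpha> :: 'n::finite \<Rightarrow> nat. sum \<alpha> UNIV = m}"
proof (rule finite_subset)
  show "{\<alpha> :: 'n \<Rightarrow> nat. sum \<alpha> UNIV = m} \<subseteq> (UNIV :: 'n set) \<rightarrow>\<^sub>E {..m}"
    by (auto intro: member_le_sum)
  show "finite ((UNIV :: 'n set) \<rightarrow>\<^sub>E {..m})"
    by (intro finite_PiE) auto
qed

text \<open>\<open>P\<^sub>m\<^sub>,\<^sub>j = \<partial>P\<^sub>m/\<partial>z\<^sub>j\<close> and \<open>P\<^sub>m\<^sup>(\<^sup>j\<^sup>) = \<partial>P\<^sub>m/\<partial>\<zeta>\<^sub>j\<close>.\<close>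

definition symbol_dz ::
  "nat \<Rightarrow> (('n \<Rightarrow> nat) \<Rightarrow> complex ^ 'n \<Rightarrow> complex) \<Rightarrow> 'n \<Rightarrow> complex ^ 'n \<Rightarrow> complex ^ 'n \<Rightarrow> complex"
  where "symbol_dz m a j z \<zeta> = d_z j (\<lambda>w. principal_symbol m a w \<zeta>) z"

definition symbol_dzeta ::
  "nat \<Rightarrow> (('n \<Rightarrow> nat) \<Rightarrow> complex ^ 'n \<Rightarrow> complex) \<Rightarrow> 'n \<Rightarrow> complex ^ 'n \<Rightarrow> complex ^ 'n \<Rightarrow> complex"
  where "symbol_dzeta m a j z \<zeta> = d_z j (\<lambda>\<eta>. principal_symbol m a z \<eta>) \<zeta>"


definition defining_function_near ::
  "(complex ^ 'n \<Rightarrow> real) \<Rightarrow> (complex ^ 'n) set \<Rightarrow> complex ^ 'n \<Rightarrow> bool" where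
  "defining_function_near \<rho> \<Omega> p \<longleftrightarrow>
     (\<exists>U. open U \<and> p \<in> U \<and> smooth_on \<rho> U \<and> \<Omega> \<inter> U = {z\<in>U. \<rho> z < 0} \<and>
          (\<forall>z \<in> frontier \<Omega> \<inter> U. hol_grad (cplx \<rho>) z \<noteq> 0))"

text \<open>
  Positive definiteness of the complex Hessian. The form is Hermitian, so its values are
  real and \<open>Re\<close> discards nothing.
\<close>

definition strictly_psh_on :: "(complex ^ 'n \<Rightarrow> real) \<Rightarrow> (complex ^ 'n) set \<Rightarrow> bool" where
  "strictly_psh_on r U \<longleftrightarrow>
     Ck_on 2 r U \<and>
     (\<forall>z\<in>U. \<forall>t. t \<noteq> 0 \<longrightarrow>
        Re (\<Sum>j\<in>UNIV. \<Sum>k\<in>UNIV. d_z j (d_zbar k (cplx r)) z * t $ j * cnj (t $ k)) > 0)"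

text \<open>
  Strictly pseudoconvex domains whose boundary need not be smooth everywhere: near every
  boundary point the domain is a sublevel set of a \<open>C\<^sup>2\<close> strictly plurisubharmonic function,
  which may have critical points. A \<open>C\<^sup>2\<close> boundary with positive definite Levi form is
  covered, by taking \<open>r = exp (A * \<rho>) - 1\<close> for a local defining function \<open>\<rho>\<close> and large \<open>A\<close>.
  Boundedness is not required.
\<close>

definition strictly_pseudoconvex_domain :: "(complex ^ 'n) set \<Rightarrow> bool" where
  "strictly_pseudoconvex_domain \<Omega> \<longleftrightarrow>
     open \<Omega> \<and> connected \<Omega> \<and>
     (\<forall>q \<in> frontier \<Omega>. \<exists>U r. open U \<and> q \<in> U \<and> strictly_psh_on r U \<and> \<Omega> \<inter> U = {z\<in>U. r z < 0})"

text \<open>The boundary is given by the defining function \<open>\<rho>\<close> in the following two notions.\<close>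

definition characteristic_at ::
  "nat \<Rightarrow> (('n \<Rightarrow> nat) \<Rightarrow> complex ^ 'n \<Rightarrow> complex) \<Rightarrow> (complex ^ 'n \<Rightarrow> real) \<Rightarrow> complex ^ 'n \<Rightarrow> bool"
  where "characteristic_at m a \<rho> p \<longleftrightarrow> principal_symbol m a p (hol_grad (cplx \<rho>) p) = 0"

definition simply_characteristic_at ::
  "nat \<Rightarrow> (('n \<Rightarrow> nat) \<Rightarrow> complex ^ 'n \<Rightarrow> complex) \<Rightarrow> (complex ^ 'n \<Rightarrow> real) \<Rightarrow> complex ^ 'n \<Rightarrow> bool"
  where "simply_characteristic_at m a \<rho> p \<longleftrightarrow>
     characteristic_at m a \<rho> p \<and>
     (\<chi> j. symbol_dzeta m a j p (hol_grad (cplx \<rho>) p)) \<noteq> 0"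

definition everywhere_characteristic_hypersurface ::
  "nat \<Rightarrow> (('n \<Rightarrow> nat) \<Rightarrow> complex ^ 'n \<Rightarrow> complex) \<Rightarrow> (complex ^ 'n) set \<Rightarrow> (complex ^ 'n) set \<Rightarrow> bool"
  where "everywhere_characteristic_hypersurface m a U S \<longleftrightarrow>
     (\<exists>f. cholomorphic_on f U \<and> S = {z\<in>U. f z = 0} \<and>
          (\<forall>z\<in>S. hol_grad f z \<noteq> 0) \<and>
          (\<forall>z\<in>S. principal_symbol m a z (hol_grad f z) = 0))"

definition strongly_P_convex_at ::
  "nat \<Rightarrow> (('n \<Rightarrow> nat) \<Rightarrow> complex ^ 'n \<Rightarrow> complex) \<Rightarrow> (complex ^ 'n) set \<Rightarrow> complex ^ 'n \<Rightarrow> bool"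
  where "strongly_P_convex_at m a \<Omega> p \<longleftrightarrow>
     (\<exists>U S. open U \<and> p \<in> U \<and> everywhere_characteristic_hypersurface m a U S \<and>
            S \<inter> closure \<Omega> \<inter> U = {p})"

text \<open>
  The coefficients \<open>q\<^sub>j\<^sub>,\<^sub>k\<close>, \<open>0 \<le> j,k \<le> n + 1\<close>: the extra index \<open>0\<close> is \<open>None\<close>, and the indices
  \<open>1,\<dots>,n + 1\<close> are \<open>Some j\<close>, so that vectors of \<open>\<complex>\<^sup>n\<^sup>+\<^sup>2\<close> have type \<open>complex ^ 'n option\<close>.
\<close>

fun pos_coeff ::
  "nat \<Rightarrow> (('n::finite \<Rightarrow> nat) \<Rightarrow> complex ^ 'n \<Rightarrow> complex) \<Rightarrow> (complex ^ 'n \<Rightarrow> real) \<Rightarrow>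
   complex ^ 'n \<Rightarrow> 'n option \<Rightarrow> 'n option \<Rightarrow> complex" where
  "pos_coeff m a \<rho> z (Some j) (Some k) = d_z j (d_zbar k (cplx \<rho>)) z"
| "pos_coeff m a \<rho> z (Some j) None =
     symbol_dz m a j z (hol_grad (cplx \<rho>) z) +
     (\<Sum>k\<in>UNIV. symbol_dzeta m a k z (hol_grad (cplx \<rho>) z) * d_z j (d_z k (cplx \<rho>)) z)"
| "pos_coeff m a \<rho> z None (Some j) =
     cnj (symbol_dz m a j z (hol_grad (cplx \<rho>) z) +
     (\<Sum>k\<in>UNIV. symbol_dzeta m a k z (hol_grad (cplx \<rho>) z) * d_z j (d_z k (cplx \<rho>)) z))"
| "pos_coeff m a \<rho> z None None =
     (\<Sum>j\<in>UNIV. \<Sum>k\<in>UNIV.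
        symbol_dzeta m a j z (hol_grad (cplx \<rho>) z) *
        cnj (symbol_dzeta m a k z (hol_grad (cplx \<rho>) z)) * d_z j (d_zbar k (cplx \<rho>)) z)"

definition pos_form ::
  "nat \<Rightarrow> (('n::finite \<Rightarrow> nat) \<Rightarrow> complex ^ 'n \<Rightarrow> complex) \<Rightarrow> (complex ^ 'n \<Rightarrow> real) \<Rightarrow>
   complex ^ 'n \<Rightarrow> complex ^ ('n option) \<Rightarrow> complex" where
  "pos_form m a \<rho> z t =
     (\<Sum>j\<in>UNIV. \<Sum>k\<in>UNIV. pos_coeff m a \<rho> z j k * t $ j * cnj (t $ k))"

text \<open>Again the form is Hermitian, so its values are real.\<close>

definition condition_Pos ::
  "nat \<Rightarrow> (('n::finite \<Rightarrow> nat) \<Rightarrow> complex ^ 'n \<Rightarrow> complex) \<Rightarrow> (complex ^ 'n \<Rightarrow> real) \<Rightarrow>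
   complex ^ 'n \<Rightarrow> bool" where
  "condition_Pos m a \<rho> p \<longleftrightarrow>
     (\<forall>t :: complex ^ ('n option).
        t \<noteq> 0 \<and> (\<Sum>j\<in>UNIV. d_z j (cplx \<rho>) p * t $ Some j) = 0 \<longrightarrow>
        Re (pos_form m a \<rho> p t) > 0)"

end

theory Submission
  imports Defs "HOL-Complex_Analysis.Cauchy_Integral_Formula"
begin

text \<open>
  Let \<open>v = \<partial>\<^sub>\<zeta> P\<^sub>m(p, \<partial>\<rho>(p))\<close>. Consider a holomorphic \<open>f\<close> near \<open>p\<close> with \<open>f(p) = 0\<close>, \<open>\<partial>f(p) = \<partial>\<rho>(p)\<close> and
  \<open>P\<^sub>m(z, \<partial>f) = 0\<close>. The hypersurface \<open>f = 0\<close> is tangent to \<open>\<partial>\<Omega>\<close> at \<open>p\<close>, and on it \<open>\<rho>\<close> is, up to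
  \<open>o(|t|\<^sup>2)\<close> with \<open>t = z - p\<close>, the real quadratic form \<open>Re A(t, t) + L(t, t)\<close>, where \<open>L\<close> is the Levi form of
  \<open>\<rho>\<close> at \<open>p\<close> and \<open>A\<close> is the difference of the holomorphic Hessians of \<open>\<rho>\<close> and \<open>f\<close>. If this form is
  positive on the complex tangent space, then \<open>\<rho> > 0\<close> on the hypersurface near \<open>p\<close> except at \<open>p\<close>, and the
  theorem follows. Thus the task is to choose the Hessian of \<open>f\<close>.

  It is not free: the equation \<open>P\<^sub>m(z, \<partial>f) = 0\<close>, differentiated at \<open>p\<close>, says that \<open>A v = b\<close> with
  \<open>b\<^sub>j = q\<^sub>j\<^sub>,\<^sub>0\<close>. Two facts settle the matter.

  \<^item> Linear algebra (\<open>symmetric_completion\<close>). Condition (Pos) bounds the linear form \<open>b\<close> on the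
    tangent space in the norm dual to \<open>L\<close> by the length of \<open>v\<close>. Therefore \<open>A\<close>, which is prescribed on all
    pairs that contain \<open>v\<close>, can be completed to a symmetric form with \<open>Re A + L > 0\<close>; this is the
    contraction completion of Parrott's theorem in a symmetric setting.

  \<^item> Existence (\<open>characteristic_function_with_prescribed_jet\<close>). The compatibility condition is the
    only obstruction: since \<open>v\<^sub>i \<noteq> 0\<close> for some \<open>i\<close>, the hyperplane \<open>z\<^sub>i = p\<^sub>i\<close> is noncharacteristic for the
    nonlinear equation \<open>P\<^sub>m(z, \<partial>f) = 0\<close>, and the Cauchy problem with the quadratic initial data can be
    solved. The solution is found as a fixed point in a space of holomorphic functions whose norm carries a
    power of the distance to the boundary of a wedge (\<open>fixed_point_exists\<close>). This weight absorbs the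
    loss of derivatives, as in Nagumo's and Walter's proofs of the Cauchy-Kovalevskaya theorem.
\<close>

section \<open>Holomorphic functions of several variables\<close>

lemma norm_vector_smult: "norm (c *s v) = norm c * norm v" for v :: "complex ^ 'n"
  by (simp add: norm_vec_def L2_set_right_distrib norm_mult)

lemma norm_axis_one [simp]: "norm (axis j (1::complex)) = 1"
  by (simp add: norm_eq_1 inner_axis_axis)

lemma vec_eq_sum_axis: "v = (\<Sum>j\<in>UNIV. v $ j *s axis j 1)" for v :: "complex ^ 'n"
  by (simp add: basis_expansion)

lemma cholomorphic_on_subset: "cholomorphic_on f U \<Longrightarrow> V \<subseteq> U \<Longrightarrow> cholomorphic_on f V"
  unfolding cholomorphic_on_def by blast

lemma complex_linear_form_expand:
  fixes f' :: "complex ^ 'n \<Rightarrow> complex"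
  assumes "linear f'" "\<And>c v. f' (c *s v) = c * f' v"
  shows "f' v = (\<Sum>j\<in>UNIV. f' (axis j 1) * v $ j)"
proof -
  have "f' v = f' (\<Sum>j\<in>UNIV. v $ j *s axis j 1)"
    by (subst vec_eq_sum_axis) simp
  also have "\<dots> = (\<Sum>j\<in>UNIV. f' (v $ j *s axis j 1))"
    using assms(1) by (simp add: linear_sum)
  finally show ?thesis by (simp add: assms(2) mult.commute)
qed

lemma d_z_eqI:
  assumes "(f has_derivative f') (at z)" "\<And>c v. f' (c *s v) = c * f' v"
  shows "d_z j f z = f' (axis j 1)"
proof -
  have "frechet_derivative f (at z) = f'"
    using assms(1) frechet_derivative_at by metis
  moreover have "axis j \<i> = \<i> *s (axis j 1 :: complex ^ 'a)"
    by (simp add: vec_eq_iff axis_def)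
  ultimately show ?thesis
    unfolding d_z_def by (simp add: assms(2))
qed

lemma d_z_eq_coeff:
  assumes "(f has_derivative (\<lambda>v. \<Sum>j\<in>UNIV. c j * v $ j)) (at z)"
  shows "d_z j f z = c j"
proof -
  have "d_z j f z = (\<Sum>k\<in>UNIV. c k * axis j 1 $ k)"
    by (rule d_z_eqI[OF assms]) (simp add: sum_distrib_left algebra_simps)
  also have "\<dots> = (\<Sum>k\<in>UNIV. if k = j then c k else 0)"
    by (rule sum.cong) (auto simp: axis_def)
  finally show ?thesis by simp
qed

text \<open>
  A complex linear form on \<open>\<complex>\<^sup>n\<close> is determined by its values on the unit vectors, so the
  differential of a holomorphic function is the form with coefficients \<open>d_z j f z\<close>. All later
  computations with differentials refer to this normal form.
\<close>

lemma cholomorphic_on_has_derivative: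
  assumes "cholomorphic_on f U" "z \<in> U"
  shows "(f has_derivative (\<lambda>v. \<Sum>j\<in>UNIV. d_z j f z * v $ j)) (at z)"
proof -
  obtain f' where f': "(f has_derivative f') (at z)" "\<And>c v. f' (c *s v) = c * f' v"
    using assms unfolding cholomorphic_on_def by blast
  have "f' v = (\<Sum>j\<in>UNIV. d_z j f z * v $ j)" for v
    unfolding d_z_eqI[OF f']
    by (rule complex_linear_form_expand[OF has_derivative_linear[OF f'(1)] f'(2)])
  then have "f' = (\<lambda>v. \<Sum>j\<in>UNIV. d_z j f z * v $ j)" by (rule ext)
  then show ?thesis using f'(1) by simp
qed

lemma cholomorphic_onI:
  assumes "\<And>z. z \<in> U \<Longrightarrow> (f has_derivative (\<lambda>v. \<Sum>j\<in>UNIV. c z j * v $ j)) (at z)"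
  shows "cholomorphic_on f U"
  unfolding cholomorphic_on_def
  by (intro ballI exI conjI, rule assms) (auto simp: sum_distrib_left algebra_simps)

lemma cholomorphic_on_imp_continuous_on:
  "cholomorphic_on f U \<Longrightarrow> continuous_on U f"
  unfolding cholomorphic_on_def
  by (meson continuous_at_imp_continuous_on has_derivative_continuous)

named_theorems chol_intros

lemma cholomorphic_on_const [chol_intros]: "cholomorphic_on (\<lambda>z. c) U"
  unfolding cholomorphic_on_def by (intro ballI exI[of _ "\<lambda>_. 0"]) auto

lemma cholomorphic_on_nth [chol_intros]: "cholomorphic_on (\<lambda>z. z $ j) U"
  unfolding cholomorphic_on_def
  by (intro ballI exI[of _ "\<lambda>v. v $ j"])
    (auto intro!: bounded_linear_imp_has_derivative bounded_linear_vec_nth)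

lemma cholomorphic_on_add [chol_intros]:
  assumes "cholomorphic_on f U" "cholomorphic_on g U"
  shows "cholomorphic_on (\<lambda>z. f z + g z) U"
proof (rule cholomorphic_onI[where c = "\<lambda>z j. d_z j f z + d_z j g z"])
  fix z assume "z \<in> U"
  from has_derivative_add[OF assms[THEN cholomorphic_on_has_derivative, OF this]]
  show "((\<lambda>z. f z + g z) has_derivative (\<lambda>v. \<Sum>j\<in>UNIV. (d_z j f z + d_z j g z) * v $ j)) (at z)"
    by (simp add: sum.distrib distrib_right)
qed

lemma cholomorphic_on_mult [chol_intros]:
  assumes "cholomorphic_on f U" "cholomorphic_on g U"
  shows "cholomorphic_on (\<lambda>z. f z * g z) U"
proof (rule cholomorphic_onI[where c = "\<lambda>z j. f z * d_z j g z + d_z j f z * g z"])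
  fix z assume "z \<in> U"
  have "(\<lambda>h. f z * (\<Sum>j\<in>UNIV. d_z j g z * h $ j) + (\<Sum>j\<in>UNIV. d_z j f z * h $ j) * g z)
     = (\<lambda>v. \<Sum>j\<in>UNIV. (f z * d_z j g z + d_z j f z * g z) * v $ j)"
    by (rule ext) (simp add: sum.distrib sum_distrib_left sum_distrib_right algebra_simps)
  with has_derivative_mult[OF assms[THEN cholomorphic_on_has_derivative, OF \<open>z \<in> U\<close>]]
  show "((\<lambda>z. f z * g z) has_derivative
      (\<lambda>v. \<Sum>j\<in>UNIV. (f z * d_z j g z + d_z j f z * g z) * v $ j)) (at z)"
    by simp
qed

lemma cholomorphic_on_diff [chol_intros]:
  assumes "cholomorphic_on f U" "cholomorphic_on g U"
  shows "cholomorphic_on (\<lambda>z. f z - g z) U"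
  using cholomorphic_on_add[OF assms(1) cholomorphic_on_mult[OF cholomorphic_on_const assms(2), of "-1"]]
  by simp

lemma cholomorphic_on_divide_const [chol_intros]:
  "cholomorphic_on f U \<Longrightarrow> cholomorphic_on (\<lambda>z. f z / c) U"
  using cholomorphic_on_mult[OF cholomorphic_on_const, of f U "1 / c"] by simp

lemma cholomorphic_on_sum [chol_intros]:
  "(\<And>i. i \<in> I \<Longrightarrow> cholomorphic_on (f i) U) \<Longrightarrow> cholomorphic_on (\<lambda>z. \<Sum>i\<in>I. f i z) U"
  by (induction I rule: infinite_finite_induct) (auto intro!: chol_intros)

lemma cholomorphic_on_prod [chol_intros]:
  "(\<And>i. i \<in> I \<Longrightarrow> cholomorphic_on (f i) U) \<Longrightarrow> cholomorphic_on (\<lambda>z. \<Prod>i\<in>I. f i z) U"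
  by (induction I rule: infinite_finite_induct) (auto intro!: chol_intros)

lemma cholomorphic_on_power [chol_intros]:
  "cholomorphic_on f U \<Longrightarrow> cholomorphic_on (\<lambda>z. f z ^ k) U"
  by (induction k) (auto intro!: chol_intros)

lemma has_derivative_vec_lambda:
  fixes f :: "'a::real_normed_vector \<Rightarrow> 'b::real_normed_vector ^ 'n"
  assumes "\<And>j. ((\<lambda>x. f x $ j) has_derivative f' j) (at x within S)"
  shows "(f has_derivative (\<lambda>v. \<chi> j. f' j v)) (at x within S)"
  unfolding has_derivative_within
proof safe
  show "bounded_linear (\<lambda>v. \<chi> j. f' j v)"
  proof -
    have bl: "bounded_linear (f' j)" for j
      using assms has_derivative_bounded_linear by blast
    then have "\<forall>j. \<exists>K. \<forall>v. norm (f' j v) \<le> norm v * K"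
      using bounded_linear.bounded by blast
    then obtain K where K: "\<And>j v. norm (f' j v) \<le> norm v * K j"
      by metis
    show ?thesis
    proof (rule bounded_linear_intro[where K = "\<Sum>j\<in>UNIV. K j"])
      show "norm (\<chi> j. f' j v) \<le> norm v * (\<Sum>j\<in>UNIV. K j)" for v
      proof -
        have "norm (\<chi> j. f' j v) \<le> (\<Sum>j\<in>UNIV. norm (f' j v))"
          unfolding norm_vec_def by (rule order_trans[OF L2_set_le_sum]) auto
        also have "\<dots> \<le> (\<Sum>j\<in>UNIV. norm v * K j)"
          by (rule sum_mono) (rule K)
        finally show ?thesis by (simp add: sum_distrib_left)
      qed
      show "(\<chi> j. f' j (x + y)) = (\<chi> j. f' j x) + (\<chi> j. f' j y)" for x y
        by (simp add: vec_eq_iff linear_add[OF bounded_linear.linear[OF bl]])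
      show "(\<chi> j. f' j (c *\<^sub>R x)) = c *\<^sub>R (\<chi> j. f' j x)" for c x
        by (simp add: vec_eq_iff linear_cmul[OF bounded_linear.linear[OF bl]])
    qed
  qed
  show "((\<lambda>y. (1 / norm (y - x)) *\<^sub>R (f y - (f x + (\<chi> j. f' j (y - x))))) \<longlongrightarrow> 0) (at x within S)"
    using assms[unfolded has_derivative_within, THEN conjunct2] by (intro vec_tendstoI) simp
qed

lemma has_derivative_compose_coords:
  assumes "cholomorphic_on F V" "\<phi> z \<in> V"
    and "\<And>k. ((\<lambda>z. \<phi> z $ k) has_derivative \<phi>' k) (at z)"
  shows "((\<lambda>z. F (\<phi> z)) has_derivative (\<lambda>v. \<Sum>k\<in>UNIV. d_z k F (\<phi> z) * \<phi>' k v)) (at z)"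
proof -
  have "(\<phi> has_derivative (\<lambda>v. \<chi> k. \<phi>' k v)) (at z)"
    by (rule has_derivative_vec_lambda) (rule assms(3))
  from has_derivative_compose[OF this cholomorphic_on_has_derivative[OF assms(1,2)]]
  show ?thesis by simp
qed

lemma cholomorphic_on_compose:
  assumes "cholomorphic_on F V" "\<And>z. z \<in> U \<Longrightarrow> \<phi> z \<in> V"
    and coord: "\<And>k. cholomorphic_on (\<lambda>z. \<phi> z $ k) U"
  shows "cholomorphic_on (\<lambda>z. F (\<phi> z)) U"
proof (rule cholomorphic_onI)
  fix z assume "z \<in> U"
  have "((\<lambda>z. F (\<phi> z)) has_derivative
      (\<lambda>v. \<Sum>k\<in>UNIV. d_z k F (\<phi> z) * (\<Sum>j\<in>UNIV. d_z j (\<lambda>z. \<phi> z $ k) z * v $ j))) (at z)"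
    by (rule has_derivative_compose_coords[where \<phi> = \<phi> and z = z, OF assms(1) assms(2)[OF \<open>z \<in> U\<close>]])
      (rule cholomorphic_on_has_derivative[OF coord \<open>z \<in> U\<close>])
  moreover have "(\<lambda>v. \<Sum>k\<in>UNIV. d_z k F (\<phi> z) * (\<Sum>j\<in>UNIV. d_z j (\<lambda>z. \<phi> z $ k) z * v $ j))
     = (\<lambda>v. \<Sum>j\<in>UNIV. (\<Sum>k\<in>UNIV. d_z k F (\<phi> z) * d_z j (\<lambda>z. \<phi> z $ k) z) * v $ j)"
    by (rule ext, simp add: sum_distrib_left sum_distrib_right mult.assoc)
       (rule sum.swap)
  ultimately show "((\<lambda>z. F (\<phi> z)) has_derivative
      (\<lambda>v. \<Sum>j\<in>UNIV. (\<Sum>k\<in>UNIV. d_z k F (\<phi> z) * d_z j (\<lambda>z. \<phi> z $ k) z) * v $ j)) (at z)"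
    by simp
qed

lemma has_derivative_smult_left: "((\<lambda>c. z + c *s v) has_derivative (\<lambda>c. c *s v)) (at x within S)"
  for v :: "complex ^ 'n"
proof -
  have "bounded_linear (\<lambda>c. c *s v)"
    by (rule bounded_linear_intro[where K = "norm v"])
      (auto simp: vec_eq_iff norm_vector_smult algebra_simps)
  then show ?thesis
    using has_derivative_add[OF has_derivative_const bounded_linear_imp_has_derivative]
    by fastforce
qed

lemma line_has_field_derivative:
  assumes "cholomorphic_on f U" "z + c *s v \<in> U"
  shows "((\<lambda>c. f (z + c *s v)) has_field_derivative (\<Sum>j\<in>UNIV. d_z j f (z + c *s v) * v $ j)) (at c)"
proof -
  have "((\<lambda>c. f (z + c *s v)) has_derivative (\<lambda>c'. \<Sum>j\<in>UNIV. d_z j f (z + c *s v) * (c' *s v) $ j)) (at c)"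
    using has_derivative_compose[OF has_derivative_smult_left cholomorphic_on_has_derivative[OF assms]]
    by simp
  moreover have "(\<lambda>c'. \<Sum>j\<in>UNIV. d_z j f (z + c *s v) * (c' *s v) $ j)
     = (*) (\<Sum>j\<in>UNIV. d_z j f (z + c *s v) * v $ j)"
    by (rule ext) (simp add: sum_distrib_left sum_distrib_right algebra_simps)
  ultimately show ?thesis
    unfolding has_field_derivative_def by simp
qed

text \<open>
  The one-variable Cauchy inequality on the complex line through \<open>z\<close> in direction \<open>v\<close>. It bounds
  the differential itself, in all directions at once, without passing through coordinates.
\<close>

lemma cauchy_estimate_direction:
  assumes "cholomorphic_on f U" "0 < s" "\<And>c. cmod c \<le> s \<Longrightarrow> z + c *s v \<in> U"
    and "\<And>c. cmod c \<le> s \<Longrightarrow> cmod (f (z + c *s v)) \<le> M"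
  shows "cmod (\<Sum>j\<in>UNIV. d_z j f z * v $ j) \<le> M / s"
proof -
  let ?g = "\<lambda>c. f (z + c *s v)"
  have der: "(?g has_field_derivative (\<Sum>j\<in>UNIV. d_z j f (z + c *s v) * v $ j)) (at c)"
    if "cmod c \<le> s" for c
    by (rule line_has_field_derivative[OF assms(1) assms(3)[OF that]])
  have "cmod ((deriv ^^ 1) ?g 0) \<le> fact 1 * M / s ^ 1"
  proof (rule Cauchy_inequality)
    show "?g holomorphic_on ball 0 s"
      unfolding holomorphic_on_open[OF open_ball] using der less_imp_le mem_ball_0 by blast
    show "continuous_on (cball 0 s) ?g"
      by (rule DERIV_continuous_on) (auto intro: has_field_derivative_at_within der)
  qed (use assms in auto)
  moreover have "deriv ?g 0 = (\<Sum>j\<in>UNIV. d_z j f z * v $ j)"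
    using DERIV_imp_deriv[OF der[of 0]] assms(2) by simp
  ultimately show ?thesis by simp
qed

lemma sum_axis_right: "(\<Sum>k\<in>UNIV. c k * axis j 1 $ k) = (c j :: complex)"
proof -
  have "(\<Sum>k\<in>UNIV. c k * axis j 1 $ k) = (\<Sum>k\<in>UNIV. if k = j then c k else 0)"
    by (rule sum.cong) (auto simp: axis_def)
  then show ?thesis by simp
qed

lemma cauchy_estimate_d_z:
  assumes "cholomorphic_on f U" "0 < s" "\<And>c. cmod c \<le> s \<Longrightarrow> z + c *s axis j 1 \<in> U"
    and "\<And>c. cmod c \<le> s \<Longrightarrow> cmod (f (z + c *s axis j 1)) \<le> M"
  shows "cmod (d_z j f z) \<le> M / s"
  using cauchy_estimate_direction[OF assms] by (simp add: sum_axis_right)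

lemma d_z_diff:
  assumes "cholomorphic_on f U" "cholomorphic_on g U" "z \<in> U"
  shows "d_z j (\<lambda>z. f z - g z) z = d_z j f z - d_z j g z"
  using has_derivative_diff[OF assms(1,2)[THEN cholomorphic_on_has_derivative, OF assms(3)]]
  by (intro d_z_eq_coeff) (simp add: sum_subtractf left_diff_distrib)

lemma d_z_add:
  assumes "cholomorphic_on f U" "cholomorphic_on g U" "z \<in> U"
  shows "d_z j (\<lambda>z. f z + g z) z = d_z j f z + d_z j g z"
  using has_derivative_add[OF assms(1,2)[THEN cholomorphic_on_has_derivative, OF assms(3)]]
  by (intro d_z_eq_coeff) (simp add: sum.distrib distrib_right)

text \<open>
  Cauchy estimates turn uniform convergence of the functions on the large ball into uniform
  convergence of the differentials, as linear maps, on the ball of half the radius; then the limit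
  may be differentiated term by term.
\<close>

lemma cholomorphic_uniform_limit_local:
  fixes f :: "nat \<Rightarrow> complex ^ 'n \<Rightarrow> complex"
  assumes hol: "\<And>n. cholomorphic_on (f n) U" and "\<rho> > 0" "cball z0 \<rho> \<subseteq> U"
    and lim: "uniform_limit (cball z0 \<rho>) f g sequentially"
  shows "\<exists>c. (g has_derivative (\<lambda>v. \<Sum>j\<in>UNIV. c j * v $ j)) (at z0)"
proof -
  define S where "S = ball z0 (\<rho> / 2)"
  define D where "D n x v = (\<Sum>j\<in>UNIV. d_z j (f n) x * v $ j)" for n x and v :: "complex ^ 'n"
  have SU: "x \<in> U" if "x \<in> S" for x
    using that assms(2,3) by (auto simp: S_def)
  have est: "cmod (D m x v - D n x v) \<le> 2 * e / \<rho> * norm v"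
    if "x \<in> S" "\<And>y. y \<in> cball z0 \<rho> \<Longrightarrow> cmod (f m y - f n y) \<le> e" for m n x v e
  proof (cases "v = 0")
    case False
    define s where "s = \<rho> / (2 * norm v)"
    have in_cball: "x + c *s v \<in> cball z0 \<rho>" if "cmod c \<le> s" for c
    proof -
      have "norm (c *s v) \<le> \<rho> / 2"
        using that False \<open>\<rho> > 0\<close> by (simp add: norm_vector_smult s_def field_simps)
      moreover have "dist z0 (x + c *s v) \<le> dist z0 x + norm (c *s v)"
        using norm_triangle_ineq4[of "z0 - x" "c *s v"] by (simp add: dist_norm algebra_simps)
      ultimately show ?thesis
        using \<open>x \<in> S\<close> by (simp add: S_def)
    qed
    have "cmod (\<Sum>j\<in>UNIV. d_z j (\<lambda>y. f m y - f n y) x * v $ j) \<le> e / s"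
    proof (rule cauchy_estimate_direction)
      show "cholomorphic_on (\<lambda>y. f m y - f n y) U"
        by (intro chol_intros hol)
    qed (use in_cball that assms(3) False \<open>\<rho> > 0\<close> in \<open>auto simp: s_def\<close>)
    moreover have "e / s = 2 * e / \<rho> * norm v"
      using False \<open>\<rho> > 0\<close> by (simp add: s_def field_simps)
    moreover have "(\<Sum>j\<in>UNIV. d_z j (\<lambda>y. f m y - f n y) x * v $ j) = D m x v - D n x v"
      by (simp add: D_def d_z_diff[OF hol hol SU[OF \<open>x \<in> S\<close>]] left_diff_distrib sum_subtractf)
    ultimately show ?thesis by simp
  qed (simp add: D_def)
  have cau: "\<exists>N. \<forall>m\<ge>N. \<forall>n\<ge>N. \<forall>x\<in>S. \<forall>v. cmod (D m x v - D n x v) \<le> e * norm v"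
    if "e > 0" for e
  proof -
    have "uniformly_convergent_on (cball z0 \<rho>) f"
      using lim by (auto simp: uniformly_convergent_on_def)
    then have "uniformly_Cauchy_on (cball z0 \<rho>) f"
      by (rule uniformly_convergent_Cauchy)
    moreover have "e * \<rho> / 2 > 0" using \<open>\<rho> > 0\<close> \<open>e > 0\<close> by simp
    ultimately obtain N where N: "\<And>x m n. x \<in> cball z0 \<rho> \<Longrightarrow> m \<ge> N \<Longrightarrow> n \<ge> N \<Longrightarrow> dist (f m x) (f n x) < e * \<rho> / 2"
      unfolding uniformly_Cauchy_on_def by meson
    have "cmod (D m x v - D n x v) \<le> e * norm v" if "m \<ge> N" "n \<ge> N" "x \<in> S" for m n x v
      using est[of x m n "e * \<rho> / 2" v] N[OF _ that(1,2)] \<open>x \<in> S\<close> \<open>\<rho> > 0\<close>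
      by (auto simp: dist_norm less_imp_le)
    then show ?thesis by blast
  qed
  have "convergent (\<lambda>n. d_z j (f n) x)" if "x \<in> S" for x j
  proof (rule Cauchy_convergent, rule CauchyI)
    fix e :: real assume "e > 0"
    then obtain N where N: "\<And>m n v. m \<ge> N \<Longrightarrow> n \<ge> N \<Longrightarrow> cmod (D m x v - D n x v) \<le> e / 2 * norm v"
      using cau[of "e / 2"] \<open>x \<in> S\<close> by (metis half_gt_zero)
    have "cmod (d_z j (f m) x - d_z j (f n) x) < e" if "m \<ge> N" "n \<ge> N" for m n
      using N[OF that, of "axis j 1"] \<open>e > 0\<close> by (simp add: D_def sum_axis_right)
    then show "\<exists>M. \<forall>m\<ge>M. \<forall>n\<ge>M. cmod (d_z j (f m) x - d_z j (f n) x) < e" by blast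
  qed
  then have "\<exists>c. \<forall>x\<in>S. \<forall>j. (\<lambda>n. d_z j (f n) x) \<longlonglongrightarrow> c x j"
    unfolding convergent_def by metis
  then obtain c where c: "\<And>x j. x \<in> S \<Longrightarrow> (\<lambda>n. d_z j (f n) x) \<longlonglongrightarrow> c x j" by blast
  define g' where "g' x v = (\<Sum>j\<in>UNIV. c x j * v $ j)" for x and v :: "complex ^ 'n"
  have D_lim: "(\<lambda>n. D n x v) \<longlonglongrightarrow> g' x v" if "x \<in> S" for x v
    unfolding D_def g'_def by (intro tendsto_intros c that)
  have z0: "z0 \<in> S" using \<open>\<rho> > 0\<close> by (simp add: S_def)
  have gl: "(\<lambda>n. f n x) \<longlonglongrightarrow> g x" if "x \<in> S" for x
    using that \<open>\<rho> > 0\<close> by (intro tendsto_uniform_limitI[OF lim]) (simp add: S_def)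
  have "\<exists>g2. \<forall>x\<in>S. (\<lambda>n. f n x) \<longlonglongrightarrow> g2 x \<and> (g2 has_derivative g' x) (at x within S)"
  proof (rule has_derivative_sequence[where ?x0.0 = z0 and l = "g z0"])
    show "convex S" by (simp add: S_def)
    show "(f n has_derivative D n x) (at x within S)" if "x \<in> S" for n x
      unfolding D_def
      by (rule has_derivative_at_withinI, rule cholomorphic_on_has_derivative[OF hol SU[OF that]])
    show "\<forall>\<^sub>F n in sequentially. \<forall>x\<in>S. \<forall>h. cmod (D n x h - g' x h) \<le> e * norm h" if "e > 0" for e
    proof -
      obtain N where N: "\<And>m n x v. m \<ge> N \<Longrightarrow> n \<ge> N \<Longrightarrow> x \<in> S \<Longrightarrow> cmod (D m x v - D n x v) \<le> e * norm v"
        using cau[OF \<open>e > 0\<close>] by blast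
      have "cmod (D n x h - g' x h) \<le> e * norm h" if "n \<ge> N" "x \<in> S" for n x h
      proof (rule Lim_bounded)
        show "(\<lambda>m. cmod (D n x h - D m x h)) \<longlonglongrightarrow> cmod (D n x h - g' x h)"
          by (intro tendsto_intros D_lim that)
        show "\<forall>m\<ge>N. cmod (D n x h - D m x h) \<le> e * norm h"
          using N that by blast
      qed
      then show ?thesis by (auto simp: eventually_sequentially)
    qed
  qed (use z0 gl[OF z0] in auto)
  then obtain g2 where g2: "\<And>x. x \<in> S \<Longrightarrow> (\<lambda>n. f n x) \<longlonglongrightarrow> g2 x"
    "\<And>x. x \<in> S \<Longrightarrow> (g2 has_derivative g' x) (at x within S)" by blast
  have "g2 x = g x" if "x \<in> S" for x
    by (rule LIMSEQ_unique[OF g2(1)[OF that] gl[OF that]])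
  then have "(g has_derivative g' z0) (at z0 within S)"
    using has_derivative_transform[OF z0 _ g2(2)[OF z0]] by simp
  then have "(g has_derivative g' z0) (at z0)"
    using at_within_open[of z0 S] z0 by (simp add: S_def del: mem_ball)
  then show ?thesis
    unfolding g'_def by blast
qed

lemma cholomorphic_uniform_limit:
  fixes f :: "nat \<Rightarrow> complex ^ 'n \<Rightarrow> complex"
  assumes "\<And>n. cholomorphic_on (f n) U"
    and "\<And>z. z \<in> U \<Longrightarrow> \<exists>\<rho>>0. cball z \<rho> \<subseteq> U \<and> uniform_limit (cball z \<rho>) f g sequentially"
  shows "cholomorphic_on g U"
proof -
  have "\<forall>z\<in>U. \<exists>c. (g has_derivative (\<lambda>v. \<Sum>j\<in>UNIV. c j * v $ j)) (at z)"
  proof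
    fix z assume "z \<in> U"
    then obtain \<rho> where "\<rho> > 0" "cball z \<rho> \<subseteq> U" "uniform_limit (cball z \<rho>) f g sequentially"
      using assms(2) by blast
    from cholomorphic_uniform_limit_local[OF assms(1) this]
    show "\<exists>c. (g has_derivative (\<lambda>v. \<Sum>j\<in>UNIV. c j * v $ j)) (at z)" by blast
  qed
  from bchoice[OF this] obtain c
    where "\<And>z. z \<in> U \<Longrightarrow> (g has_derivative (\<lambda>v. \<Sum>j\<in>UNIV. c z j * v $ j)) (at z)" by blast
  then show ?thesis by (rule cholomorphic_onI)
qed

lemma cholomorphic_on_shift:
  assumes "cholomorphic_on f U" "\<And>z. z \<in> V \<Longrightarrow> z + c \<in> U"
  shows "cholomorphic_on (\<lambda>z. f (z + c)) V"
  by (rule cholomorphic_on_compose[OF assms]) (auto intro!: chol_intros)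

text \<open>
  A partial derivative is a locally uniform limit of difference quotients, which are holomorphic
  functions of \<open>z\<close>. Uniformity comes from Taylor's formula on complex lines, where a Cauchy estimate
  controls the second derivative by the supremum of \<open>f\<close>.
\<close>

lemma cholomorphic_on_d_z:
  assumes "open U" "cholomorphic_on f U"
  shows "cholomorphic_on (d_z j f) U"
proof -
  have "\<exists>s>0. cholomorphic_on (d_z j f) (ball z0 s)" if z0: "z0 \<in> U" for z0
  proof -
    \<comment> \<open>Room for a base point at distance \<open>s\<close>, a shift of length \<open>s\<close>, and a Cauchy circle of radius \<open>s\<close>.\<close>
    obtain s where s: "s > 0" "cball z0 (3 * s) \<subseteq> U"
    proof -
      obtain e where "e > 0" "cball z0 e \<subseteq> U"
        using \<open>open U\<close> z0 open_contains_cball by blast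
      then show ?thesis using that[of "e / 3"] by simp
    qed
    have "compact (f ` cball z0 (3 * s))"
      using cholomorphic_on_imp_continuous_on[OF assms(2)] s
      by (intro compact_continuous_image) (auto intro: continuous_on_subset)
    then obtain M where M: "\<And>x. x \<in> cball z0 (3 * s) \<Longrightarrow> cmod (f x) \<le> M"
      by (meson bounded_iff compact_imp_bounded imageI)
    define h where "h n = s / (real n + 1)" for n :: nat
    have h: "0 < h n" "h n \<le> s" for n
      using s by (auto simp: h_def field_simps)
    define q where "q n z = (f (z + complex_of_real (h n) *s axis j 1) - f z) / complex_of_real (h n)" for n z
    have near: "z + c *s axis j 1 \<in> cball z0 (3 * s)"
      if "z \<in> ball z0 s" "cmod c \<le> 2 * s" for z c
    proof -
      have "dist z0 (z + c *s axis j 1) \<le> dist z0 z + norm (c *s axis j (1::complex) :: complex ^ 'a)"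
        using norm_triangle_ineq4[of "z0 - z" "c *s axis j 1"] by (simp add: dist_norm algebra_simps)
      then show ?thesis using that by (simp add: norm_vector_smult)
    qed
    have tay: "cmod (q n z - d_z j f z) \<le> 2 * M / s^2 * h n" if z: "z \<in> ball z0 s" for n z
    proof -
      define \<phi> where "\<phi> c = f (z + c *s axis j 1)" for c
      have der: "(\<phi> has_field_derivative d_z j f (z + c *s axis j 1)) (at c)"
        if "cmod c \<le> 2 * s" for c
        using line_has_field_derivative[OF assms(2), of z c "axis j 1"] near[OF z that] s
        by (auto simp: sum_axis_right \<phi>_def[abs_def])
      have holo: "\<phi> holomorphic_on ball 0 (2 * s)"
        unfolding holomorphic_on_open[OF open_ball] using der less_imp_le mem_ball_0 by blast
      have cont: "continuous_on (cball 0 (2 * s)) \<phi>"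
        by (rule DERIV_continuous_on) (auto intro: has_field_derivative_at_within der)
      have sub: "cball c s \<subseteq> cball 0 (2 * s)" if "cmod c \<le> s" for c
        using that by (simp add: cball_subset_cball_iff)
      have "cmod ((deriv ^^ 0) \<phi> (h n) - (\<Sum>i\<le>1. (deriv ^^ i) \<phi> 0 * (complex_of_real (h n) - 0) ^ i / fact i))
        \<le> (2 * M / s^2) * cmod (complex_of_real (h n) - 0) ^ (Suc 1) / fact 1"
      proof (rule complex_Taylor)
        show "convex (cball (0::complex) s)" by simp
        fix i c assume "c \<in> cball (0::complex) s"
        then have c: "c \<in> ball 0 (2 * s)" using s by auto
        show "((deriv ^^ i) \<phi> has_field_derivative (deriv ^^ Suc i) \<phi> c) (at c within cball 0 s)"
          using holomorphic_derivI[OF holomorphic_higher_deriv[OF holo] _ c, of i]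
          by simp
      next
        fix c assume c: "c \<in> cball (0::complex) s"
        have "cmod ((deriv ^^ 2) \<phi> c) \<le> fact 2 * M / s ^ 2"
        proof (rule Cauchy_inequality)
          show "\<phi> holomorphic_on ball c s"
          proof (rule holomorphic_on_subset[OF holo])
            show "ball c s \<subseteq> ball 0 (2 * s)"
              using c by (simp add: ball_subset_ball_iff)
          qed
          show "continuous_on (cball c s) \<phi>"
            using cont sub c by (auto intro: continuous_on_subset)
          show "cmod (\<phi> x) \<le> M" if "cmod (c - x) = s" for x
            unfolding \<phi>_def using sub[of c] c that
            by (intro M near[OF z]) (auto simp: dist_norm subset_iff)
        qed (use s in auto)
        then show "cmod ((deriv ^^ Suc 1) \<phi> c) \<le> 2 * M / s ^ 2"
          by (simp add: numeral_2_eq_2)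
      qed (use h[of n] s in auto)
      moreover have "deriv \<phi> 0 = d_z j f z"
        using DERIV_imp_deriv[OF der[of 0]] s by simp
      moreover have "complex_of_real (h n) * (q n z - d_z j f z) = \<phi> (h n) - (\<phi> 0 + d_z j f z * complex_of_real (h n))"
        using h(1)[of n] by (simp add: q_def \<phi>_def field_simps)
      ultimately have "cmod (complex_of_real (h n) * (q n z - d_z j f z)) \<le> 2 * M / s^2 * (h n) ^ 2"
        using h[of n] by (simp add: power2_eq_square)
      then have "h n * cmod (q n z - d_z j f z) \<le> h n * (2 * M / s^2 * h n)"
        using h[of n] by (simp add: norm_mult power2_eq_square mult_ac)
      then show ?thesis
        using h(1)[of n] by (rule mult_left_le_imp_le)
    qed
    have "cholomorphic_on (d_z j f) (ball z0 s)"
    proof (rule cholomorphic_uniform_limit)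
      show "cholomorphic_on (q n) (ball z0 s)" for n
        unfolding q_def using near[of _ "complex_of_real (h n)"] near[of _ 0] s h[of n]
        by (intro chol_intros cholomorphic_on_shift[OF assms(2)] cholomorphic_on_subset[OF assms(2)]) auto
      fix z assume "z \<in> ball z0 s"
      then obtain \<rho> where \<rho>: "\<rho> > 0" "cball z \<rho> \<subseteq> ball z0 s"
        using open_contains_cball by blast
      have "uniform_limit (cball z \<rho>) q (d_z j f) sequentially"
      proof (rule uniform_limitI)
        fix e :: real assume "e > 0"
        have "(\<lambda>n. 2 * M / s^2 * (s * inverse (real (Suc n)))) \<longlonglongrightarrow> 2 * M / s^2 * (s * 0)"
          by (intro tendsto_mult tendsto_const LIMSEQ_inverse_real_of_nat)
        then have "(\<lambda>n. 2 * M / s^2 * h n) \<longlonglongrightarrow> 0"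
          by (simp add: h_def divide_inverse add.commute)
        then have "\<forall>\<^sub>F n in sequentially. 2 * M / s^2 * h n < e"
          using \<open>e > 0\<close> order_tendstoD(2) by fastforce
        then show "\<forall>\<^sub>F n in sequentially. \<forall>x\<in>cball z \<rho>. dist (q n x) (d_z j f x) < e"
        proof eventually_elim
          case (elim n)
          show ?case
          proof
            fix x assume "x \<in> cball z \<rho>"
            then have "cmod (q n x - d_z j f x) \<le> 2 * M / s^2 * h n"
              using \<rho> by (intro tay) auto
            also have "\<dots> < e" by (rule elim)
            finally show "dist (q n x) (d_z j f x) < e" by (simp add: dist_norm)
          qed
        qed
      qed
      with \<rho> show "\<exists>\<rho>>0. cball z \<rho> \<subseteq> ball z0 s \<and> uniform_limit (cball z \<rho>) q (d_z j f) sequentially"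
        by blast
    qed
    then show ?thesis using s by blast
  qed
  then show ?thesis
    unfolding cholomorphic_on_def by (metis centre_in_ball)
qed

lemma continuous_on_d_z:
  "open U \<Longrightarrow> cholomorphic_on f U \<Longrightarrow> continuous_on U (d_z j f)"
  by (intro cholomorphic_on_imp_continuous_on cholomorphic_on_d_z)

lemma d_z_cong_open:
  assumes "open U" "z \<in> U" "\<And>x. x \<in> U \<Longrightarrow> f x = g x"
  shows "d_z j f z = d_z j g z"
proof -
  have "(f has_derivative D) (at z) \<longleftrightarrow> (g has_derivative D) (at z)" for D
    using has_derivative_transform_within_open[OF _ assms(1,2)] assms(3) by metis
  then have "frechet_derivative f (at z) = frechet_derivative g (at z)"
    unfolding frechet_derivative_def by simp
  then show ?thesis by (simp add: d_z_def)
qed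

section \<open>Integration along one complex coordinate\<close>

text \<open>
  The primitive of \<open>w\<close> in the variable \<open>z\<^sub>i\<close> that vanishes on the hyperplane \<open>z\<^sub>i = p\<^sub>i\<close> is the integral
  of \<open>w\<close> over the segment from \<open>p\<^sub>i\<close> to \<open>z\<^sub>i\<close>, the other variables being fixed. Parametrised over
  \<open>[0, 1]\<close>, it is an integral with parameter \<open>z\<close> over a fixed interval.
\<close>

definition slide :: "'n \<Rightarrow> complex ^ 'n \<Rightarrow> real \<Rightarrow> complex ^ 'n \<Rightarrow> complex ^ 'n" where
  "slide i p t z = (\<chi> k. if k = i then p $ i + of_real t * (z $ i - p $ i) else z $ k)"

definition primitive ::
  "'n \<Rightarrow> complex ^ 'n \<Rightarrow> (complex ^ 'n \<Rightarrow> complex) \<Rightarrow> complex ^ 'n \<Rightarrow> complex" where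
  "primitive i p w z = (z $ i - p $ i) * integral {0..1} (\<lambda>t. w (slide i p t z))"

lemma slide_nth: "slide i p t z $ k = (if k = i then p $ i + of_real t * (z $ i - p $ i) else z $ k)"
  by (simp add: slide_def)

lemma slide_1 [simp]: "slide i p 1 z = z"
  by (simp add: vec_eq_iff slide_nth)

lemma continuous_on_slide [continuous_intros]:
  "continuous_on S f \<Longrightarrow> continuous_on S g \<Longrightarrow> continuous_on S (\<lambda>x. slide i p (f x) (g x))"
  unfolding slide_def
proof (rule continuous_on_vec_lambda)
  fix k assume "continuous_on S f" "continuous_on S g"
  then show "continuous_on S (\<lambda>x. if k = i then p $ i + of_real (f x) * (g x $ i - p $ i) else g x $ k)"
    by (cases "k = i") (simp_all add: continuous_intros)
qed

context
  fixes i :: "'n::finite" and p :: "complex ^ 'n" and U :: "(complex ^ 'n) set"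
  assumes opU: "open U" and cvU: "convex U"
    and slideU: "\<And>z t. z \<in> U \<Longrightarrow> t \<in> {0..1} \<Longrightarrow> slide i p t z \<in> U"
begin

lemma continuous_on_slide_integrand:
  assumes "cholomorphic_on w U" "z \<in> U"
  shows "continuous_on {0..1} (\<lambda>t. w (slide i p t z))"
  by (rule continuous_on_compose2[OF cholomorphic_on_imp_continuous_on[OF assms(1)]])
    (auto intro!: continuous_intros slideU assms)

text \<open>
  Differentiation under the integral sign. The factor \<open>t\<close> in the derivative with respect to \<open>z\<^sub>i\<close> is
  the inner derivative of \<open>t \<mapsto> p\<^sub>i + t (z\<^sub>i - p\<^sub>i)\<close>.
\<close>

lemma slide_integral_has_derivative:
  assumes w: "cholomorphic_on w U" and z: "z \<in> U"
  shows "((\<lambda>z. integral {0..1} (\<lambda>t. w (slide i p t z))) has_derivative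
    (\<lambda>v. \<Sum>j\<in>UNIV. integral {0..1} (\<lambda>t. d_z j w (slide i p t z) * (if j = i then of_real t else 1)) * v $ j)) (at z)"
proof -
  define c where "c j t = (if j = i then complex_of_real t else 1)" for j t
  define D where "D x t v = (\<Sum>j\<in>UNIV. d_z j w (slide i p t x) * (c j t * v $ j))"
    for x t and v :: "complex ^ 'n"
  have der: "((\<lambda>x. w (slide i p t x)) has_derivative D x t) (at x)" if "x \<in> U" "t \<in> {0..1}" for x t
    unfolding D_def
  proof (rule has_derivative_compose_coords[where \<phi> = "slide i p t" and z = x, OF w slideU[OF that]])
    show "((\<lambda>z. slide i p t z $ k) has_derivative (\<lambda>v. c k t * v $ k)) (at x)" for k
      unfolding slide_nth c_def
      by (auto intro!: derivative_eq_intros bounded_linear_imp_has_derivative bounded_linear_vec_nth)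
  qed
  have bl: "bounded_linear (D x t)" if "x \<in> U" "t \<in> {0..1}" for x t
    using der[OF that] has_derivative_bounded_linear by blast
  have contD: "continuous_on (U \<times> {0..1}) (\<lambda>y. D (fst y) (snd y) v)" for v
  proof -
    have "continuous_on (U \<times> {0..1}) (\<lambda>y. d_z j w (slide i p (snd y) (fst y)))" for j
      by (rule continuous_on_compose2[OF continuous_on_d_z[OF opU w]])
        (auto intro!: continuous_intros slideU)
    moreover have "continuous_on (U \<times> {0..1}) (\<lambda>y. c j (snd y))" for j
      unfolding c_def by (cases "j = i") (auto intro!: continuous_intros)
    ultimately show ?thesis
      unfolding D_def by (intro continuous_intros)
  qed
  define B where "B x t = Blinfun (D x t)" for x t
  have B: "blinfun_apply (B x t) = D x t" if "x \<in> U" "t \<in> {0..1}" for x t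
    unfolding B_def by (rule bounded_linear_Blinfun_apply[OF bl[OF that]])
  have contB: "continuous_on (U \<times> {0..1}) (\<lambda>(x, t). B x t)"
  proof (rule continuous_on_blinfun_componentwise)
    fix v :: "complex ^ 'n"
    have "continuous_on (U \<times> {0..1}) (\<lambda>y. D (fst y) (snd y) v)" by (rule contD)
    then show "continuous_on (U \<times> {0..1}) (\<lambda>x. blinfun_apply (case x of (x, t) \<Rightarrow> B x t) v)"
      by (rule continuous_on_eq) (auto simp: B)
  qed
  have L: "((\<lambda>x. integral (cbox 0 1) (\<lambda>t. w (slide i p t x))) has_derivative
      integral (cbox 0 1) (B z)) (at z within U)"
  proof (rule leibniz_rule)
    show "((\<lambda>x. w (slide i p t x)) has_derivative blinfun_apply (B x t)) (at x within U)"
      if "x \<in> U" "t \<in> cbox 0 1" for x t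
      using has_derivative_at_withinI[OF der[OF that(1)]] B[OF that(1)] that(2) by simp
    show "(\<lambda>t. w (slide i p t x)) integrable_on cbox 0 1" if "x \<in> U" for x
      using continuous_on_slide_integrand[OF w that] integrable_continuous_interval by simp
    show "continuous_on (U \<times> cbox 0 1) (\<lambda>(x, t). B x t)" using contB by simp
  qed (use cvU z in auto)
  have intB: "B z integrable_on {0..1}"
  proof (rule integrable_continuous_interval)
    show "continuous_on {0..1} (B z)"
    proof -
      have "continuous_on {0..1} (Pair z :: real \<Rightarrow> _)" by (intro continuous_intros)
      from continuous_on_compose2[OF contB this] z show ?thesis by auto
    qed
  qed
  have "blinfun_apply (integral {0..1} (B z)) v =
    (\<Sum>j\<in>UNIV. integral {0..1} (\<lambda>t. d_z j w (slide i p t z) * c j t) * v $ j)" for v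
  proof -
    have "blinfun_apply (integral {0..1} (B z)) v = integral {0..1} (\<lambda>t. blinfun_apply (B z t) v)"
      using integral_linear[OF intB blinfun.bounded_linear_left[of v]] by (simp add: o_def)
    also have "\<dots> = integral {0..1} (\<lambda>t. \<Sum>j\<in>UNIV. d_z j w (slide i p t z) * c j t * v $ j)"
      by (rule integral_cong) (simp add: B z D_def mult.assoc)
    also have "\<dots> = (\<Sum>j\<in>UNIV. integral {0..1} (\<lambda>t. d_z j w (slide i p t z) * c j t * v $ j))"
    proof (rule integral_sum)
      fix j
      have "continuous_on {0..1} (\<lambda>t. c j t)"
        unfolding c_def by (cases "j = i") (auto intro!: continuous_intros)
      then show "(\<lambda>t. d_z j w (slide i p t z) * c j t * v $ j) integrable_on {0..1}"
        by (intro integrable_continuous_interval continuous_intros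
            continuous_on_slide_integrand[OF cholomorphic_on_d_z[OF opU w] z])
    qed simp
    finally show ?thesis by simp
  qed
  then have "blinfun_apply (integral {0..1} (B z)) =
     (\<lambda>v. \<Sum>j\<in>UNIV. integral {0..1} (\<lambda>t. d_z j w (slide i p t z) * c j t) * v $ j)"
    by (rule ext)
  with L show ?thesis
    using at_within_open[OF z opU] by (simp add: c_def)
qed

lemma cholomorphic_on_primitive:
  assumes w: "cholomorphic_on w U"
  shows "cholomorphic_on (primitive i p w) U"
proof -
  have "cholomorphic_on (\<lambda>z. integral {0..1} (\<lambda>t. w (slide i p t z))) U"
    by (rule cholomorphic_onI) (rule slide_integral_has_derivative[OF w])
  then show ?thesis
    unfolding primitive_def[abs_def] by (intro chol_intros)
qed

lemma primitive_has_derivative: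
  assumes w: "cholomorphic_on w U" and z: "z \<in> U"
  defines "I j \<equiv> integral {0..1} (\<lambda>t. d_z j w (slide i p t z) * (if j = i then of_real t else 1))"
  shows "(primitive i p w has_derivative (\<lambda>v. \<Sum>j\<in>UNIV. ((z $ i - p $ i) * I j +
    (if j = i then integral {0..1} (\<lambda>t. w (slide i p t z)) else 0)) * v $ j)) (at z)"
proof -
  let ?G = "\<lambda>z. integral {0..1} (\<lambda>t. w (slide i p t z))"
  have "(primitive i p w has_derivative
      (\<lambda>v. (z $ i - p $ i) * (\<Sum>j\<in>UNIV. I j * v $ j) + v $ i * ?G z)) (at z)"
    unfolding primitive_def[abs_def] I_def
    by (rule has_derivative_mult[OF _ slide_integral_has_derivative[OF w z]])
      (auto intro!: derivative_eq_intros bounded_linear_imp_has_derivative bounded_linear_vec_nth)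
  moreover have "(\<lambda>v. (z $ i - p $ i) * (\<Sum>j\<in>UNIV. I j * v $ j) + v $ i * ?G z)
     = (\<lambda>v. \<Sum>j\<in>UNIV. ((z $ i - p $ i) * I j + (if j = i then ?G z else 0)) * v $ j)"
    by (rule ext) (simp add: distrib_right sum.distrib sum_distrib_left mult.assoc if_distrib[of "\<lambda>x. x * _"] cong: if_cong)
  ultimately show ?thesis by simp
qed

lemma d_z_primitive_other:
  assumes w: "cholomorphic_on w U" and z: "z \<in> U" and "j \<noteq> i"
  shows "d_z j (primitive i p w) z = primitive i p (d_z j w) z"
  using d_z_eq_coeff[OF primitive_has_derivative[OF w z], of j] \<open>j \<noteq> i\<close>
  by (simp add: primitive_def)

text \<open>
  The derivative with respect to \<open>z\<^sub>i\<close> is the integral over \<open>[0, 1]\<close> of the derivative of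
  \<open>t \<mapsto> t w(slide t z)\<close>.
\<close>

lemma d_z_primitive_same:
  assumes w: "cholomorphic_on w U" and z: "z \<in> U"
  shows "d_z i (primitive i p w) z = w z"
proof -
  let ?s = "\<lambda>t. slide i p t z" and ?c = "z $ i - p $ i"
  have "((\<lambda>t. of_real t * w (?s t)) has_vector_derivative
      (w (?s t) + of_real t * (?c * d_z i w (?s t)))) (at t within {0..1})" if "t \<in> {0..1}" for t
  proof -
    have "((\<lambda>x. w (?s x)) has_derivative (\<lambda>v. \<Sum>k\<in>UNIV. d_z k w (?s t) *
        (if k = i then of_real v * ?c else 0))) (at t)"
    proof (rule has_derivative_compose[of "?s" "\<lambda>v. \<chi> k. if k = i then of_real v * ?c else 0" t UNIV,
            OF _ cholomorphic_on_has_derivative[OF w slideU[OF z that]], simplified])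
      show "(?s has_derivative (\<lambda>v. \<chi> k. if k = i then of_real v * ?c else 0)) (at t)"
      proof (rule has_derivative_vec_lambda)
        show "((\<lambda>x. slide i p x z $ k) has_derivative (\<lambda>v. if k = i then of_real v * ?c else 0)) (at t)" for k
          unfolding slide_nth
          by (cases "k = i") (auto intro!: derivative_eq_intros simp: of_real_def)
      qed
    qed
    then have "((\<lambda>x. w (?s x)) has_vector_derivative (?c * d_z i w (?s t))) (at t)"
      unfolding has_vector_derivative_def
      by (simp add: scaleR_conv_of_real if_distrib[of "\<lambda>x. _ * x"] mult_ac cong: if_cong)
    from has_vector_derivative_mult[OF has_vector_derivative_of_real[OF DERIV_ident] has_vector_derivative_at_within[OF this]]
    show ?thesis by (simp add: add.commute)
  qed
  then have "((\<lambda>t. w (?s t) + of_real t * (?c * d_z i w (?s t))) has_integral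
      (of_real 1 * w (?s 1) - of_real 0 * w (?s 0))) {0..1}"
    by (intro fundamental_theorem_of_calculus) auto
  then have "integral {0..1} (\<lambda>t. w (?s t) + of_real t * (?c * d_z i w (?s t))) = w z"
    by (simp add: integral_unique)
  moreover have "integral {0..1} (\<lambda>t. w (?s t) + of_real t * (?c * d_z i w (?s t))) =
     integral {0..1} (\<lambda>t. w (?s t)) + integral {0..1} (\<lambda>t. ?c * (d_z i w (?s t) * of_real t))"
    by (subst integral_add[symmetric])
      (auto intro!: integrable_continuous_interval continuous_intros
        continuous_on_slide_integrand[OF w z] continuous_on_slide_integrand[OF cholomorphic_on_d_z[OF opU w] z]
        simp: mult_ac)
  ultimately show ?thesis
    using d_z_eq_coeff[OF primitive_has_derivative[OF w z], of i] by (simp add: add.commute)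
qed

lemma primitive_bound:
  assumes w: "cholomorphic_on w U" and z: "z \<in> U"
    and der: "\<And>t. t \<in> {0..1} \<Longrightarrow> (\<phi> has_real_derivative \<phi>' t) (at t)"
    and le: "\<And>t. t \<in> {0..1} \<Longrightarrow> cmod (z $ i - p $ i) * cmod (w (slide i p t z)) \<le> \<phi>' t"
  shows "cmod (primitive i p w z) \<le> \<phi> 1 - \<phi> 0"
proof -
  have "(\<phi>' has_integral (\<phi> 1 - \<phi> 0)) {0..1}"
    using der
    by (intro fundamental_theorem_of_calculus)
      (auto intro: has_field_derivative_at_within simp: has_real_derivative_iff_has_vector_derivative[symmetric])
  moreover have "primitive i p w z = integral {0..1} (\<lambda>t. (z $ i - p $ i) * w (slide i p t z))"
    by (simp add: primitive_def)
  moreover have "(\<lambda>t. (z $ i - p $ i) * w (slide i p t z)) integrable_on {0..1}"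
    by (intro integrable_continuous_interval continuous_intros continuous_on_slide_integrand[OF w z])
  ultimately show ?thesis
    using integral_norm_bound_integral[of "\<lambda>t. (z $ i - p $ i) * w (slide i p t z)" "{0..1}" \<phi>'] le
    by (simp add: norm_mult integral_unique has_integral_integrable[of \<phi>'])
qed

end

section \<open>Cauchy estimates with weights on a wedge\<close>

text \<open>
  The wedge consists of the points where \<open>|z' - p'| + |z\<^sub>i - p\<^sub>i| / \<epsilon> < r\<close>, with \<open>z'\<close> the variables other
  than \<open>z\<^sub>i\<close>; \<open>gap\<close> is what is left of \<open>r\<close>. A derivative in a direction \<open>j \<noteq> i\<close> costs one power of the
  gap (Nagumo's form of the Cauchy estimate). Integration in the direction \<open>i\<close> gains this power
  back, together with a factor \<open>\<epsilon>\<close>, because the gap decreases with slope \<open>1 / \<epsilon>\<close> along the segment of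
  integration. So the loss of derivatives in \<open>w \<mapsto> \<partial>\<^sub>j \<integral> w dz\<^sub>i\<close> is harmless in the norm
  \<open>sup |w| \<surd>gap\<close>, in which this operator has norm at most \<open>6 \<epsilon>\<close>.
\<close>

locale wedge =
  fixes i :: "'n::finite" and p :: "complex ^ 'n" and \<epsilon> r :: real
  assumes eps: "0 < \<epsilon>" "\<epsilon> \<le> 1 / 2" and r: "0 < r"
begin

definition tang :: "complex ^ 'n \<Rightarrow> complex ^ 'n" where
  "tang x = (\<chi> k. if k = i then 0 else x $ k)"

definition gap :: "complex ^ 'n \<Rightarrow> real" where
  "gap z = r - norm (tang (z - p)) - cmod (z $ i - p $ i) / \<epsilon>"

definition W :: "(complex ^ 'n) set" where
  "W = {z. gap z > 0}"

lemma tang_add: "tang (x + y) = tang x + tang y"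
  and tang_scaleR: "tang (c *\<^sub>R x) = c *\<^sub>R tang x"
  by (simp_all add: tang_def vec_eq_iff)

lemma continuous_on_gap: "continuous_on S gap"
proof -
  have "continuous_on S (\<lambda>z. tang (z - p))"
    unfolding tang_def
  proof (rule continuous_on_vec_lambda)
    show "continuous_on S (\<lambda>z. if k = i then 0 else (z - p) $ k)" for k
      by (cases "k = i") (auto intro!: continuous_intros)
  qed
  then show ?thesis
    unfolding gap_def[abs_def] using eps by (intro continuous_intros) auto
qed

lemma open_W: "open W"
  unfolding W_def using continuous_on_gap[of UNIV] by (intro open_Collect_less) (auto intro: continuous_intros)

lemma convex_W: "convex W"
proof (rule convexI)
  fix x y and u v :: real
  assume xy: "x \<in> W" "y \<in> W" and uv: "0 \<le> u" "0 \<le> v" "u + v = 1"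
  have eq: "u *\<^sub>R x + v *\<^sub>R y - p = u *\<^sub>R (x - p) + v *\<^sub>R (y - p)"
    using uv by (simp add: algebra_simps flip: scaleR_left_distrib)
  have "norm (tang (u *\<^sub>R x + v *\<^sub>R y - p)) \<le> u * norm (tang (x - p)) + v * norm (tang (y - p))"
    unfolding eq tang_add tang_scaleR using norm_triangle_ineq[of "u *\<^sub>R tang (x - p)" "v *\<^sub>R tang (y - p)"] uv by simp
  moreover have "cmod ((u *\<^sub>R x + v *\<^sub>R y) $ i - p $ i) \<le> u * cmod (x $ i - p $ i) + v * cmod (y $ i - p $ i)"
  proof -
    have "(u *\<^sub>R x + v *\<^sub>R y) $ i - p $ i = u *\<^sub>R (x $ i - p $ i) + v *\<^sub>R (y $ i - p $ i)"
      using arg_cong[OF eq, of "\<lambda>x. x $ i"] by simp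
    then show ?thesis
      using norm_triangle_ineq[of "u *\<^sub>R (x $ i - p $ i)" "v *\<^sub>R (y $ i - p $ i)"] uv by simp
  qed
  then have "cmod ((u *\<^sub>R x + v *\<^sub>R y) $ i - p $ i) / \<epsilon> \<le> u * (cmod (x $ i - p $ i) / \<epsilon>) + v * (cmod (y $ i - p $ i) / \<epsilon>)"
    using eps by (simp add: field_simps)
  ultimately have "gap (u *\<^sub>R x + v *\<^sub>R y) \<ge> u * gap x + v * gap y"
    using uv(3) unfolding gap_def by (simp add: algebra_simps flip: distrib_left)
  moreover have "u * gap x + v * gap y > 0"
    using xy uv unfolding W_def
    by (cases "u = 0") (auto intro!: add_pos_nonneg mult_pos_pos)
  ultimately show "u *\<^sub>R x + v *\<^sub>R y \<in> W" by (simp add: W_def)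
qed

lemma gap_slide: "gap (slide i p t z) = r - norm (tang (z - p)) - \<bar>t\<bar> * cmod (z $ i - p $ i) / \<epsilon>"
proof -
  have "tang (slide i p t z - p) = tang (z - p)"
    by (simp add: tang_def vec_eq_iff slide_nth)
  then show ?thesis
    by (simp add: gap_def slide_nth norm_mult)
qed

lemma gap_slide_ge: "t \<in> {0..1} \<Longrightarrow> gap z \<le> gap (slide i p t z)"
  unfolding gap_slide using eps
  by (simp add: gap_def divide_right_mono mult_left_le_one_le)

lemma slide_W: "z \<in> W \<Longrightarrow> t \<in> {0..1} \<Longrightarrow> slide i p t z \<in> W"
  using gap_slide_ge[of t z] by (simp add: W_def)

lemma gap_pos: "z \<in> W \<Longrightarrow> 0 < gap z"
  by (simp add: W_def)

lemma gap_le: "gap z \<le> r"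
proof -
  have "0 \<le> cmod (z $ i - p $ i) / \<epsilon>" using eps by simp
  then show ?thesis unfolding gap_def using norm_ge_zero[of "tang (z - p)"] by linarith
qed

lemma gap_p: "gap p = r"
  by (simp add: gap_def tang_def vec_eq_iff)

lemma p_in_W: "p \<in> W"
  using r by (simp add: W_def gap_p)

lemma norm_split: "norm x \<le> norm (tang x) + cmod (x $ i)"
proof -
  have "x = tang x + x $ i *s axis i 1"
    by (simp add: vec_eq_iff tang_def axis_def)
  then have "norm x \<le> norm (tang x) + norm (x $ i *s axis i (1::complex) :: complex ^ 'n)"
    using norm_triangle_ineq[of "tang x" "x $ i *s axis i 1"] by metis
  then show ?thesis by (simp add: norm_vector_smult)
qed

lemma W_subset_ball: "W \<subseteq> ball p r"
proof
  fix z assume "z \<in> W"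
  have "norm (z - p) \<le> norm (tang (z - p)) + cmod (z $ i - p $ i)"
    using norm_split[of "z - p"] by simp
  also have "cmod (z $ i - p $ i) \<le> cmod (z $ i - p $ i) / \<epsilon>"
    using eps by (simp add: le_divide_eq mult_left_le)
  finally show "z \<in> ball p r"
    using \<open>z \<in> W\<close> by (simp add: W_def gap_def dist_norm norm_minus_commute)
qed

lemma gap_shift:
  assumes "j \<noteq> i"
  shows "gap z - cmod c \<le> gap (z + c *s axis j 1)"
proof -
  have "tang (z + c *s axis j 1 - p) = tang (z - p) + c *s axis j 1"
    using assms by (auto simp: tang_def vec_eq_iff axis_def)
  then have "norm (tang (z + c *s axis j 1 - p)) \<le> norm (tang (z - p)) + cmod c"
    using norm_triangle_ineq[of "tang (z - p)" "c *s axis j 1"] by (simp add: norm_vector_smult)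
  moreover have "(z + c *s axis j 1) $ i = z $ i"
    using assms by (simp add: axis_def)
  ultimately show ?thesis by (simp only: gap_def)
qed

text \<open>
  The Cauchy estimate on the disc of radius half the gap, on which the gap is at least half of its
  value at the centre. The constant is \<open>2 \<surd>2 \<le> 3\<close>.
\<close>

lemma nagumo:
  assumes w: "cholomorphic_on w W" and "j \<noteq> i" and "A \<ge> 0"
    and le: "\<And>z. z \<in> W \<Longrightarrow> cmod (w z) \<le> A / sqrt (gap z)" and z: "z \<in> W"
  shows "cmod (d_z j w z) \<le> 3 * A / (gap z * sqrt (gap z))"
proof -
  define d where "d = gap z"
  have d: "d > 0" using gap_pos[OF z] by (simp add: d_def)
  have near: "d / 2 \<le> gap (z + c *s axis j 1)" if "cmod c \<le> d / 2" for c
    using gap_shift[OF \<open>j \<noteq> i\<close>, of z c] that by (simp add: d_def)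
  have "cmod (d_z j w z) \<le> (A / sqrt (d / 2)) / (d / 2)"
  proof (rule cauchy_estimate_d_z[OF w])
    fix c assume c: "cmod c \<le> d / 2"
    show W: "z + c *s axis j 1 \<in> W" using near[OF c] d by (simp add: W_def)
    have "cmod (w (z + c *s axis j 1)) \<le> A / sqrt (gap (z + c *s axis j 1))" by (rule le[OF W])
    also have "\<dots> \<le> A / sqrt (d / 2)"
      using near[OF c] d \<open>A \<ge> 0\<close> by (intro divide_left_mono mult_pos_pos real_sqrt_gt_zero) auto
    finally show "cmod (w (z + c *s axis j 1)) \<le> A / sqrt (d / 2)" .
  qed (use d in auto)
  also have "\<dots> = (2 * sqrt 2) * (A / (d * sqrt d))"
    by (simp add: real_sqrt_divide mult_ac)
  also have "\<dots> \<le> 3 * (A / (d * sqrt d))"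
  proof (rule mult_right_mono)
    have "sqrt 2 \<le> 3 / 2" by (rule real_le_lsqrt) (auto simp: power2_eq_square)
    then show "2 * sqrt 2 \<le> 3" by simp
  qed (use d \<open>A \<ge> 0\<close> in auto)
  finally show ?thesis by (simp add: d_def)
qed

text \<open>
  The singularity \<open>1 / \<surd>gap\<close> is integrable, so the primitive stays bounded. This is why the
  exponent of the weight is chosen smaller than one.
\<close>

lemma primitive_bound_sqrt:
  assumes w: "cholomorphic_on w W" and A: "A \<ge> 0"
    and le: "\<And>z. z \<in> W \<Longrightarrow> cmod (w z) \<le> A / sqrt (gap z)" and z: "z \<in> W"
  shows "cmod (primitive i p w z) \<le> 2 * A * \<epsilon> * sqrt r"
proof -
  define a where "a = cmod (z $ i - p $ i)"
  define X where "X t = r - norm (tang (z - p)) - t * a / \<epsilon>" for t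
  have X: "X t = gap (slide i p t z)" "X t > 0" if "t \<in> {0..1}" for t
    using that gap_slide[of t z] gap_pos[OF slide_W[OF z that]] by (auto simp: X_def a_def)
  have "cmod (primitive i p w z) \<le> - (2 * A * \<epsilon>) * sqrt (X 1) - (- (2 * A * \<epsilon>) * sqrt (X 0))"
  proof (rule primitive_bound[OF open_W convex_W slide_W w z])
    fix t :: real assume t: "t \<in> {0..1}"
    show "((\<lambda>t. - (2 * A * \<epsilon>) * sqrt (X t)) has_real_derivative a * (A / sqrt (X t))) (at t)"
      using X(2)[OF t] eps unfolding X_def
      by (auto intro!: derivative_eq_intros simp: field_simps)
    show "cmod (z $ i - p $ i) * cmod (w (slide i p t z)) \<le> a * (A / sqrt (X t))"
      unfolding X(1)[OF t] a_def by (intro mult_left_mono le slide_W z t) simp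
  qed auto
  also have "\<dots> \<le> 2 * A * \<epsilon> * sqrt (X 0)"
    using X(2)[of 1] A eps by (simp add: less_imp_le)
  also have "\<dots> \<le> 2 * A * \<epsilon> * sqrt r"
    using A eps by (intro mult_left_mono) (auto simp: X_def)
  finally show ?thesis .
qed

lemma primitive_bound_nagumo:
  assumes w: "cholomorphic_on w W" and A: "A \<ge> 0"
    and le: "\<And>z. z \<in> W \<Longrightarrow> cmod (w z) \<le> A / (gap z * sqrt (gap z))" and z: "z \<in> W"
  shows "cmod (primitive i p w z) \<le> 2 * A * \<epsilon> / sqrt (gap z)"
proof -
  define a where "a = cmod (z $ i - p $ i)"
  define X where "X t = r - norm (tang (z - p)) - t * a / \<epsilon>" for t
  have X: "X t = gap (slide i p t z)" "X t > 0" if "t \<in> {0..1}" for t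
    using that gap_slide[of t z] gap_pos[OF slide_W[OF z that]] by (auto simp: X_def a_def)
  have "cmod (primitive i p w z) \<le> 2 * A * \<epsilon> / sqrt (X 1) - 2 * A * \<epsilon> / sqrt (X 0)"
  proof (rule primitive_bound[OF open_W convex_W slide_W w z])
    fix t :: real assume t: "t \<in> {0..1}"
    have "((\<lambda>t. 2 * A * \<epsilon> / sqrt (X t)) has_real_derivative
        - (2 * A * \<epsilon> * (- (a / \<epsilon>) * (inverse (sqrt (X t)) / 2))) / (sqrt (X t) * sqrt (X t))) (at t)"
      using X(2)[OF t] eps unfolding X_def
      by (auto intro!: derivative_eq_intros)
    moreover have "- (2 * A * \<epsilon> * (- (a / \<epsilon>) * (inverse (sqrt (X t)) / 2))) / (sqrt (X t) * sqrt (X t))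
       = a * (A / (X t * sqrt (X t)))"
      using X(2)[OF t] eps by (simp add: field_simps)
    ultimately show "((\<lambda>t. 2 * A * \<epsilon> / sqrt (X t)) has_real_derivative a * (A / (X t * sqrt (X t)))) (at t)"
      by simp
    show "cmod (z $ i - p $ i) * cmod (w (slide i p t z)) \<le> a * (A / (X t * sqrt (X t)))"
      unfolding X(1)[OF t] a_def by (intro mult_left_mono le slide_W z t) simp
  qed auto
  also have "\<dots> \<le> 2 * A * \<epsilon> / sqrt (X 1)"
    using X(2)[of 0] A eps by simp
  also have "X 1 = gap z" using X(1)[of 1] by simp
  finally show ?thesis .
qed

lemma d_z_d_z_primitive:
  assumes w: "cholomorphic_on w W" and z: "z \<in> W" and "j \<noteq> i" "k \<noteq> i"
  shows "d_z k (d_z j (primitive i p w)) z = primitive i p (d_z k (d_z j w)) z"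
proof -
  have "d_z k (d_z j (primitive i p w)) z = d_z k (primitive i p (d_z j w)) z"
    using d_z_primitive_other[OF open_W convex_W slide_W w _ \<open>j \<noteq> i\<close>]
    by (intro d_z_cong_open[OF open_W z]) auto
  also have "\<dots> = primitive i p (d_z k (d_z j w)) z"
    using d_z_primitive_other[OF open_W convex_W slide_W cholomorphic_on_d_z[OF open_W w] z \<open>k \<noteq> i\<close>]
    by auto
  finally show ?thesis .
qed

text \<open>
  \<open>\<partial>\<^sub>j\<close> and integration in \<open>z\<^sub>i\<close> commute. Nagumo's estimate for \<open>\<partial>\<^sub>j w\<close> loses one power of the gap and
  the integration recovers it.
\<close>

lemma d_z_primitive_bound:
  assumes w: "cholomorphic_on w W" and "A \<ge> 0" and "j \<noteq> i"
    and le: "\<And>z. z \<in> W \<Longrightarrow> cmod (w z) \<le> A / sqrt (gap z)" and z: "z \<in> W"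
  shows "cmod (d_z j (primitive i p w) z) \<le> 6 * A * \<epsilon> / sqrt (gap z)"
proof -
  have "cmod (primitive i p (d_z j w) z) \<le> 2 * (3 * A) * \<epsilon> / sqrt (gap z)"
    using nagumo[OF w \<open>j \<noteq> i\<close> \<open>A \<ge> 0\<close> le] \<open>A \<ge> 0\<close>
    by (intro primitive_bound_nagumo cholomorphic_on_d_z open_W w z) auto
  then show ?thesis
    using d_z_primitive_other[OF open_W convex_W slide_W w z \<open>j \<noteq> i\<close>] by auto
qed

lemma primitive_diff:
  assumes "cholomorphic_on v W" "cholomorphic_on w W" "z \<in> W"
  shows "primitive i p (\<lambda>z. v z - w z) z = primitive i p v z - primitive i p w z"
proof -
  have "continuous_on {0..1} (\<lambda>t. v (slide i p t z))" "continuous_on {0..1} (\<lambda>t. w (slide i p t z))"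
    using continuous_on_slide_integrand[OF open_W convex_W slide_W] assms by blast+
  then show ?thesis
    unfolding primitive_def
    by (simp add: integral_diff integrable_continuous_interval right_diff_distrib)
qed

lemma d_z_primitive_diff:
  assumes v: "cholomorphic_on v W" and w: "cholomorphic_on w W" and z: "z \<in> W"
  shows "d_z j (primitive i p v) z - d_z j (primitive i p w) z = d_z j (primitive i p (\<lambda>z. v z - w z)) z"
proof -
  have "cholomorphic_on (primitive i p v) W" "cholomorphic_on (primitive i p w) W"
    using cholomorphic_on_primitive[OF open_W convex_W slide_W] v w by blast+
  from d_z_diff[OF this z, of j] 
  have "d_z j (primitive i p v) z - d_z j (primitive i p w) z = d_z j (\<lambda>z. primitive i p v z - primitive i p w z) z" by simp
  also have "\<dots> = d_z j (primitive i p (\<lambda>z. v z - w z)) z"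
    using primitive_diff[OF v w] by (intro d_z_cong_open[OF open_W z]) auto
  finally show ?thesis .
qed

end

text \<open>
  Divide the increment in the direction of the \<open>k\<close>-th coordinate by its length and pass to the
  limit. In this way a Lipschitz bound for \<open>\<Psi>(z, \<eta>)\<close> replaces the chain rule for \<open>\<Psi>(z, u(z))\<close>.
\<close>

lemma d_z_le_of_increment_bound:
  fixes u :: "complex ^ 'n \<Rightarrow> complex ^ 'n"
  assumes V: "open V" "z \<in> V" and F: "cholomorphic_on F V" and u: "\<And>j. cholomorphic_on (\<lambda>z. u z $ j) V"
    and le: "\<And>x. x \<in> V \<Longrightarrow> cmod (F x - F z) \<le> K * norm (x - z) + (\<Sum>j\<in>UNIV. L j * cmod (u x $ j - u z $ j))"
  shows "cmod (d_z k F z) \<le> K + (\<Sum>j\<in>UNIV. L j * cmod (d_z k (\<lambda>z. u z $ j) z))"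
proof -
  define q where "q G h = (G (z + h *s axis k 1) - G z) / h" for G :: "complex ^ 'n \<Rightarrow> complex" and h
  have q: "(q G \<longlongrightarrow> d_z k G z) (at 0)" if "cholomorphic_on G V" for G
    using line_has_field_derivative[OF that, of z 0 "axis k 1"] V(2)
    by (simp add: DERIV_def q_def[abs_def] sum_axis_right)
  have "isCont (\<lambda>h::complex. z + h *s axis k 1) 0"
    using has_derivative_continuous[OF has_derivative_smult_left] by blast
  then have "((\<lambda>h::complex. z + h *s axis k 1) \<longlongrightarrow> z) (at 0)"
    by (simp add: isCont_def)
  then have "eventually (\<lambda>h::complex. z + h *s axis k 1 \<in> V) (at 0)"
    using V topological_tendstoD by blast
  then have ev: "eventually (\<lambda>h. cmod (q F h) \<le> K + (\<Sum>j\<in>UNIV. L j * cmod (q (\<lambda>z. u z $ j) h))) (at 0)"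
    using eventually_neq_at_within[of 0 0 UNIV]
  proof eventually_elim
    case (elim h)
    have "cmod h * cmod (q F h) \<le> cmod h * (K + (\<Sum>j\<in>UNIV. L j * cmod (q (\<lambda>z. u z $ j) h)))"
      using le[OF elim(1)] elim(2)
      by (simp add: q_def norm_divide norm_vector_smult distrib_left sum_distrib_left mult.commute)
    then show ?case using elim(2) by simp
  qed
  show ?thesis
    by (rule tendsto_le[OF _ _ _ ev]) (auto intro!: tendsto_intros q F u)
qed


section \<open>A Cauchy-Kovalevskaya theorem by contraction\<close>

text \<open>
  The equation \<open>\<partial>\<^sub>i h = \<Psi>(z, \<partial>h)\<close> with \<open>h = 0\<close> on \<open>z\<^sub>i = p\<^sub>i\<close> becomes a fixed point problem for \<open>w = \<partial>\<^sub>i h\<close>,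
  since \<open>h\<close> is the primitive of \<open>w\<close>. The variable \<open>\<eta>\<^sub>i\<close> may occur in \<open>\<Psi>\<close>, with Lipschitz constant
  \<open>1 / 4\<close>, so that one iteration solves the equation for \<open>\<partial>\<^sub>i h\<close> and integrates it at the same time.
\<close>

locale wedge_contraction = wedge i p \<epsilon> r
  for i :: "'n::finite" and p \<epsilon> r +
  fixes \<Psi> :: "complex ^ 'n \<Rightarrow> complex ^ 'n \<Rightarrow> complex" and K R :: real
  assumes K: "0 < K" and R: "0 < R"
    and Lip: "\<And>z z' \<eta> \<eta>'. z \<in> W \<Longrightarrow> z' \<in> W \<Longrightarrow> (\<And>j. cmod (\<eta> $ j) \<le> R) \<Longrightarrow> (\<And>j. cmod (\<eta>' $ j) \<le> R) \<Longrightarrow>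
      cmod (\<Psi> z \<eta> - \<Psi> z' \<eta>') \<le> K * norm (z - z') + (\<Sum>j\<in>UNIV. (if j = i then 1 / 4 else K) * cmod (\<eta> $ j - \<eta>' $ j))"
    and hol: "\<And>u. (\<And>j. cholomorphic_on (\<lambda>z. u z $ j) W) \<Longrightarrow> (\<And>z j. z \<in> W \<Longrightarrow> cmod (u z $ j) \<le> R) \<Longrightarrow>
      cholomorphic_on (\<lambda>z. \<Psi> z (u z)) W"
    and zero: "\<Psi> p 0 = 0"
    and eps_small: "12 * real CARD('n) * K * \<epsilon> \<le> 1"
    and r_small: "4 * K * r \<le> R" "4 * K * sqrt r \<le> 1" "sqrt r \<le> R"
begin

definition T :: "(complex ^ 'n \<Rightarrow> complex) \<Rightarrow> complex ^ 'n \<Rightarrow> complex" where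
  "T w z = \<Psi> z (hol_grad (primitive i p w) z)"

text \<open>
  Admissible functions are those for which \<open>T\<close> makes sense, as \<open>\<Psi>\<close> is controlled for \<open>|\<eta>\<^sub>j| \<le> R\<close> only.
  The iteration takes place among the good functions: their derivatives in the directions \<open>j \<noteq> i\<close> may
  grow at the boundary of the wedge, but slowly enough for the primitive to have a small gradient.
\<close>

definition admissible :: "(complex ^ 'n \<Rightarrow> complex) \<Rightarrow> bool" where
  "admissible w \<longleftrightarrow> cholomorphic_on w W \<and>
     (\<forall>z\<in>W. \<forall>j. cmod (hol_grad (primitive i p w) z $ j) \<le> R)"

definition good :: "(complex ^ 'n \<Rightarrow> complex) \<Rightarrow> bool" where
  "good w \<longleftrightarrow> cholomorphic_on w W \<and> (\<forall>z\<in>W. cmod (w z) \<le> R) \<and>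
     (\<forall>z\<in>W. \<forall>j. j \<noteq> i \<longrightarrow> cmod (d_z j w z) \<le> 1 / sqrt (gap z))"

lemma grad_same: "cholomorphic_on w W \<Longrightarrow> z \<in> W \<Longrightarrow> hol_grad (primitive i p w) z $ i = w z"
  using d_z_primitive_same[OF open_W convex_W slide_W] by (simp add: hol_grad_def)

lemma grad_other:
  "cholomorphic_on w W \<Longrightarrow> z \<in> W \<Longrightarrow> j \<noteq> i \<Longrightarrow> hol_grad (primitive i p w) z $ j = primitive i p (d_z j w) z"
  using d_z_primitive_other[OF open_W convex_W slide_W] by (simp add: hol_grad_def)

lemma hol_primitive: "cholomorphic_on w W \<Longrightarrow> cholomorphic_on (primitive i p w) W"
  using cholomorphic_on_primitive[OF open_W convex_W slide_W] by blast

lemma hol_grad_primitive: "cholomorphic_on w W \<Longrightarrow> cholomorphic_on (\<lambda>z. hol_grad (primitive i p w) z $ j) W"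
  using cholomorphic_on_d_z[OF open_W hol_primitive] by (simp add: hol_grad_def)

lemma sum_weights_le:
  assumes "\<And>j. j \<noteq> i \<Longrightarrow> x j \<le> b" "b \<ge> 0"
  shows "(\<Sum>j\<in>UNIV. (if j = i then 1 / 4 else K) * x j) \<le> x i / 4 + real CARD('n) * K * b"
proof -
  have "(\<Sum>j\<in>UNIV. (if j = i then 1 / 4 else K) * x j) = x i / 4 + (\<Sum>j\<in>UNIV - {i}. K * x j)"
    by (subst sum.remove[of _ i]) auto
  also have "(\<Sum>j\<in>UNIV - {i}. K * x j) \<le> (\<Sum>j\<in>UNIV - {i}. K * b)"
    using K assms by (intro sum_mono mult_left_mono) auto
  also have "\<dots> = real (card (UNIV - {i})) * (K * b)" by simp
  also have "\<dots> \<le> real CARD('n) * (K * b)"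
    using K assms(2) by (intro mult_right_mono) (auto simp: card_Diff_singleton)
  finally show ?thesis by (simp add: mult.assoc)
qed

lemma good_grad_bound:
  assumes "good w" "z \<in> W" "j \<noteq> i"
  shows "cmod (hol_grad (primitive i p w) z $ j) \<le> 2 * \<epsilon> * sqrt r"
proof -
  have w: "cholomorphic_on w W" using assms(1) by (simp add: good_def)
  have "cmod (primitive i p (d_z j w) z) \<le> 2 * 1 * \<epsilon> * sqrt r"
    using assms by (intro primitive_bound_sqrt cholomorphic_on_d_z[OF open_W w]) (auto simp: good_def)
  then show ?thesis using grad_other[OF w assms(2,3)] by simp
qed

lemma six_eps: "6 * (real CARD('n) * K * \<epsilon>) \<le> 1 / 2"
  using eps_small by simp

lemma good_imp_admissible:
  assumes "good w"
  shows "admissible w"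
  unfolding admissible_def
proof (intro conjI ballI allI)
  show w: "cholomorphic_on w W" using assms by (simp add: good_def)
  fix z j assume z: "z \<in> W"
  show "cmod (hol_grad (primitive i p w) z $ j) \<le> R"
  proof (cases "j = i")
    case True
    then show ?thesis using grad_same[OF w z] assms z by (simp add: good_def)
  next
    case False
    have "2 * \<epsilon> * sqrt r \<le> 1 * sqrt r"
      using eps r by (intro mult_right_mono) auto
    with r_small(3) have "2 * \<epsilon> * sqrt r \<le> R" by simp
    then show ?thesis using good_grad_bound[OF assms z False] by linarith
  qed
qed

lemma hol_T: "admissible w \<Longrightarrow> cholomorphic_on (T w) W"
  unfolding T_def[abs_def] admissible_def by (intro hol hol_grad_primitive) auto

text \<open>
  With \<open>s = 1 / \<surd>gap\<close>, the derivative of \<open>T w\<close> is at most \<open>K + s / 4 + 6 n K \<epsilon> s\<close>, where \<open>n\<close> is the dimension.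
  The first term is at most \<open>s / 4\<close> since \<open>r\<close> is small, and the last one at most \<open>s / 2\<close> since \<open>\<epsilon>\<close> is
  small. The bound for \<open>T w\<close> itself compares \<open>\<Psi>(z, \<eta>)\<close> with \<open>\<Psi>(p, 0) = 0\<close>.
\<close>

lemma good_T:
  assumes g: "good w"
  shows "good (T w)"
proof -
  have adm: "admissible w" by (rule good_imp_admissible[OF g])
  then have w: "cholomorphic_on w W" and u: "\<And>z j. z \<in> W \<Longrightarrow> cmod (hol_grad (primitive i p w) z $ j) \<le> R"
    by (auto simp: admissible_def)
  have holT: "cholomorphic_on (T w) W" by (rule hol_T[OF adm])
  have "cmod (T w z) \<le> R" if z: "z \<in> W" for z
  proof -
    let ?u = "hol_grad (primitive i p w) z"
    have "cmod (T w z) \<le> K * norm (z - p) + (\<Sum>j\<in>UNIV. (if j = i then 1 / 4 else K) * cmod (?u $ j))"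
      using Lip[OF z p_in_W u[OF z], of 0] R by (simp add: T_def zero)
    also have "K * norm (z - p) \<le> K * r"
      using W_subset_ball z K by (intro mult_left_mono) (auto simp: dist_norm norm_minus_commute subset_iff less_imp_le)
    also have "(\<Sum>j\<in>UNIV. (if j = i then 1 / 4 else K) * cmod (?u $ j)) \<le>
        cmod (?u $ i) / 4 + real CARD('n) * K * (2 * \<epsilon> * sqrt r)"
      using eps r by (intro sum_weights_le good_grad_bound[OF g z]) auto
    also have "real CARD('n) * K * (2 * \<epsilon> * sqrt r) = 2 * (real CARD('n) * K * \<epsilon>) * sqrt r" by simp
    also have "\<dots> \<le> 1 / 6 * sqrt r"
      using six_eps r by (intro mult_right_mono) auto
    finally show ?thesis
      using r_small u[OF z, of i] R by linarith
  qed
  moreover have "cmod (d_z k (T w) z) \<le> 1 / sqrt (gap z)" if z: "z \<in> W" and k: "k \<noteq> i" for z k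
  proof -
    let ?u = "\<lambda>z. hol_grad (primitive i p w) z"
    define s where "s = 1 / sqrt (gap z)"
    have s0: "0 < s" using gap_pos[OF z] by (simp add: s_def)
    have "cmod (d_z k (T w) z) \<le> K + (\<Sum>j\<in>UNIV. (if j = i then 1 / 4 else K) * cmod (d_z k (\<lambda>z. ?u z $ j) z))"
    proof (rule d_z_le_of_increment_bound[OF open_W z holT hol_grad_primitive[OF w]])
      show "cmod (T w x - T w z) \<le> K * norm (x - z) +
          (\<Sum>j\<in>UNIV. (if j = i then 1 / 4 else K) * cmod (?u x $ j - ?u z $ j))" if "x \<in> W" for x
        unfolding T_def by (rule Lip[OF that z u[OF that] u[OF z]])
    qed
    also have "(\<Sum>j\<in>UNIV. (if j = i then 1 / 4 else K) * cmod (d_z k (\<lambda>z. ?u z $ j) z)) \<le>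
        cmod (d_z k (\<lambda>z. ?u z $ i) z) / 4 + real CARD('n) * K * (6 * \<epsilon> * s)"
    proof (rule sum_weights_le)
      fix j assume j: "j \<noteq> i"
      have "d_z k (\<lambda>z. ?u z $ j) z = primitive i p (d_z k (d_z j w)) z"
        using d_z_d_z_primitive[OF w z j k] by (simp add: hol_grad_def)
      moreover have "cmod (primitive i p (d_z k (d_z j w)) z) \<le> 2 * (3 * 1) * \<epsilon> / sqrt (gap z)"
        using g j by (intro primitive_bound_nagumo nagumo k cholomorphic_on_d_z[OF open_W] w z) (auto simp: good_def)
      ultimately show "cmod (d_z k (\<lambda>z. ?u z $ j) z) \<le> 6 * \<epsilon> * s" by (simp add: s_def)
    qed (use eps s0 in auto)
    also have "d_z k (\<lambda>z. ?u z $ i) z = d_z k w z"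
      using grad_same[OF w] by (intro d_z_cong_open[OF open_W z]) auto
    also have "cmod (d_z k w z) \<le> s"
      using g z k by (simp add: good_def s_def)
    also have "real CARD('n) * K * (6 * \<epsilon> * s) = 6 * (real CARD('n) * K * \<epsilon>) * s" by simp
    also have "\<dots> \<le> 1 / 2 * s"
      using six_eps s0 by (intro mult_right_mono) auto
    also have "K \<le> s / 4"
    proof -
      have "4 * K * sqrt (gap z) \<le> 4 * K * sqrt r"
        using K gap_le[of z] by (intro mult_left_mono) auto
      then show ?thesis
        using r_small(2) gap_pos[OF z] by (simp add: s_def field_simps)
    qed
    finally show ?thesis unfolding s_def[symmetric] by simp
  qed
  ultimately show ?thesis
    using holT by (simp add: good_def)
qed

text \<open>
  The slot \<open>\<eta>\<^sub>i\<close> contributes the factor \<open>1 / 4\<close> and the other slots together \<open>6 n K \<epsilon> \<le> 1 / 2\<close>.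
\<close>

lemma T_contraction:
  assumes v: "admissible v" and w: "admissible w" and "D \<ge> 0"
    and le: "\<And>z. z \<in> W \<Longrightarrow> cmod (v z - w z) \<le> D / sqrt (gap z)" and z: "z \<in> W"
  shows "cmod (T v z - T w z) \<le> 3 / 4 * D / sqrt (gap z)"
proof -
  let ?u = "hol_grad (primitive i p v) z" and ?u' = "hol_grad (primitive i p w) z"
  define s where "s = D / sqrt (gap z)"
  have s0: "0 \<le> s" using gap_pos[OF z] \<open>D \<ge> 0\<close> by (simp add: s_def)
  have hv: "cholomorphic_on v W" and hw: "cholomorphic_on w W"
    using v w by (auto simp: admissible_def)
  have "cmod (T v z - T w z) \<le> K * norm (z - z) + (\<Sum>j\<in>UNIV. (if j = i then 1 / 4 else K) * cmod (?u $ j - ?u' $ j))"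
    unfolding T_def using v w z by (intro Lip) (auto simp: admissible_def)
  also have "\<dots> = (\<Sum>j\<in>UNIV. (if j = i then 1 / 4 else K) * cmod (?u $ j - ?u' $ j))" by simp
  also have "\<dots> \<le> cmod (?u $ i - ?u' $ i) / 4 + real CARD('n) * K * (6 * \<epsilon> * s)"
  proof (rule sum_weights_le)
    fix j assume j: "j \<noteq> i"
    have "cmod (d_z j (primitive i p (\<lambda>z. v z - w z)) z) \<le> 6 * D * \<epsilon> / sqrt (gap z)"
      by (intro d_z_primitive_bound chol_intros hv hw le z j \<open>D \<ge> 0\<close>)
    then show "cmod (?u $ j - ?u' $ j) \<le> 6 * \<epsilon> * s"
      using d_z_primitive_diff[OF hv hw z, of j] by (simp add: hol_grad_def s_def mult_ac)
  qed (use eps s0 in auto)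
  also have "real CARD('n) * K * (6 * \<epsilon> * s) = 6 * (real CARD('n) * K * \<epsilon>) * s" by simp
  also have "\<dots> \<le> 1 / 2 * s"
    using six_eps s0 by (intro mult_right_mono) auto
  also have "cmod (?u $ i - ?u' $ i) \<le> s"
    using le[OF z] grad_same[OF hv z] grad_same[OF hw z] by (simp add: s_def)
  finally show ?thesis by (simp add: s_def)
qed

definition iter :: "nat \<Rightarrow> complex ^ 'n \<Rightarrow> complex" where
  "iter n = (T ^^ n) (\<lambda>_. 0)"

lemma iter_0: "iter 0 z = 0" and iter_Suc: "iter (Suc n) = T (iter n)"
  by (simp_all add: iter_def)

lemma good_iter: "good (iter n)"
proof (induction n)
  case 0
  have "d_z j (\<lambda>_. 0) z = 0" for j and z :: "complex ^ 'n"
    by (simp add: d_z_def)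
  then show ?case
    using R gap_pos by (auto simp: iter_def good_def less_imp_le intro: cholomorphic_on_const)
qed (simp add: iter_Suc good_T)

lemma iter_step:
  assumes "z \<in> W"
  shows "cmod (iter (Suc n) z - iter n z) \<le> (3 / 4) ^ n * (R * sqrt r) / sqrt (gap z)"
  using assms
proof (induction n arbitrary: z)
  case 0
  have "R * sqrt (gap z) \<le> R * sqrt r"
    using R gap_le[of z] by (intro mult_left_mono) auto
  then have "R \<le> R * sqrt r / sqrt (gap z)"
    using gap_pos[OF 0] by (simp add: field_simps)
  moreover have "cmod (iter (Suc 0) z) \<le> R"
    using good_iter[of "Suc 0"] 0 by (simp add: good_def)
  ultimately show ?case by (simp add: iter_0)
next
  case (Suc n)
  have "cmod (T (iter (Suc n)) z - T (iter n) z) \<le> 3 / 4 * ((3 / 4) ^ n * (R * sqrt r)) / sqrt (gap z)"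
    using R r Suc by (intro T_contraction good_imp_admissible good_iter) auto
  then show ?case by (simp add: iter_Suc)
qed

lemma iter_distance:
  assumes "z \<in> W" "n \<le> m"
  shows "cmod (iter m z - iter n z) \<le> 4 * ((3 / 4) ^ n - (3 / 4) ^ m) * (R * sqrt r) / sqrt (gap z)"
  using assms(2)
proof (induction m rule: dec_induct)
  case (step m)
  define c where "c = R * sqrt r / sqrt (gap z)"
  have "cmod (iter (Suc m) z - iter n z) \<le> cmod (iter (Suc m) z - iter m z) + cmod (iter m z - iter n z)"
    using norm_triangle_ineq[of "iter (Suc m) z - iter m z" "iter m z - iter n z"] by simp
  also have "\<dots> \<le> (3 / 4) ^ m * c + 4 * ((3 / 4) ^ n - (3 / 4) ^ m) * c"
    using iter_step[OF assms(1), of m] step.IH by (simp add: c_def)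
  also have "\<dots> = 4 * ((3 / 4) ^ n - (3 / 4) ^ Suc m) * c"
    by (simp add: algebra_simps)
  finally show ?case by (simp add: c_def)
qed simp

text \<open>
  The iterates converge geometrically in the weighted norm, hence uniformly where the gap is bounded
  below. Both \<open>T\<close> and the gradient of the primitive are continuous for this convergence.
\<close>

lemma fixed_point_exists:
  "\<exists>w. admissible w \<and> (\<forall>z\<in>W. T w z = w z)"
proof -
  define c where "c = R * sqrt r"
  have c0: "0 \<le> c" using R r by (simp add: c_def)
  have dist: "cmod (iter m z - iter n z) \<le> 4 * (3 / 4) ^ n * c / sqrt (gap z)"
    if "z \<in> W" "n \<le> m" for z m n
  proof -
    have "4 * ((3 / 4) ^ n - (3 / 4) ^ m) * c / sqrt (gap z) \<le> 4 * (3 / 4) ^ n * c / sqrt (gap z)"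
      using gap_pos[OF that(1)] c0 by (intro divide_right_mono mult_right_mono) auto
    with iter_distance[OF that] show ?thesis by (simp add: c_def)
  qed
  have geo: "(\<lambda>n. x * (3 / 4) ^ n * y) \<longlonglongrightarrow> 0" for x y :: real
    by (intro tendsto_mult_left_zero tendsto_mult_right_zero LIMSEQ_realpow_zero) auto
  have "uniformly_convergent_on S iter" if S: "\<And>z. z \<in> S \<Longrightarrow> z \<in> W \<and> d \<le> gap z" and d: "d > 0" for S d
  proof (rule Cauchy_uniformly_convergent, unfold uniformly_Cauchy_on_def, intro allI impI)
    fix e :: real assume "e > 0"
    have "\<forall>\<^sub>F n in sequentially. 4 * (3 / 4) ^ n * (c / sqrt d) < e / 2"
      using \<open>e > 0\<close> by (intro order_tendstoD(2)[OF geo]) simp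
    then obtain N where N: "4 * (3 / 4) ^ N * (c / sqrt d) < e / 2"
      by (auto simp: eventually_sequentially)
    show "\<exists>M. \<forall>x\<in>S. \<forall>m\<ge>M. \<forall>n\<ge>M. dist (iter m x) (iter n x) < e"
    proof (intro exI ballI allI impI)
      fix x m n assume x: "x \<in> S" and mn: "m \<ge> N" "n \<ge> N"
      have *: "cmod (iter m x - iter N x) < e / 2" if "m \<ge> N" for m
      proof -
        have "4 * (3 / 4) ^ N * c / sqrt (gap x) \<le> 4 * (3 / 4) ^ N * c / sqrt d"
          using S[OF x] d c0 by (intro divide_left_mono) auto
        then show ?thesis using dist[of x N m] S[OF x] that N by auto
      qed
      show "dist (iter m x) (iter n x) < e"
        using *[OF mn(1)] *[OF mn(2)] norm_triangle_ineq4[of "iter m x - iter N x" "iter n x - iter N x"]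
        by (simp add: dist_norm)
    qed
  qed
  note unif = this
  define w where "w z = lim (\<lambda>n. iter n z)" for z
  have lim: "uniform_limit S iter w sequentially" if "\<And>z. z \<in> S \<Longrightarrow> z \<in> W \<and> d \<le> gap z" "d > 0" for S d
    using uniformly_convergent_uniform_limit_iff[of S iter] unif[OF that] unfolding w_def[abs_def] by auto
  have w_lim: "(\<lambda>n. iter n z) \<longlonglongrightarrow> w z" if "z \<in> W" for z
    using tendsto_uniform_limitI[OF lim[of "{z}" "gap z"], of z] that gap_pos by auto
  have holw: "cholomorphic_on w W"
  proof (rule cholomorphic_uniform_limit)
    show "cholomorphic_on (iter n) W" for n using good_iter[of n] by (simp add: good_def)
    fix z assume z: "z \<in> W"
    define U where "U = {x. gap z / 2 < gap x}"
    have "open U"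
      unfolding U_def using continuous_on_gap[of UNIV] by (intro open_Collect_less) (auto intro: continuous_intros)
    moreover have "z \<in> U" using gap_pos[OF z] by (simp add: U_def)
    ultimately obtain \<rho> where \<rho>: "\<rho> > 0" "cball z \<rho> \<subseteq> U"
      using open_contains_cball by blast
    have sub: "x \<in> W \<and> gap z / 2 \<le> gap x" if "x \<in> cball z \<rho>" for x
      using that \<rho> gap_pos[OF z] by (force simp: U_def W_def)
    have "uniform_limit (cball z \<rho>) iter w sequentially"
      by (rule lim[OF sub]) (use gap_pos[OF z] in auto)
    then show "\<exists>\<rho>>0. cball z \<rho> \<subseteq> W \<and> uniform_limit (cball z \<rho>) iter w sequentially"
      using \<rho>(1) sub by blast
  qed
  have close: "cmod (w z - iter n z) \<le> 4 * (3 / 4) ^ n * c / sqrt (gap z)" if z: "z \<in> W" for z n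
  proof (rule Lim_bounded)
    show "(\<lambda>m. cmod (iter m z - iter n z)) \<longlonglongrightarrow> cmod (w z - iter n z)"
      by (intro tendsto_intros w_lim z)
  qed (use dist[OF z] in blast)
  have hol_iter: "cholomorphic_on (iter n) W" for n using good_iter[of n] by (simp add: good_def)
  have grad_lim: "(\<lambda>n. hol_grad (primitive i p (iter n)) z $ j) \<longlonglongrightarrow> hol_grad (primitive i p w) z $ j"
    if z: "z \<in> W" for z j
  proof (cases "j = i")
    case True
    then show ?thesis using w_lim[OF z] grad_same[OF hol_iter z] grad_same[OF holw z] by simp
  next
    case False
    have "cmod (hol_grad (primitive i p (iter n)) z $ j - hol_grad (primitive i p w) z $ j)
      \<le> 4 * (3 / 4) ^ n * (6 * c * \<epsilon> / sqrt (gap z))" for n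
    proof -
      have "cmod (d_z j (primitive i p (\<lambda>z. iter n z - w z)) z) \<le> 6 * (4 * (3 / 4) ^ n * c) * \<epsilon> / sqrt (gap z)"
        using close[of _ n] c0
        by (intro d_z_primitive_bound chol_intros holw hol_iter False z) (auto simp: norm_minus_commute)
      then show ?thesis
        using d_z_primitive_diff[OF hol_iter holw z, of j n] by (simp add: hol_grad_def mult_ac)
    qed
    then have "(\<lambda>n. hol_grad (primitive i p (iter n)) z $ j - hol_grad (primitive i p w) z $ j) \<longlonglongrightarrow> 0"
      by (intro Lim_null_comparison[OF _ geo[of 4 "6 * c * \<epsilon> / sqrt (gap z)"]]) auto
    then show ?thesis by (simp add: LIM_zero_iff)
  qed
  have adm: "admissible w"
    unfolding admissible_def
  proof (intro conjI ballI allI holw)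
    fix z j assume z: "z \<in> W"
    show "cmod (hol_grad (primitive i p w) z $ j) \<le> R"
      by (rule Lim_bounded[OF tendsto_norm[OF grad_lim[OF z]], of 0])
        (use good_imp_admissible[OF good_iter] z in \<open>auto simp: admissible_def\<close>)
  qed
  have "T w z = w z" if z: "z \<in> W" for z
  proof -
    have "cmod (T (iter n) z - T w z) \<le> 4 * (3 / 4) ^ n * (3 / 4 * c / sqrt (gap z))" for n
    proof -
      have "cmod (T (iter n) z - T w z) \<le> 3 / 4 * (4 * (3 / 4) ^ n * c) / sqrt (gap z)"
        using close[of _ n] c0
        by (intro T_contraction good_imp_admissible good_iter adm z) (auto simp: norm_minus_commute)
      then show ?thesis by (simp add: mult_ac)
    qed
    then have "(\<lambda>n. T (iter n) z - T w z) \<longlonglongrightarrow> 0"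
      by (intro Lim_null_comparison[OF _ geo[of 4 "3 / 4 * c / sqrt (gap z)"]]) auto
    then have "(\<lambda>n. iter (Suc n) z) \<longlonglongrightarrow> T w z" by (simp add: LIM_zero_iff iter_Suc)
    moreover have "(\<lambda>n. iter (Suc n) z) \<longlonglongrightarrow> w z"
      using LIMSEQ_Suc[OF w_lim[OF z]] .
    ultimately show ?thesis by (rule LIMSEQ_unique)
  qed
  with adm show ?thesis by blast
qed

end

section \<open>Flat solutions of a first-order equation in normal form\<close>

text \<open>
  Strict differentiability: partial derivatives of holomorphic functions are continuous, and the
  mean value inequality is applied on the segment from \<open>Y\<close> to \<open>X\<close>.
\<close>

lemma d_z_strict_bound:
  assumes V: "open V" "X0 \<in> V" and F: "cholomorphic_on F V" and e: "e > 0"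
  obtains r where "r > 0" "ball X0 r \<subseteq> V"
    "\<And>X Y. X \<in> ball X0 r \<Longrightarrow> Y \<in> ball X0 r \<Longrightarrow>
      cmod (F X - F Y) \<le> (\<Sum>k\<in>UNIV. (cmod (d_z k F X0) + e) * cmod (X $ k - Y $ k))"
proof -
  have "\<forall>\<^sub>F X in nhds X0. cmod (d_z k F X) \<le> cmod (d_z k F X0) + e" for k
  proof -
    have "isCont (d_z k F) X0"
      using continuous_on_d_z[OF V(1) F] V by (simp add: continuous_on_eq_continuous_at)
    then have "(d_z k F \<longlongrightarrow> d_z k F X0) (nhds X0)"
      by (simp add: continuous_at tendsto_nhds_iff)
    then have "\<forall>\<^sub>F X in nhds X0. dist (d_z k F X) (d_z k F X0) < e"
      using e by (rule tendstoD)
    then show ?thesis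
    proof eventually_elim
      case (elim X)
      then show ?case
        using norm_triangle_ineq2[of "d_z k F X" "d_z k F X0"] by (simp add: dist_norm)
    qed
  qed
  then have "\<forall>\<^sub>F X in nhds X0. \<forall>k\<in>UNIV. cmod (d_z k F X) \<le> cmod (d_z k F X0) + e"
    by (intro eventually_ball_finite) auto
  moreover have "\<forall>\<^sub>F X in nhds X0. X \<in> V"
    using V by (rule eventually_nhds_in_open)
  ultimately have "\<forall>\<^sub>F X in nhds X0. X \<in> V \<and> (\<forall>k. cmod (d_z k F X) \<le> cmod (d_z k F X0) + e)"
    by eventually_elim auto
  then obtain r where r: "r > 0" "\<And>X. dist X X0 < r \<Longrightarrow> X \<in> V \<and> (\<forall>k. cmod (d_z k F X) \<le> cmod (d_z k F X0) + e)"
    unfolding eventually_nhds_metric by blast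
  show thesis
  proof (rule that[OF r(1)])
    show "ball X0 r \<subseteq> V" using r(2) by (auto simp: dist_commute)
    fix X Y assume XY: "X \<in> ball X0 r" "Y \<in> ball X0 r"
    let ?B = "\<Sum>k\<in>UNIV. (cmod (d_z k F X0) + e) * cmod (X $ k - Y $ k)"
    have seg: "Y + c *s (X - Y) \<in> ball X0 r" if c: "c \<in> closed_segment 0 1" for c :: complex
    proof -
      obtain t where t: "0 \<le> t" "t \<le> 1" "c = of_real t"
        using c by (auto simp: in_segment scaleR_conv_of_real)
      have "c *s (X - Y) = t *\<^sub>R (X - Y)"
        by (simp add: t(3) vec_eq_iff scaleR_conv_of_real[where 'a = complex] right_diff_distrib)
      then have "Y + c *s (X - Y) = (1 - t) *\<^sub>R Y + t *\<^sub>R X"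
        by (simp add: algebra_simps)
      then show ?thesis
        using convexD_alt[OF convex_ball XY(2,1) t(1,2)] by simp
    qed
    have "cmod (F (Y + 1 *s (X - Y)) - F (Y + 0 *s (X - Y))) \<le> ?B * cmod (1 - 0)"
    proof (rule field_differentiable_bound[OF convex_closed_segment])
      fix c :: complex assume c: "c \<in> closed_segment 0 1"
      have near: "dist (Y + c *s (X - Y)) X0 < r" using seg[OF c] by (simp add: dist_commute)
      show "((\<lambda>c. F (Y + c *s (X - Y))) has_field_derivative
          (\<Sum>k\<in>UNIV. d_z k F (Y + c *s (X - Y)) * (X - Y) $ k)) (at c within closed_segment 0 1)"
        using line_has_field_derivative[OF F] r(2)[OF near] has_field_derivative_at_within by blast
      have "cmod (\<Sum>k\<in>UNIV. d_z k F (Y + c *s (X - Y)) * (X - Y) $ k)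
          \<le> (\<Sum>k\<in>UNIV. cmod (d_z k F (Y + c *s (X - Y)) * (X - Y) $ k))"
        by (rule norm_sum)
      also have "\<dots> \<le> ?B"
        using r(2)[OF near] by (intro sum_mono) (simp add: norm_mult mult_right_mono)
      finally show "cmod (\<Sum>k\<in>UNIV. d_z k F (Y + c *s (X - Y)) * (X - Y) $ k) \<le> ?B" .
    qed auto
    then show "cmod (F X - F Y) \<le> ?B" by simp
  qed
qed

lemma sum_UNIV_Plus: "(\<Sum>k\<in>UNIV. f k) = (\<Sum>j\<in>UNIV. f (Inl j)) + (\<Sum>j\<in>UNIV. f (Inr j))"
  for f :: "'m::finite + 'n::finite \<Rightarrow> 'a::comm_monoid_add"
  using sum.Plus[of UNIV UNIV f] by simp

text \<open>
  A function of position and covector is treated as one holomorphic function of the variables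
  indexed by \<open>'n + 'n\<close>, so that the tools above apply to it.
\<close>

definition join :: "'a ^ 'n \<Rightarrow> 'a ^ 'n \<Rightarrow> 'a ^ ('n + 'n)" where
  "join z \<zeta> = (\<chi> k. case k of Inl j \<Rightarrow> z $ j | Inr j \<Rightarrow> \<zeta> $ j)"

definition base_part :: "'a ^ ('n + 'n) \<Rightarrow> 'a ^ 'n" where
  "base_part X = (\<chi> j. X $ Inl j)"

definition fibre_part :: "'a ^ ('n + 'n) \<Rightarrow> 'a ^ 'n" where
  "fibre_part X = (\<chi> j. X $ Inr j)"

lemma join_nth [simp]: "join z \<zeta> $ Inl j = z $ j" "join z \<zeta> $ Inr j = \<zeta> $ j"
  by (simp_all add: join_def)

lemma parts_join [simp]: "base_part (join z \<zeta>) = z" "fibre_part (join z \<zeta>) = \<zeta>"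
  by (simp_all add: base_part_def fibre_part_def vec_eq_iff)

lemma parts_nth [simp]: "base_part X $ j = X $ Inl j" "fibre_part X $ j = X $ Inr j"
  by (simp_all add: base_part_def fibre_part_def)

lemma norm_join_le: "norm (X :: complex ^ ('n::finite + 'n)) \<le> (\<Sum>j\<in>UNIV. cmod (X $ Inl j)) + (\<Sum>j\<in>UNIV. cmod (X $ Inr j))"
proof -
  have "norm X \<le> (\<Sum>k\<in>UNIV. cmod (X $ k))"
    unfolding norm_vec_def by (rule L2_set_le_sum) simp
  then show ?thesis by (simp add: sum_UNIV_Plus)
qed

text \<open>
  The Cauchy problem \<open>\<partial>\<^sub>i h = F(z, \<partial>h)\<close>, \<open>h = 0\<close> on \<open>z\<^sub>i = p\<^sub>i\<close>, for an \<open>F\<close> whose Lipschitz constant in \<open>\<eta>\<^sub>i\<close> is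
  small near the base point.

  The second derivatives of \<open>h\<close> vanish at \<open>p\<close> for the following reason. Those in two directions
  different from \<open>i\<close> vanish by the initial condition. For the others, differentiate the equation at
  \<open>p\<close>: the terms \<open>\<partial>F/\<partial>z\<^sub>k\<close> and \<open>\<partial>F/\<partial>\<eta>\<^sub>i\<close> are zero, so \<open>\<partial>\<^sub>k \<partial>\<^sub>i h\<close> is a combination of the \<open>\<partial>\<^sub>k \<partial>\<^sub>j h\<close> with
  \<open>j \<noteq> i\<close>; these vanish for \<open>k \<noteq> i\<close>, and then, by symmetry, also for \<open>k = i\<close>.
\<close>

proposition noncharacteristic_flat_solution:
  fixes F :: "complex ^ ('n::finite + 'n) \<Rightarrow> complex" and p :: "complex ^ 'n"
  assumes V: "open V" "join p 0 \<in> V" and F: "cholomorphic_on F V"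
    and F0: "F (join p 0) = 0"
    and Fi: "d_z (Inr i) F (join p 0) = 0"
    and Fz: "\<And>j. d_z (Inl j) F (join p 0) = 0"
  obtains r h where "r > 0" "cholomorphic_on h (ball p r)" "h p = 0"
    "\<And>z. z \<in> ball p r \<Longrightarrow> join z (hol_grad h z) \<in> V"
    "\<And>z. z \<in> ball p r \<Longrightarrow> d_z i h z = F (join z (hol_grad h z))"
    "\<And>j. d_z j h p = 0" "\<And>j k. d_z k (d_z j h) p = 0"
proof -
  define n where "n = real CARD('n)"
  have n: "n \<ge> 1" using zero_less_card_finite[where 'a = 'n] unfolding n_def by linarith
  let ?X0 = "join p 0"
  obtain r0 where r0: "r0 > 0" "ball ?X0 r0 \<subseteq> V"
    "\<And>X Y. X \<in> ball ?X0 r0 \<Longrightarrow> Y \<in> ball ?X0 r0 \<Longrightarrow>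
      cmod (F X - F Y) \<le> (\<Sum>k\<in>UNIV. (cmod (d_z k F ?X0) + 1 / 4) * cmod (X $ k - Y $ k))"
    using d_z_strict_bound[OF V F, of "1 / 4"] by auto
  \<comment> \<open>If \<open>|z - p| < R\<close> and all \<open>|\<eta>\<^sub>j| \<le> R\<close>, then \<open>(z, \<eta>)\<close> has distance at most \<open>2 n R < r0\<close> from \<open>(p, 0)\<close>.\<close>
  define R where "R = r0 / (4 * n)"
  define K where "K = (\<Sum>k\<in>UNIV. cmod (d_z k F ?X0) + 1 / 4)"
  have K_ge: "cmod (d_z k F ?X0) + 1 / 4 \<le> K" for k
    unfolding K_def by (rule member_le_sum) auto
  have K: "K > 0" using K_ge[of "Inl undefined"] norm_ge_zero[of "d_z (Inl undefined) F ?X0"] by linarith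
  have R: "R > 0" using r0 n by (simp add: R_def)
  have in_ball: "join z \<eta> \<in> ball ?X0 r0" if "z \<in> ball p R" "\<And>j. cmod (\<eta> $ j) \<le> R" for z \<eta>
  proof -
    have zj: "cmod (z $ j - p $ j) \<le> R" for j
      using that(1) Finite_Cartesian_Product.norm_nth_le[of "z - p" j] by (simp add: dist_norm norm_minus_commute)
    have "norm (join z \<eta> - ?X0) \<le> (\<Sum>j\<in>UNIV. cmod (z $ j - p $ j)) + (\<Sum>j\<in>UNIV. cmod (\<eta> $ j))"
      using norm_join_le[of "join z \<eta> - ?X0"] by simp
    also have "\<dots> \<le> (\<Sum>j\<in>(UNIV :: 'n set). R) + (\<Sum>j\<in>(UNIV :: 'n set). R)"
      by (intro add_mono sum_mono zj that(2))
    also have "\<dots> = 2 * n * R" by (simp add: n_def)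
    also have "\<dots> < r0" using n r0 by (simp add: R_def)
    finally show ?thesis by (simp add: dist_norm norm_minus_commute)
  qed
  define \<epsilon> where "\<epsilon> = min (1 / 2) (1 / (12 * n * K))"
  define r where "r = Min {R, R / (4 * K), (1 / (4 * K))\<^sup>2, R\<^sup>2}"
  have r_le: "r \<le> R" "r \<le> R / (4 * K)" "r \<le> (1 / (4 * K))\<^sup>2" "r \<le> R\<^sup>2"
    by (auto simp: r_def)
  have rpos: "r > 0" using R K by (auto simp: r_def)
  interpret w: wedge i p \<epsilon> r
    by unfold_locales (use n K rpos in \<open>auto simp: \<epsilon>_def\<close>)
  have W_ball: "z \<in> ball p R" if "z \<in> w.W" for z
    using that w.W_subset_ball r_le(1) by (auto intro: order_less_le_trans)
  interpret c: wedge_contraction i p \<epsilon> r "\<lambda>z \<eta>. F (join z \<eta>)" K R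
  proof unfold_locales
    fix z z' \<eta> \<eta>' :: "complex ^ 'n"
    assume W: "z \<in> w.W" "z' \<in> w.W" and \<eta>: "\<And>j. cmod (\<eta> $ j) \<le> R" "\<And>j. cmod (\<eta>' $ j) \<le> R"
    have "cmod (F (join z \<eta>) - F (join z' \<eta>')) \<le> (\<Sum>j\<in>UNIV. (cmod (d_z (Inl j) F ?X0) + 1 / 4) * cmod (z $ j - z' $ j))
       + (\<Sum>j\<in>UNIV. (cmod (d_z (Inr j) F ?X0) + 1 / 4) * cmod (\<eta> $ j - \<eta>' $ j))"
      using r0(3)[OF in_ball in_ball] W_ball W \<eta> by (simp add: sum_UNIV_Plus)
    also have "(\<Sum>j\<in>UNIV. (cmod (d_z (Inl j) F ?X0) + 1 / 4) * cmod (z $ j - z' $ j)) \<le>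
       (\<Sum>j\<in>UNIV. (cmod (d_z (Inl j) F ?X0) + 1 / 4) * norm (z - z'))"
    proof (intro sum_mono mult_left_mono)
      show "cmod (z $ j - z' $ j) \<le> norm (z - z')" for j
        using Finite_Cartesian_Product.norm_nth_le[of "z - z'" j] by simp
    qed auto
    also have "\<dots> \<le> K * norm (z - z')"
    proof -
      have "(\<Sum>j\<in>UNIV. cmod (d_z (Inl j) F ?X0) + 1 / 4) \<le> K"
        unfolding K_def sum_UNIV_Plus by (simp add: sum_nonneg)
      then show ?thesis
        by (simp add: sum_distrib_right[symmetric] mult_right_mono)
    qed
    also have "(\<Sum>j\<in>UNIV. (cmod (d_z (Inr j) F ?X0) + 1 / 4) * cmod (\<eta> $ j - \<eta>' $ j)) \<le>
       (\<Sum>j\<in>UNIV. (if j = i then 1 / 4 else K) * cmod (\<eta> $ j - \<eta>' $ j))"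
      using K_ge Fi by (intro sum_mono mult_right_mono) auto
    finally show "cmod (F (join z \<eta>) - F (join z' \<eta>')) \<le> K * norm (z - z') +
       (\<Sum>j\<in>UNIV. (if j = i then 1 / 4 else K) * cmod (\<eta> $ j - \<eta>' $ j))" by simp
  next
    fix u :: "complex ^ 'n \<Rightarrow> complex ^ 'n"
    assume u: "\<And>j. cholomorphic_on (\<lambda>z. u z $ j) w.W" and le: "\<And>z j. z \<in> w.W \<Longrightarrow> cmod (u z $ j) \<le> R"
    show "cholomorphic_on (\<lambda>z. F (join z (u z))) w.W"
    proof (rule cholomorphic_on_compose[OF F])
      show "join z (u z) \<in> V" if "z \<in> w.W" for z
        using in_ball[OF W_ball[OF that], of "u z"] le[OF that] r0(2) by auto
      show "cholomorphic_on (\<lambda>z. join z (u z) $ k) w.W" for k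
        by (cases k) (auto intro: u cholomorphic_on_nth)
    qed
  next
    show "12 * real CARD('n) * K * \<epsilon> \<le> 1"
    proof -
      have "12 * n * K * \<epsilon> \<le> 12 * n * K * (1 / (12 * n * K))"
        using n K by (intro mult_left_mono) (auto simp: \<epsilon>_def)
      then show ?thesis using n K by (simp add: n_def)
    qed
    show "4 * K * r \<le> R" using r_le(2) K by (simp add: field_simps)
    have "sqrt r \<le> 1 / (4 * K)" using r_le(3) K by (intro real_le_lsqrt) auto
    then show "4 * K * sqrt r \<le> 1" using K by (simp add: field_simps)
    show "sqrt r \<le> R" using r_le(4) R by (intro real_le_lsqrt) auto
  qed (use K R F0 in auto)
  obtain w where w: "c.admissible w" "\<And>z. z \<in> w.W \<Longrightarrow> c.T w z = w z"
    using c.fixed_point_exists by blast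
  define h where "h = primitive i p w"
  have hw: "cholomorphic_on w w.W" and hR: "\<And>z j. z \<in> w.W \<Longrightarrow> cmod (hol_grad h z $ j) \<le> R"
    using w(1) by (auto simp: c.admissible_def h_def)
  have hh: "cholomorphic_on h w.W" unfolding h_def by (rule c.hol_primitive[OF hw])
  have dih: "d_z i h z = w z" if "z \<in> w.W" for z
    using c.grad_same[OF hw that] by (simp add: h_def hol_grad_def)
  have eqn: "d_z i h z = F (join z (hol_grad h z))" if "z \<in> w.W" for z
    using w(2)[OF that] dih[OF that] by (simp add: c.T_def h_def)
  have prim_p: "primitive i p v p = 0" for v by (simp add: primitive_def)
  have dj_p: "d_z j h p = 0" if "j \<noteq> i" for j
    using c.grad_other[OF hw w.p_in_W that] prim_p by (simp add: h_def hol_grad_def)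
  have lip: "cmod (F (join z \<eta>) - F (join p 0)) \<le> K * norm (z - p) + (\<Sum>j\<in>UNIV. (if j = i then 1 / 4 else K) * cmod (\<eta> $ j))"
    if "z \<in> w.W" "\<And>j. cmod (\<eta> $ j) \<le> R" for z \<eta>
    using c.Lip[OF that(1) w.p_in_W that(2), of 0] R by simp
  have wp: "w p = 0"
  proof -
    have "cmod (w p) \<le> (\<Sum>j\<in>UNIV. (if j = i then 1 / 4 else K) * cmod (d_z j h p))"
      using lip[OF w.p_in_W hR[OF w.p_in_W]] eqn[OF w.p_in_W] dih[OF w.p_in_W] F0
      by (simp add: hol_grad_def)
    also have "\<dots> = (\<Sum>j\<in>UNIV. if j = i then cmod (w p) / 4 else 0)"
      using dj_p dih[OF w.p_in_W] by (intro sum.cong) auto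
    finally show ?thesis by simp
  qed
  have grad_p: "d_z j h p = 0" for j
    using dj_p wp dih[OF w.p_in_W] by (cases "j = i") auto
  have dkj: "d_z k (d_z j h) p = 0" if "j \<noteq> i" "k \<noteq> i" for j k
    using w.d_z_d_z_primitive[OF hw w.p_in_W that] prim_p by (simp add: h_def)
  have dij: "d_z i (d_z j h) p = d_z j w p" if "j \<noteq> i" for j
  proof -
    have "d_z i (d_z j h) p = d_z i (primitive i p (d_z j w)) p"
      using c.grad_other[OF hw _ that]
      by (intro d_z_cong_open[OF w.open_W w.p_in_W]) (simp add: h_def hol_grad_def)
    also have "\<dots> = d_z j w p"
      using c.grad_same[OF cholomorphic_on_d_z[OF w.open_W hw] w.p_in_W] by (simp add: hol_grad_def)
    finally show ?thesis .
  qed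
  have djh: "cholomorphic_on (d_z j h) w.W" for j by (rule cholomorphic_on_d_z[OF w.open_W hh])
  \<comment> \<open>The equation \<open>w = F(z, \<partial>h)\<close>, differentiated at \<open>p\<close>. As \<open>e\<close> is arbitrary, the slots \<open>z\<^sub>j\<close>
    contribute nothing in the limit.\<close>
  have w_bound: "cmod (d_z k w p) \<le> n * e + (\<Sum>j\<in>UNIV. (if j = i then 1 / 4 else K + e) * cmod (d_z k (d_z j h) p))"
    if e: "0 < e" "e \<le> 1 / 4" for e k
  proof -
    obtain s where s: "s > 0" "ball ?X0 s \<subseteq> V"
      "\<And>X Y. X \<in> ball ?X0 s \<Longrightarrow> Y \<in> ball ?X0 s \<Longrightarrow>
      cmod (F X - F Y) \<le> (\<Sum>k\<in>UNIV. (cmod (d_z k F ?X0) + e) * cmod (X $ k - Y $ k))"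
      by (rule d_z_strict_bound[OF V F e(1)]) (rule that)
    define U where "U = w.W \<inter> {z. join z (hol_grad h z) \<in> ball ?X0 s}"
    have "continuous_on w.W (\<lambda>z. join z (hol_grad h z))"
      unfolding join_def
    proof (rule continuous_on_vec_lambda)
      show "continuous_on w.W (\<lambda>z. case k of Inl j \<Rightarrow> z $ j | Inr j \<Rightarrow> hol_grad h z $ j)" for k
        using cholomorphic_on_imp_continuous_on[OF djh]
        by (cases k) (auto intro!: continuous_intros simp: hol_grad_def)
    qed
    then have "open U"
      unfolding U_def vimage_def[symmetric] by (rule continuous_open_preimage[OF _ w.open_W open_ball])
    have "hol_grad h p = 0" using grad_p by (simp add: hol_grad_def vec_eq_iff)
    then have pU: "p \<in> U" using w.p_in_W s(1) by (simp add: U_def)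
    have "cmod (d_z k w p) \<le> n * e + (\<Sum>j\<in>UNIV. (if j = i then 1 / 4 else K + e) * cmod (d_z k (\<lambda>z. hol_grad h z $ j) p))"
    proof (rule d_z_le_of_increment_bound[OF \<open>open U\<close> pU])
      show "cholomorphic_on w U" using hw by (rule cholomorphic_on_subset) (auto simp: U_def)
      show "cholomorphic_on (\<lambda>z. hol_grad h z $ j) U" for j
        using cholomorphic_on_subset[OF djh[of j], of U] by (simp add: hol_grad_def U_def)
    next
      fix x assume x: "x \<in> U"
      then have xW: "x \<in> w.W" by (simp add: U_def)
      have "cmod (w x - w p) = cmod (F (join x (hol_grad h x)) - F (join p (hol_grad h p)))"
        using eqn[OF xW] eqn[OF w.p_in_W] dih[OF xW] dih[OF w.p_in_W] by simp
      also have "\<dots> \<le> (\<Sum>j\<in>UNIV. e * cmod (x $ j - p $ j)) + (\<Sum>j\<in>UNIV. (cmod (d_z (Inr j) F ?X0) + e) * cmod (hol_grad h x $ j - hol_grad h p $ j))"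
        using s(3)[of "join x (hol_grad h x)" "join p (hol_grad h p)"] x pU Fz
        by (simp add: U_def sum_UNIV_Plus)
      also have "(\<Sum>j\<in>UNIV. e * cmod (x $ j - p $ j)) \<le> (\<Sum>j\<in>(UNIV :: 'n set). e * norm (x - p))"
      proof (intro sum_mono mult_left_mono)
        show "cmod (x $ j - p $ j) \<le> norm (x - p)" for j
          using Finite_Cartesian_Product.norm_nth_le[of "x - p" j] by simp
      qed (use e in auto)
      also have "\<dots> = n * e * norm (x - p)" by (simp add: n_def)
      also have "(\<Sum>j\<in>UNIV. (cmod (d_z (Inr j) F ?X0) + e) * cmod (hol_grad h x $ j - hol_grad h p $ j)) \<le>
        (\<Sum>j\<in>UNIV. (if j = i then 1 / 4 else K + e) * cmod (hol_grad h x $ j - hol_grad h p $ j))"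
      proof (intro sum_mono mult_right_mono)
        show "cmod (d_z (Inr j) F ?X0) + e \<le> (if j = i then 1 / 4 else K + e)" for j
          using K_ge[of "Inr j"] Fi e by auto
      qed auto
      finally show "cmod (w x - w p) \<le> n * e * norm (x - p) +
        (\<Sum>j\<in>UNIV. (if j = i then 1 / 4 else K + e) * cmod (hol_grad h x $ j - hol_grad h p $ j))" by simp
    qed
    then show ?thesis by (simp add: hol_grad_def)
  qed
  have dki: "d_z k (d_z i h) p = d_z k w p" for k
    using dih by (intro d_z_cong_open[OF w.open_W w.p_in_W])
  have dw_step: "d_z k w p = 0" if "\<And>j. j \<noteq> i \<Longrightarrow> d_z k (d_z j h) p = 0" for k
  proof (rule ccontr)
    assume nz: "d_z k w p \<noteq> 0"
    define x where "x = cmod (d_z k w p)"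
    define e where "e = min (1 / 4) (x / (4 * n))"
    have x: "x > 0" using nz by (simp add: x_def)
    have e: "0 < e" "e \<le> 1 / 4" using x n by (auto simp: e_def)
    have "n * e \<le> n * (x / (4 * n))" using n by (intro mult_left_mono) (auto simp: e_def)
    then have "n * e \<le> x / 4" using n by simp
    moreover have "(\<Sum>j\<in>UNIV. (if j = i then 1 / 4 else K + e) * cmod (d_z k (d_z j h) p)) =
      (\<Sum>j\<in>UNIV. if j = i then x / 4 else 0)"
      using that dki by (intro sum.cong) (auto simp: x_def)
    moreover have "(\<Sum>j\<in>(UNIV :: 'n set). if j = i then x / 4 else 0) = x / 4" by simp
    ultimately show False using w_bound[OF e, of k] x unfolding x_def[symmetric] by linarith
  qed
  have dw1: "d_z k w p = 0" if "k \<noteq> i" for k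
    using dkj that by (intro dw_step) auto
  have dw: "d_z k w p = 0" for k
    using dw1 dij dw_step[of i] by (cases "k = i") auto
  have ddh: "d_z k (d_z j h) p = 0" for j k
    using dki dw dij dkj by (cases "j = i"; cases "k = i") auto
  obtain r' where r': "r' > 0" "ball p r' \<subseteq> w.W"
    using w.open_W w.p_in_W open_contains_ball by blast
  show thesis
  proof (rule that[OF r'(1)])
    show "cholomorphic_on h (ball p r')" using hh r'(2) by (rule cholomorphic_on_subset)
    show "join z (hol_grad h z) \<in> V" if "z \<in> ball p r'" for z
      using in_ball[OF W_ball hR] r'(2) that r0(2) by blast
    show "d_z i h z = F (join z (hol_grad h z))" if "z \<in> ball p r'" for z
      using eqn r'(2) that by blast
  qed (use grad_p ddh prim_p in \<open>auto simp: h_def\<close>)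
qed

section \<open>Characteristic functions with prescribed second-order jet\<close>

lemma flat_second_order:
  assumes r: "r > 0" and h: "cholomorphic_on h (ball p r)" and h0: "h p = 0"
    and h1: "\<And>j. d_z j h p = 0" and h2: "\<And>j k. d_z k (d_z j h) p = 0" and e: "e > 0"
  shows "\<exists>s>0. \<forall>z\<in>ball p s. cmod (h z) \<le> e * (norm (z - p))\<^sup>2"
proof -
  define n where "n = real CARD('a)"
  have n: "n \<ge> 1" using zero_less_card_finite[where 'a = 'a] unfolding n_def by linarith
  have "\<forall>\<^sub>F z in nhds p. cmod (d_z j h z) \<le> e / n * norm (z - p)" for j
  proof -
    have "(d_z j h has_derivative (\<lambda>v. \<Sum>k\<in>UNIV. d_z k (d_z j h) p * v $ k)) (at p)"
      using r by (intro cholomorphic_on_has_derivative[OF cholomorphic_on_d_z[OF open_ball h]]) simp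
    then have "(d_z j h has_derivative (\<lambda>v. 0)) (at p)" by (simp add: h2)
    then have "\<exists>d>0. \<forall>y. norm (y - p) < d \<longrightarrow> norm (d_z j h y - d_z j h p - 0) \<le> e / n * norm (y - p)"
      unfolding has_derivative_at_alt using e n by (metis divide_pos_pos less_le_trans zero_less_one)
    then show ?thesis
      by (auto simp: eventually_nhds_metric dist_norm h1)
  qed
  then have "\<forall>\<^sub>F z in nhds p. \<forall>j\<in>UNIV. cmod (d_z j h z) \<le> e / n * norm (z - p)"
    by (intro eventually_ball_finite) auto
  then obtain d where d: "d > 0" "\<And>z j. dist z p < d \<Longrightarrow> cmod (d_z j h z) \<le> e / n * norm (z - p)"
    unfolding eventually_nhds_metric by auto
  have "cmod (h z) \<le> e * (norm (z - p))\<^sup>2" if z: "z \<in> ball p (min d r)" for z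
  proof -
    have seg: "norm (c *s (z - p)) \<le> norm (z - p)" if c: "c \<in> cball 0 1" for c :: complex
      unfolding norm_vector_smult using c by (intro mult_left_le_one_le) auto
    have "cmod (h (p + 1 *s (z - p)) - h (p + 0 *s (z - p))) \<le> e * (norm (z - p))\<^sup>2 * cmod (1 - 0)"
    proof (rule field_differentiable_bound[OF convex_cball])
      fix c :: complex assume c: "c \<in> cball 0 1"
      have near: "dist (p + c *s (z - p)) p < d" "p + c *s (z - p) \<in> ball p r"
        using seg[OF c] z by (auto simp: dist_norm norm_minus_commute)
      show "((\<lambda>c. h (p + c *s (z - p))) has_field_derivative
          (\<Sum>k\<in>UNIV. d_z k h (p + c *s (z - p)) * (z - p) $ k)) (at c within cball 0 1)"
        using line_has_field_derivative[OF h near(2)] has_field_derivative_at_within by blast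
      have "cmod (\<Sum>k\<in>UNIV. d_z k h (p + c *s (z - p)) * (z - p) $ k)
          \<le> (\<Sum>k\<in>(UNIV::'a set). e / n * norm (z - p) * norm (z - p))"
      proof (rule order_trans[OF norm_sum], rule sum_mono)
        fix k
        have "cmod (d_z k h (p + c *s (z - p))) \<le> e / n * norm (c *s (z - p))"
          using d(2)[OF near(1), of k] by simp
        also have "\<dots> \<le> e / n * norm (z - p)"
          using seg[OF c] e n by (intro mult_left_mono) auto
        finally show "cmod (d_z k h (p + c *s (z - p)) * (z - p) $ k) \<le> e / n * norm (z - p) * norm (z - p)"
          unfolding norm_mult by (intro mult_mono Finite_Cartesian_Product.norm_nth_le) (use e n in auto)
      qed
      also have "\<dots> = e * (norm (z - p))\<^sup>2"
        using n by (simp add: n_def power2_eq_square)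
      finally show "cmod (\<Sum>k\<in>UNIV. d_z k h (p + c *s (z - p)) * (z - p) $ k) \<le> e * (norm (z - p))\<^sup>2" .
    qed auto
    then show ?thesis by (simp add: h0)
  qed
  then show ?thesis using d(1) r by (intro exI[of _ "min d r"]) auto
qed

lemma cholomorphic_on_principal_symbol_fibre: "cholomorphic_on (principal_symbol m a z) U"
  unfolding principal_symbol_def[abs_def] by (intro chol_intros)

lemma principal_symbol_scale:
  "principal_symbol m a z (c *s \<zeta>) = c ^ m * principal_symbol m a z \<zeta>"
proof -
  have "(\<Prod>j\<in>UNIV. ((c *s \<zeta>) $ j) ^ \<alpha> j) = c ^ m * (\<Prod>j\<in>UNIV. (\<zeta> $ j) ^ \<alpha> j)"
    if "sum \<alpha> UNIV = m" for \<alpha>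
    using that by (simp add: power_mult_distrib prod.distrib power_sum[symmetric])
  then show ?thesis
    unfolding principal_symbol_def by (simp add: sum_distrib_left mult_ac)
qed

text \<open>
  Euler's identity for the principal symbol, which is homogeneous in \<open>\<zeta>\<close>, at a
  characteristic covector: the vector \<open>\<partial>\<^sub>\<zeta> P\<^sub>m\<close> is annihilated by \<open>\<zeta>\<close>, and so is tangent to the boundary when
  \<open>\<zeta> = \<partial>\<rho>\<close>.
\<close>

lemma euler_characteristic:
  assumes "principal_symbol m a z \<zeta> = 0"
  shows "(\<Sum>j\<in>UNIV. symbol_dzeta m a j z \<zeta> * \<zeta> $ j) = 0"
proof -
  have "((\<lambda>c. principal_symbol m a z (\<zeta> + c *s \<zeta>)) has_field_derivative
      (\<Sum>j\<in>UNIV. symbol_dzeta m a j z (\<zeta> + 0 *s \<zeta>) * \<zeta> $ j)) (at 0)"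
    unfolding symbol_dzeta_def
    by (rule line_has_field_derivative[OF cholomorphic_on_principal_symbol_fibre[of m a z UNIV]]) simp
  moreover have "principal_symbol m a z (\<zeta> + c *s \<zeta>) = 0" for c
  proof -
    have "\<zeta> + c *s \<zeta> = (1 + c) *s \<zeta>" by (simp add: vector_sadd_rdistrib)
    then show ?thesis by (simp only: principal_symbol_scale assms) simp
  qed
  ultimately have "((\<lambda>c::complex. 0) has_field_derivative (\<Sum>j\<in>UNIV. symbol_dzeta m a j z \<zeta> * \<zeta> $ j)) (at 0)"
    by simp
  then show ?thesis using DERIV_unique[OF _ DERIV_const] by blast
qed

lemma coeffs_holomorphic_nearD:
  assumes "coeffs_holomorphic_near m a p"
  obtains V where "open V" "p \<in> V" "\<And>\<alpha>. sum \<alpha> UNIV = m \<Longrightarrow> cholomorphic_on (a \<alpha>) V"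
proof -
  have "\<forall>\<alpha>\<in>{\<alpha>. sum \<alpha> UNIV = m}. \<exists>V. open V \<and> p \<in> V \<and> cholomorphic_on (a \<alpha>) V"
    using assms unfolding coeffs_holomorphic_near_def by auto
  from bchoice[OF this] obtain V where V: "\<And>\<alpha>. sum \<alpha> UNIV = m \<Longrightarrow> open (V \<alpha>) \<and> p \<in> V \<alpha> \<and> cholomorphic_on (a \<alpha>) (V \<alpha>)"
    by auto
  show thesis
  proof (rule that[of "\<Inter>\<alpha>\<in>{\<alpha>. sum \<alpha> UNIV = m}. V \<alpha>"])
    show "open (\<Inter>\<alpha>\<in>{\<alpha>. sum \<alpha> UNIV = m}. V \<alpha>)"
      using V finite_multi_indices by (intro open_INT) auto
    show "cholomorphic_on (a \<alpha>) (\<Inter>\<alpha>\<in>{\<alpha>. sum \<alpha> UNIV = m}. V \<alpha>)" if "sum \<alpha> UNIV = m" for \<alpha>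
    proof (rule cholomorphic_on_subset)
      show "cholomorphic_on (a \<alpha>) (V \<alpha>)" using V[OF that] by blast
      show "(\<Inter>\<alpha>\<in>{\<alpha>. sum \<alpha> UNIV = m}. V \<alpha>) \<subseteq> V \<alpha>" using that by blast
    qed
  qed (use V in auto)
qed

definition joint_symbol ::
  "nat \<Rightarrow> (('n \<Rightarrow> nat) \<Rightarrow> complex ^ 'n \<Rightarrow> complex) \<Rightarrow> complex ^ ('n + 'n) \<Rightarrow> complex" where
  "joint_symbol m a X = principal_symbol m a (base_part X) (fibre_part X)"

lemma joint_symbol_join: "joint_symbol m a (join z \<zeta>) = principal_symbol m a z \<zeta>"
  by (simp add: joint_symbol_def)

lemma cholomorphic_on_joint_symbol:
  assumes "\<And>\<alpha>. sum \<alpha> UNIV = m \<Longrightarrow> cholomorphic_on (a \<alpha>) V"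
  shows "cholomorphic_on (joint_symbol m a) {X. base_part X \<in> V}"
  unfolding joint_symbol_def[abs_def] principal_symbol_def
proof (intro chol_intros)
  show "cholomorphic_on (\<lambda>X. a \<alpha> (base_part X)) {X. base_part X \<in> V}"
    if "\<alpha> \<in> {\<alpha>. sum \<alpha> UNIV = m}" for \<alpha>
    using that by (intro cholomorphic_on_compose[OF assms]) (auto intro: chol_intros)
qed (auto intro: chol_intros)

lemma open_base_part: "open V \<Longrightarrow> open {X :: complex ^ ('n::finite + 'n). base_part X \<in> V}"
proof -
  assume "open V"
  have "continuous_on UNIV (base_part :: complex ^ ('n + 'n) \<Rightarrow> _)"
    unfolding base_part_def[abs_def] by (intro continuous_on_vec_lambda continuous_intros)
  from continuous_open_preimage[OF this open_UNIV \<open>open V\<close>] show ?thesis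
    by (simp add: vimage_def)
qed

lemma d_z_joint_symbol:
  assumes V: "\<And>\<alpha>. sum \<alpha> UNIV = m \<Longrightarrow> cholomorphic_on (a \<alpha>) V" and "z \<in> V"
  shows "d_z (Inl j) (joint_symbol m a) (join z \<zeta>) = symbol_dz m a j z \<zeta>"
    and "d_z (Inr j) (joint_symbol m a) (join z \<zeta>) = symbol_dzeta m a j z \<zeta>"
proof -
  note J = cholomorphic_on_joint_symbol[of m a V, OF V]
  have 1: "((\<lambda>x. joint_symbol m a (join x \<zeta>)) has_derivative (\<lambda>v. \<Sum>k\<in>UNIV. d_z k (joint_symbol m a) (join z \<zeta>) *
      (case k of Inl j \<Rightarrow> v $ j | Inr j \<Rightarrow> 0))) (at z)"
  proof (rule has_derivative_compose_coords[where \<phi> = "\<lambda>x. join x \<zeta>" and z = z, OF J])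
    show "((\<lambda>x. join x \<zeta> $ k) has_derivative (\<lambda>v. case k of Inl j \<Rightarrow> v $ j | Inr j \<Rightarrow> 0)) (at z)" for k
      by (cases k) (auto intro!: bounded_linear_imp_has_derivative bounded_linear_vec_nth)
  qed (use \<open>z \<in> V\<close> in auto)
  then show "d_z (Inl j) (joint_symbol m a) (join z \<zeta>) = symbol_dz m a j z \<zeta>"
    unfolding symbol_dz_def by (intro d_z_eq_coeff[symmetric]) (simp add: sum_UNIV_Plus joint_symbol_join)
  have 2: "((\<lambda>x. joint_symbol m a (join z x)) has_derivative (\<lambda>v. \<Sum>k\<in>UNIV. d_z k (joint_symbol m a) (join z \<zeta>) *
      (case k of Inr j \<Rightarrow> v $ j | Inl j \<Rightarrow> 0))) (at \<zeta>)"
  proof (rule has_derivative_compose_coords[where \<phi> = "\<lambda>x. join z x" and z = \<zeta>, OF J])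
    show "((\<lambda>x. join z x $ k) has_derivative (\<lambda>v. case k of Inr j \<Rightarrow> v $ j | Inl j \<Rightarrow> 0)) (at \<zeta>)" for k
      by (cases k) (auto intro!: bounded_linear_imp_has_derivative bounded_linear_vec_nth)
  qed (use \<open>z \<in> V\<close> in auto)
  then show "d_z (Inr j) (joint_symbol m a) (join z \<zeta>) = symbol_dzeta m a j z \<zeta>"
    unfolding symbol_dzeta_def by (intro d_z_eq_coeff[symmetric]) (simp add: sum_UNIV_Plus joint_symbol_join)
qed

definition quad_poly :: "complex ^ 'n \<Rightarrow> complex ^ 'n \<Rightarrow> ('n \<Rightarrow> 'n \<Rightarrow> complex) \<Rightarrow> complex ^ 'n \<Rightarrow> complex" where
  "quad_poly p \<zeta> H z = (\<Sum>j\<in>UNIV. \<zeta> $ j * (z $ j - p $ j)) +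
     (\<Sum>j\<in>UNIV. \<Sum>k\<in>UNIV. H j k * (z $ j - p $ j) * (z $ k - p $ k)) / 2"

lemma cholomorphic_on_quad_poly: "cholomorphic_on (quad_poly p \<zeta> H) U"
  unfolding quad_poly_def[abs_def] by (intro chol_intros)

lemma d_z_quad_poly:
  assumes sym: "\<And>j k. H j k = H k j"
  shows "d_z j (quad_poly p \<zeta> H) z = \<zeta> $ j + (\<Sum>k\<in>UNIV. H j k * (z $ k - p $ k))"
proof (rule d_z_eq_coeff)
  have nth: "((\<lambda>z. z $ j - p $ j) has_derivative (\<lambda>v. v $ j)) (at z)" for j
    by (auto intro!: derivative_eq_intros bounded_linear_imp_has_derivative bounded_linear_vec_nth)
  have "(quad_poly p \<zeta> H has_derivative (\<lambda>v. (\<Sum>j\<in>UNIV. \<zeta> $ j * v $ j) +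
     (\<Sum>j\<in>UNIV. \<Sum>k\<in>UNIV. H j k * (z $ j - p $ j) * v $ k + H j k * v $ j * (z $ k - p $ k)) / 2)) (at z)"
    unfolding quad_poly_def[abs_def]
    by (rule derivative_eq_intros nth refl | simp add: mult.assoc)+
  moreover have "(\<Sum>j\<in>UNIV. \<zeta> $ j * v $ j) +
     (\<Sum>j\<in>UNIV. \<Sum>k\<in>UNIV. H j k * (z $ j - p $ j) * v $ k + H j k * v $ j * (z $ k - p $ k)) / 2 =
     (\<Sum>j\<in>UNIV. (\<zeta> $ j + (\<Sum>k\<in>UNIV. H j k * (z $ k - p $ k))) * v $ j)" for v
  proof -
    have "(\<Sum>j\<in>UNIV. \<Sum>k\<in>UNIV. H j k * (z $ j - p $ j) * v $ k) = (\<Sum>j\<in>UNIV. \<Sum>k\<in>UNIV. H j k * v $ j * (z $ k - p $ k))"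
      by (subst sum.swap) (simp add: sym mult_ac)
    then show ?thesis
      by (simp add: sum.distrib distrib_left sum_distrib_left mult_ac)
  qed
  ultimately show "(quad_poly p \<zeta> H has_derivative
     (\<lambda>v. \<Sum>j\<in>UNIV. (\<zeta> $ j + (\<Sum>k\<in>UNIV. H j k * (z $ k - p $ k))) * v $ j)) (at z)" by simp
qed

text \<open>
  Differentiating \<open>P\<^sub>m(z, \<partial>f) = 0\<close> at \<open>p\<close> shows that \<open>compat\<close> is necessary for \<open>\<zeta>\<close> and \<open>H\<close> to be the gradient
  and the Hessian of a characteristic function. It is also sufficient. Put \<open>f = g + h\<close> with the
  quadratic polynomial \<open>g\<close> that has this jet. As \<open>v\<^sub>i = \<partial>P\<^sub>m/\<partial>\<zeta>\<^sub>i \<noteq> 0\<close>, the equation for \<open>h\<close> reads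
  \<open>\<partial>\<^sub>i h = F(z, \<partial>h)\<close> with \<open>F(z, \<eta>) = \<eta>\<^sub>i - P\<^sub>m(z, \<partial>g(z) + \<eta>) / v\<^sub>i\<close>. The division by \<open>v\<^sub>i\<close> makes \<open>\<partial>F/\<partial>\<eta>\<^sub>i\<close> vanish
  at the base point, and \<open>compat\<close> makes all \<open>\<partial>F/\<partial>z\<^sub>k\<close> vanish there; so \<open>h\<close> is flat to second order.
\<close>

proposition characteristic_function_with_prescribed_jet:
  fixes p \<zeta> :: "complex ^ 'n"
  assumes hol: "coeffs_holomorphic_near m a p" and char: "principal_symbol m a p \<zeta> = 0"
    and simple: "symbol_dzeta m a i p \<zeta> \<noteq> 0" and sym: "\<And>j k. H j k = H k j"
    and compat: "\<And>k. symbol_dz m a k p \<zeta> + (\<Sum>j\<in>UNIV. symbol_dzeta m a j p \<zeta> * H j k) = 0"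
  obtains r f where "r > 0" "cholomorphic_on f (ball p r)" "f p = 0" "hol_grad f p = \<zeta>"
    "\<And>z. z \<in> ball p r \<Longrightarrow> principal_symbol m a z (hol_grad f z) = 0"
    "\<And>e. e > 0 \<Longrightarrow> \<exists>s>0. \<forall>z\<in>ball p s. cmod (f z - quad_poly p \<zeta> H z) \<le> e * (norm (z - p))\<^sup>2"
proof -
  obtain V where V: "open V" "p \<in> V" "\<And>\<alpha>. sum \<alpha> UNIV = m \<Longrightarrow> cholomorphic_on (a \<alpha>) V"
    using coeffs_holomorphic_nearD[OF hol] by blast
  let ?g = "quad_poly p \<zeta> H" and ?V = "{X. base_part X \<in> V} :: (complex ^ ('n + 'n)) set"
  define \<phi> where "\<phi> X = join (base_part X) (hol_grad ?g (base_part X) + fibre_part X)" for X :: "complex ^ ('n + 'n)"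
  define v where "v j = symbol_dzeta m a j p \<zeta>" for j
  define F where "F X = X $ Inr i - joint_symbol m a (\<phi> X) / v i" for X
  have \<phi>_nth: "\<phi> X $ Inl j = X $ Inl j"
      "\<phi> X $ Inr j = \<zeta> $ j + (\<Sum>k\<in>UNIV. H j k * (X $ Inl k - p $ k)) + X $ Inr j" for X j
    by (simp_all add: \<phi>_def hol_grad_def d_z_quad_poly[OF sym])
  have \<phi>0: "\<phi> (join p 0) = join p \<zeta>"
    unfolding \<phi>_def by (simp add: hol_grad_def d_z_quad_poly[OF sym])
  note J = cholomorphic_on_joint_symbol[of m a V, OF V(3)]
  have J\<phi>: "cholomorphic_on (\<lambda>X. joint_symbol m a (\<phi> X)) ?V"
  proof (rule cholomorphic_on_compose[OF J])
    show "cholomorphic_on (\<lambda>X. \<phi> X $ k) ?V" for k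
      by (cases k) (auto simp: \<phi>_nth intro!: chol_intros)
  qed (auto simp: \<phi>_def)
  have F: "cholomorphic_on F ?V"
    unfolding F_def[abs_def] by (intro chol_intros J\<phi>)
  define \<phi>' where "\<phi>' k v = (case k of Inl j \<Rightarrow> v $ Inl j | Inr j \<Rightarrow> (\<Sum>k\<in>UNIV. H j k * v $ Inl k) + v $ Inr j)"
    for k and v :: "complex ^ ('n + 'n)"
  have derJ: "((\<lambda>X. joint_symbol m a (\<phi> X)) has_derivative
      (\<lambda>v. \<Sum>k\<in>UNIV. d_z k (joint_symbol m a) (\<phi> (join p 0)) * \<phi>' k v)) (at (join p 0))"
  proof (rule has_derivative_compose_coords[where \<phi> = \<phi> and z = "join p 0", OF J])
    show "((\<lambda>X. \<phi> X $ k) has_derivative \<phi>' k) (at (join p 0))" for k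
    proof (cases k)
      case (Inl j)
      then show ?thesis
        by (simp add: \<phi>_nth \<phi>'_def[abs_def] bounded_linear_imp_has_derivative bounded_linear_vec_nth)
    next
      case (Inr j)
      have nth: "((\<lambda>X. X $ l) has_derivative (\<lambda>v. v $ l)) (at (join p 0))" for l :: "'n + 'n"
        by (rule bounded_linear_imp_has_derivative) (rule bounded_linear_vec_nth)
      show ?thesis
        unfolding Inr \<phi>_nth \<phi>'_def
        by (rule derivative_eq_intros nth refl | simp)+
    qed
  qed (use V(2) in \<open>auto simp: \<phi>0\<close>)
  have coef: "(\<Sum>k\<in>UNIV. d_z k (joint_symbol m a) (\<phi> (join p 0)) * \<phi>' k w) = (\<Sum>j\<in>UNIV. v j * w $ Inr j)" for w
  proof -
    have "(\<Sum>k\<in>UNIV. d_z k (joint_symbol m a) (\<phi> (join p 0)) * \<phi>' k w) =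
       (\<Sum>k\<in>UNIV. symbol_dz m a k p \<zeta> * w $ Inl k) + (\<Sum>j\<in>UNIV. v j * ((\<Sum>k\<in>UNIV. H j k * w $ Inl k) + w $ Inr j))"
      by (simp add: sum_UNIV_Plus \<phi>0 d_z_joint_symbol[OF V(3) V(2)] \<phi>'_def v_def)
    also have "(\<Sum>j\<in>UNIV. v j * ((\<Sum>k\<in>UNIV. H j k * w $ Inl k) + w $ Inr j)) =
       (\<Sum>j\<in>UNIV. \<Sum>k\<in>UNIV. v j * H j k * w $ Inl k) + (\<Sum>j\<in>UNIV. v j * w $ Inr j)"
      by (simp add: distrib_left sum.distrib sum_distrib_left mult.assoc)
    also have "(\<Sum>j\<in>UNIV. \<Sum>k\<in>UNIV. v j * H j k * w $ Inl k) = (\<Sum>k\<in>UNIV. (\<Sum>j\<in>UNIV. v j * H j k) * w $ Inl k)"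
      by (subst sum.swap) (simp add: sum_distrib_right)
    also have "(\<Sum>k\<in>UNIV. symbol_dz m a k p \<zeta> * w $ Inl k) + ((\<Sum>k\<in>UNIV. (\<Sum>j\<in>UNIV. v j * H j k) * w $ Inl k) + (\<Sum>j\<in>UNIV. v j * w $ Inr j))
       = (\<Sum>k\<in>UNIV. (symbol_dz m a k p \<zeta> + (\<Sum>j\<in>UNIV. v j * H j k)) * w $ Inl k) + (\<Sum>j\<in>UNIV. v j * w $ Inr j)"
      by (simp add: distrib_right sum.distrib)
    finally show ?thesis using compat by (simp add: v_def)
  qed
  have vi: "v i \<noteq> 0" using simple by (simp add: v_def)
  have derF: "(F has_derivative (\<lambda>w. \<Sum>k\<in>UNIV. (case k of Inl j \<Rightarrow> 0 | Inr j \<Rightarrow> (if j = i then 1 else 0) - v j / v i) * w $ k)) (at (join p 0))"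
  proof -
    have "(F has_derivative (\<lambda>w. w $ Inr i - (\<Sum>j\<in>UNIV. v j * w $ Inr j) / v i)) (at (join p 0))"
      unfolding F_def[abs_def] using derJ[unfolded coef]
      by (intro has_derivative_diff bounded_linear_imp_has_derivative[OF bounded_linear_vec_nth])
        (auto intro!: derivative_eq_intros simp: vi)
    moreover have "w $ Inr i - (\<Sum>j\<in>UNIV. v j * w $ Inr j) / v i =
      (\<Sum>k\<in>UNIV. (case k of Inl j \<Rightarrow> 0 | Inr j \<Rightarrow> (if j = i then 1 else 0) - v j / v i) * w $ k)" for w :: "complex ^ ('n + 'n)"
      by (simp add: sum_UNIV_Plus left_diff_distrib sum_subtractf sum_divide_distrib
          if_distrib[of "\<lambda>x. x * _"] cong: if_cong)
    ultimately show ?thesis by simp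
  qed
  have dF: "d_z (Inl j) F (join p 0) = 0" "d_z (Inr i) F (join p 0) = 0" for j
    using d_z_eq_coeff[OF derF, of "Inl j"] d_z_eq_coeff[OF derF, of "Inr i"] vi by auto
  have F0: "F (join p 0) = 0"
    by (simp add: F_def \<phi>0 joint_symbol_def char)
  have J0: "join p 0 \<in> ?V" using V(2) by simp
  obtain r h where rh: "r > 0" "cholomorphic_on h (ball p r)" "h p = 0"
    "\<And>z. z \<in> ball p r \<Longrightarrow> join z (hol_grad h z) \<in> ?V"
    "\<And>z. z \<in> ball p r \<Longrightarrow> d_z i h z = F (join z (hol_grad h z))"
    "\<And>j. d_z j h p = 0" "\<And>j k. d_z k (d_z j h) p = 0"
    by (rule noncharacteristic_flat_solution[OF open_base_part[OF V(1)] J0 F F0 dF(2,1)]) (rule that)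
  define f where "f z = ?g z + h z" for z
  have f: "cholomorphic_on f (ball p r)"
    unfolding f_def[abs_def] by (intro chol_intros cholomorphic_on_quad_poly rh)
  have grad_f: "hol_grad f z = hol_grad ?g z + hol_grad h z" if "z \<in> ball p r" for z
    using d_z_add[OF cholomorphic_on_quad_poly rh(2) that]
    by (simp add: f_def[abs_def] hol_grad_def vec_eq_iff)
  show thesis
  proof (rule that[OF rh(1) f])
    show "f p = 0" by (simp add: f_def rh quad_poly_def)
    show "hol_grad f p = \<zeta>"
      using grad_f[of p] rh by (simp add: hol_grad_def vec_eq_iff d_z_quad_poly[OF sym])
    show "principal_symbol m a z (hol_grad f z) = 0" if z: "z \<in> ball p r" for z
    proof -
      have "joint_symbol m a (\<phi> (join z (hol_grad h z))) = principal_symbol m a z (hol_grad f z)"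
        by (simp add: \<phi>_def joint_symbol_def grad_f[OF z])
      then show ?thesis
        using rh(5)[OF z] vi by (simp add: F_def hol_grad_def)
    qed
    show "\<exists>s>0. \<forall>z\<in>ball p s. cmod (f z - ?g z) \<le> e * (norm (z - p))\<^sup>2" if "e > 0" for e
      using flat_second_order[OF rh(1,2,3,6,7) that] by (simp add: f_def)
  qed
qed

section \<open>Symmetric completion of a Hermitian form\<close>

text \<open>
  For fixed \<open>s\<close> the last summand is minus the minimum over \<open>c\<close> of the two others. The minimum is
  attained at \<open>c = - (N cnj s - cnj \<beta> s) / (N\<^sup>2 - |\<beta>|\<^sup>2)\<close>, which is where the real derivative
  \<open>N c + cnj \<beta> cnj c + cnj s\<close> vanishes.
\<close>

lemma completed_square_nonneg:
  fixes c s \<beta> :: complex and N :: real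
  assumes "cmod \<beta> < N"
  shows "0 \<le> N * (cmod c)\<^sup>2 + Re (\<beta> * c\<^sup>2 + 2 * c * s) +
    (N * (cmod s)\<^sup>2 - Re (cnj \<beta> * s\<^sup>2)) / (N\<^sup>2 - (cmod \<beta>)\<^sup>2)"
proof -
  define D where "D = N\<^sup>2 - (cmod \<beta>)\<^sup>2"
  have D: "D > 0"
    using assms unfolding D_def by (simp add: power_strict_mono)
  define \<sigma> where "\<sigma> = s / of_real D"
  define d where "d = c + (of_real N * cnj \<sigma> - cnj \<beta> * \<sigma>)"
  have s: "s = of_real D * \<sigma>" using D by (simp add: \<sigma>_def)
  have "(N * (cmod s)\<^sup>2 - Re (cnj \<beta> * s\<^sup>2)) / D = D * (N * (cmod \<sigma>)\<^sup>2 - Re (cnj \<beta> * \<sigma>\<^sup>2))"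
    unfolding s using D by (simp add: norm_mult power_mult_distrib field_simps power2_eq_square)
  moreover have "N * (cmod c)\<^sup>2 + Re (\<beta> * c\<^sup>2 + 2 * c * s) + D * (N * (cmod \<sigma>)\<^sup>2 - Re (cnj \<beta> * \<sigma>\<^sup>2))
     = N * (cmod d)\<^sup>2 + Re (\<beta> * d\<^sup>2)"
    unfolding s d_def D_def cmod_power2
    by (simp add: power2_eq_square) algebra
  moreover have "- (cmod \<beta> * (cmod d)\<^sup>2) \<le> Re (\<beta> * d\<^sup>2)"
    using abs_Re_le_cmod[of "\<beta> * d\<^sup>2"] by (simp add: norm_mult norm_power)
  moreover have "cmod \<beta> * (cmod d)\<^sup>2 \<le> N * (cmod d)\<^sup>2"
    using assms by (intro mult_right_mono) auto
  ultimately show ?thesis unfolding D_def by linarith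
qed

definition sesq :: "('n \<Rightarrow> 'n \<Rightarrow> complex) \<Rightarrow> complex ^ 'n \<Rightarrow> complex ^ 'n \<Rightarrow> complex" where
  "sesq l s t = (\<Sum>j\<in>UNIV. \<Sum>k\<in>UNIV. l j k * s $ j * cnj (t $ k))"

lemma sesq_add_left: "sesq l (s + s') t = sesq l s t + sesq l s' t"
  and sesq_add_right: "sesq l s (t + t') = sesq l s t + sesq l s t'"
  and sesq_smult_left: "sesq l (c *s s) t = c * sesq l s t"
  and sesq_smult_right: "sesq l s (c *s t) = cnj c * sesq l s t"
  by (simp_all add: sesq_def algebra_simps sum.distrib sum_distrib_left)

lemma sesq_hermitian:
  assumes "\<And>j k. l k j = cnj (l j k)"
  shows "sesq l t s = cnj (sesq l s t)"
proof -
  have "cnj (sesq l s t) = (\<Sum>j\<in>UNIV. \<Sum>k\<in>UNIV. l k j * t $ k * cnj (s $ j))"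
    unfolding sesq_def by (simp add: assms[symmetric] mult_ac)
  also have "\<dots> = sesq l t s" unfolding sesq_def by (rule sum.swap)
  finally show ?thesis by simp
qed

lemma sesq_real:
  assumes "\<And>j k. l k j = cnj (l j k)"
  shows "sesq l t t = of_real (Re (sesq l t t))"
  using sesq_hermitian[where l = l and t = t and s = t, OF assms] by (simp add: complex_eq_iff)

lemma mult_cnj_self: "c * cnj c = (complex_of_real (cmod c))\<^sup>2"
  by (simp only: complex_norm_square[symmetric] of_real_power)

text \<open>
  This is where condition (Pos) enters. A symmetric \<open>A\<close> with \<open>A v = b\<close> is prescribed on pairs one of whose
  members is \<open>v\<close>, and is to be completed in such a way that \<open>Re A(t, t) + L(t, t)\<close> is positive, where
  \<open>L\<close> is the form with matrix \<open>l\<close>. After normalisation by \<open>L\<close> this asks for a symmetric matrix of norm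
  less than one with given first row, and the hypothesis says that this row has norm less than one.
  As in Parrott's theorem on contractions, the completion is explicit.

  Write \<open>N = L(v, v)\<close>, \<open>\<beta> = b(v)\<close>, \<open>D = N\<^sup>2 - |\<beta>|\<^sup>2\<close>, and \<open>t = c v + u\<close> with \<open>u\<close> orthogonal to \<open>v\<close> for \<open>L\<close>. Then
  \<open>A(t, t) = \<beta> c\<^sup>2 + 2 c b(u) + A(u, u)\<close>. The choice \<open>A(u, u) = - cnj \<beta> b(u)\<^sup>2 / D\<close> lets the minimum over \<open>c\<close> of
  \<open>N |c|\<^sup>2 + Re A(t, t)\<close> become \<open>- N |b(u)|\<^sup>2 / D\<close>, which is outweighed by \<open>L(u, u)\<close> if \<open>u \<noteq> 0\<close>.
\<close>

proposition symmetric_completion: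
  fixes l :: "'n::finite \<Rightarrow> 'n \<Rightarrow> complex" and b v \<zeta> :: "complex ^ 'n"
  assumes herm: "\<And>j k. l k j = cnj (l j k)"
    and v: "v \<noteq> 0" and tan: "(\<Sum>j\<in>UNIV. \<zeta> $ j * v $ j) = 0"
    and pos: "\<And>t0 t. (t0 \<noteq> 0 \<or> t \<noteq> 0) \<Longrightarrow> (\<Sum>j\<in>UNIV. \<zeta> $ j * t $ j) = 0 \<Longrightarrow>
      0 < Re (sesq l v v) * (cmod t0)\<^sup>2 + 2 * Re (cnj t0 * (\<Sum>j\<in>UNIV. b $ j * t $ j)) + Re (sesq l t t)"
  obtains A where "\<And>j k. A j k = A k j" "\<And>k. (\<Sum>j\<in>UNIV. v $ j * A j k) = b $ k"
    "\<And>t. t \<noteq> 0 \<Longrightarrow> (\<Sum>j\<in>UNIV. \<zeta> $ j * t $ j) = 0 \<Longrightarrow>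
      0 < Re (\<Sum>j\<in>UNIV. \<Sum>k\<in>UNIV. A j k * t $ j * t $ k) + Re (sesq l t t)"
proof -
  define N where "N = Re (sesq l v v)"
  define B where "B t = (\<Sum>j\<in>UNIV. b $ j * t $ j)" for t
  define Z where "Z t = (\<Sum>j\<in>UNIV. \<zeta> $ j * t $ j)" for t
  define \<beta> where "\<beta> = B v"
  have lin: "B (x + y) = B x + B y" "Z (x + y) = Z x + Z y" "B (c *s x) = c * B x" "Z (c *s x) = c * Z x" for x y c
    by (simp_all add: B_def Z_def algebra_simps sum.distrib sum_distrib_left)
  have Zv: "Z v = 0" using tan by (simp add: Z_def)
  have pos': "0 < N * (cmod t0)\<^sup>2 + 2 * Re (cnj t0 * B t) + Re (sesq l t t)"
    if "t0 \<noteq> 0 \<or> t \<noteq> 0" "Z t = 0" for t0 t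
    using pos[of t0 t] that by (simp add: N_def B_def Z_def)
  have N: "N > 0" using pos'[of 0 v] v Zv by (simp add: N_def)
  have vv: "sesq l v v = of_real N" using sesq_real[where l = l and t = v, OF herm] by (simp add: N_def)
  have \<beta>: "cmod \<beta> < N"
  proof (cases "\<beta> = 0")
    case False
    \<comment> \<open>Positivity at \<open>t = v\<close>, with \<open>t0\<close> of modulus one and opposite to \<open>\<beta>\<close>, reads \<open>2 N - 2 |\<beta>| > 0\<close>.\<close>
    have "cnj (- (\<beta> / of_real (cmod \<beta>))) * \<beta> = - of_real (cmod \<beta>)"
      using False by (simp add: mult.commute[of "cnj \<beta>"] mult_cnj_self power2_eq_square)
    then show ?thesis
      using pos'[of "- (\<beta> / of_real (cmod \<beta>))" v] v Zv False
      by (simp add: norm_divide \<beta>_def[symmetric] N_def[symmetric])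
  qed (use N in simp)
  define D where "D = N\<^sup>2 - (cmod \<beta>)\<^sup>2"
  have D: "D > 0" using \<beta> unfolding D_def by (simp add: power_strict_mono)
  have transversal: "N * (cmod (B u))\<^sup>2 / D < Re (sesq l u u)"
    if u: "u \<noteq> 0" "Z u = 0" "sesq l u v = 0" for u
  proof -
    define s where "s = B u"
    define \<sigma> where "\<sigma> = s / of_real D"
    have s: "s = of_real D * \<sigma>" using D by (simp add: \<sigma>_def)
    \<comment> \<open>Among the vectors \<open>(t0, c v + u)\<close>, the form is minimal at these values of \<open>c\<close> and \<open>t0\<close>.\<close>
    define c where "c = cnj \<beta> * \<sigma>"
    define t0 where "t0 = - (of_real N * \<sigma>)"
    define t where "t = c *s v + u"
    have vu: "sesq l v u = 0" using sesq_hermitian[where l = l and t = v and s = u, OF herm] u(3) by simp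
    have Bt: "B t = of_real (N\<^sup>2) * \<sigma>"
    proof -
      have "B t = (cnj \<beta> * \<beta> + of_real D) * \<sigma>"
        by (simp add: t_def lin \<beta>_def[symmetric] s_def[symmetric] c_def s algebra_simps)
      also have "cnj \<beta> * \<beta> + of_real D = of_real (N\<^sup>2)"
        by (simp add: D_def mult.commute[of "cnj \<beta>"] mult_cnj_self)
      finally show ?thesis .
    qed
    have LL: "sesq l t t = of_real (N * (cmod c)\<^sup>2) + sesq l u u"
      by (simp add: t_def sesq_add_left sesq_add_right sesq_smult_left sesq_smult_right vu u(3) vv
          mult_cnj_self mult_ac)
    have "t0 \<noteq> 0 \<or> t \<noteq> 0"
    proof (rule ccontr)
      assume neg: "\<not> (t0 \<noteq> 0 \<or> t \<noteq> 0)"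
      then have "\<sigma> = 0" using N by (simp add: t0_def)
      then have "t = u" by (simp add: t_def c_def)
      with neg u show False by simp
    qed
    moreover have "Z t = 0" by (simp add: t_def lin Zv u)
    ultimately have "0 < N * (cmod t0)\<^sup>2 + 2 * Re (cnj t0 * B t) + Re (sesq l t t)"
      by (rule pos')
    also have "cnj t0 * B t = - of_real (N ^ 3 * (cmod \<sigma>)\<^sup>2)"
      by (simp add: t0_def Bt mult_cnj_self power2_eq_square power3_eq_cube mult_ac)
    also have "Re (sesq l t t) = N * ((cmod \<beta>)\<^sup>2 * (cmod \<sigma>)\<^sup>2) + Re (sesq l u u)"
      by (simp add: LL c_def norm_mult power_mult_distrib)
    also have "N * (cmod t0)\<^sup>2 = N ^ 3 * (cmod \<sigma>)\<^sup>2"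
      using N by (simp add: t0_def norm_mult power_mult_distrib power2_eq_square power3_eq_cube)
    finally have "N * D * (cmod \<sigma>)\<^sup>2 < Re (sesq l u u)"
      by (simp add: D_def algebra_simps power2_eq_square power3_eq_cube)
    moreover have "N * (cmod (B u))\<^sup>2 / D = N * D * (cmod \<sigma>)\<^sup>2"
      using D by (simp add: s_def[symmetric] s norm_mult power_mult_distrib power2_eq_square)
    ultimately show ?thesis by simp
  qed
  \<comment> \<open>\<open>lam\<close> is the coordinate \<open>c\<close> in \<open>t = c v + u\<close>, as a linear form.\<close>
  define lam where "lam j = (\<Sum>k\<in>UNIV. l j k * cnj (v $ k)) / of_real N" for j
  define \<gamma> where "\<gamma> = - cnj \<beta> / of_real D"
  define A where "A j k = lam j * b $ k + lam k * b $ j - \<beta> * lam j * lam k +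
    \<gamma> * (b $ j - \<beta> * lam j) * (b $ k - \<beta> * lam k)" for j k
  define \<Lambda> where "\<Lambda> t = (\<Sum>j\<in>UNIV. lam j * t $ j)" for t
  have \<Lambda>: "\<Lambda> t = sesq l t v / of_real N" for t
    by (simp add: \<Lambda>_def lam_def sesq_def sum_distrib_left sum_distrib_right sum_divide_distrib mult_ac)
  have \<Lambda>v: "\<Lambda> v = 1" using N by (simp add: \<Lambda> vv)
  have A_sum: "(\<Sum>j\<in>UNIV. t $ j * A j k) = \<Lambda> t * b $ k + lam k * B t - \<beta> * \<Lambda> t * lam k +
    \<gamma> * (B t - \<beta> * \<Lambda> t) * (b $ k - \<beta> * lam k)" for t k
    by (simp add: A_def B_def \<Lambda>_def algebra_simps sum.distrib sum_subtractf sum_distrib_left)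
  have A_quad: "(\<Sum>j\<in>UNIV. \<Sum>k\<in>UNIV. A j k * t $ j * t $ k) =
    2 * \<Lambda> t * B t - \<beta> * (\<Lambda> t)\<^sup>2 + \<gamma> * (B t - \<beta> * \<Lambda> t)\<^sup>2" for t
  proof -
    have "(\<Sum>j\<in>UNIV. \<Sum>k\<in>UNIV. A j k * t $ j * t $ k) = (\<Sum>k\<in>UNIV. (\<Sum>j\<in>UNIV. t $ j * A j k) * t $ k)"
      by (subst sum.swap) (simp add: sum_distrib_left sum_distrib_right mult_ac)
    also have "\<dots> = \<Lambda> t * B t + \<Lambda> t * B t - \<beta> * \<Lambda> t * \<Lambda> t + \<gamma> * (B t - \<beta> * \<Lambda> t) * (B t - \<beta> * \<Lambda> t)"
    proof -
      have "(\<Sum>k\<in>UNIV. (x * b $ k + lam k * y - \<beta> * x * lam k + g * (b $ k - \<beta> * lam k)) * t $ k) =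
        x * B t + \<Lambda> t * y - \<beta> * x * \<Lambda> t + g * (B t - \<beta> * \<Lambda> t)" for x y g
        by (simp add: B_def \<Lambda>_def algebra_simps sum.distrib sum_subtractf sum_distrib_left)
      then show ?thesis unfolding A_sum .
    qed
    finally show ?thesis by (simp add: power2_eq_square algebra_simps)
  qed
  show thesis
  proof (rule that)
    show "A j k = A k j" for j k by (simp add: A_def algebra_simps)
    show "(\<Sum>j\<in>UNIV. v $ j * A j k) = b $ k" for k
      by (simp add: A_sum \<Lambda>v \<beta>_def)
    fix t :: "complex ^ 'n" assume t: "t \<noteq> 0" and "(\<Sum>j\<in>UNIV. \<zeta> $ j * t $ j) = 0"
    then have Zt: "Z t = 0" by (simp add: Z_def)
    define c where "c = \<Lambda> t"
    define u where "u = t + (- c) *s v"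
    have tcu: "t = c *s v + u" by (simp add: u_def vec_eq_iff)
    have uv: "sesq l u v = 0"
      unfolding u_def sesq_add_left sesq_smult_left c_def \<Lambda> vv using N by simp
    have vu: "sesq l v u = 0" using sesq_hermitian[where l = l and t = v and s = u, OF herm] uv by simp
    have LL: "sesq l t t = of_real (N * (cmod c)\<^sup>2) + sesq l u u"
      by (simp add: tcu sesq_add_left sesq_add_right sesq_smult_left sesq_smult_right vu uv vv
          mult_cnj_self mult_ac)
    define s where "s = B u"
    have Bt: "B t = c * \<beta> + s" by (simp add: tcu lin s_def \<beta>_def)
    have quad: "(\<Sum>j\<in>UNIV. \<Sum>k\<in>UNIV. A j k * t $ j * t $ k) = \<beta> * c\<^sup>2 + 2 * c * s + \<gamma> * s\<^sup>2"
      unfolding A_quad c_def[symmetric] Bt by (simp add: power2_eq_square algebra_simps)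
    have re\<gamma>: "Re (\<gamma> * s\<^sup>2) = - (Re (cnj \<beta> * s\<^sup>2) / D)"
      by (simp add: \<gamma>_def add_divide_distrib diff_divide_distrib)
    have sq: "0 \<le> N * (cmod c)\<^sup>2 + Re (\<beta> * c\<^sup>2 + 2 * c * s) + (N * (cmod s)\<^sup>2 - Re (cnj \<beta> * s\<^sup>2)) / D"
      unfolding D_def by (rule completed_square_nonneg[OF \<beta>])
    show "0 < Re (\<Sum>j\<in>UNIV. \<Sum>k\<in>UNIV. A j k * t $ j * t $ k) + Re (sesq l t t)"
    proof (cases "u = 0")
      case False
      have "Z u = 0" using Zt by (simp add: tcu lin Zv)
      from transversal[OF False this uv] have "N * (cmod s)\<^sup>2 / D < Re (sesq l u u)" by (simp add: s_def)
      with sq show ?thesis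
        unfolding quad LL using re\<gamma>
        by (simp only: plus_complex.sel Re_complex_of_real diff_divide_distrib)
    next
      case True
      then have "s = 0" and tc: "t = c *s v" by (simp_all add: s_def B_def tcu)
      have c: "c \<noteq> 0" using t tc by auto
      have "- (cmod \<beta> * (cmod c)\<^sup>2) \<le> Re (\<beta> * c\<^sup>2)"
        using abs_Re_le_cmod[of "\<beta> * c\<^sup>2"] by (simp add: norm_mult norm_power)
      moreover have "cmod \<beta> * (cmod c)\<^sup>2 < N * (cmod c)\<^sup>2"
        using \<beta> c by (intro mult_strict_right_mono) auto
      moreover have "sesq l u u = 0" using True by (simp add: sesq_def)
      ultimately show ?thesis
        unfolding quad LL using \<open>s = 0\<close> by simp
    qed
  qed
qed

section \<open>Second-order expansion of a smooth real function\<close>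

text \<open>
  The second difference of \<open>f\<close> at \<open>p\<close> is symmetric in \<open>u\<close> and \<open>v\<close>. The mean value theorem in the direction
  \<open>u\<close>, followed by the differentiability at \<open>p\<close> of the derivative in that direction, shows that it
  equals \<open>t\<^sup>2 Bu v + o(t\<^sup>2)\<close>; exchanging the roles gives \<open>t\<^sup>2 Bv u + o(t\<^sup>2)\<close>.
\<close>

lemma second_derivative_symmetric:
  fixes f :: "'a::real_normed_vector \<Rightarrow> real"
  assumes U: "open U" "p \<in> U" and D: "\<And>x. x \<in> U \<Longrightarrow> (f has_derivative D x) (at x)"
    and Bu: "((\<lambda>x. D x u) has_derivative Bu) (at p)"
    and Bv: "((\<lambda>x. D x v) has_derivative Bv) (at p)"
  shows "Bu v = Bv u"
proof -
  define C where "C = norm u + norm v + 1"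
  have C: "C > 0" by (simp add: C_def add_nonneg_pos)
  obtain d0 where d0: "d0 > 0" "\<And>x. norm (x - p) < d0 \<Longrightarrow> x \<in> U"
    using U open_dist by (metis dist_norm)
  define \<Delta> where "\<Delta> u v t = f (p + t *\<^sub>R u + t *\<^sub>R v) - f (p + t *\<^sub>R u) - f (p + t *\<^sub>R v) + f p" for u v t
  have key: "\<exists>d>0. \<forall>t. 0 < t \<and> t < d \<longrightarrow> \<bar>\<Delta> u v t - t\<^sup>2 * B v\<bar> \<le> e * t\<^sup>2"
    if e: "e > 0" and B: "((\<lambda>x. D x u) has_derivative B) (at p)" and C_eq: "C = norm u + norm v + 1" for u v B e
  proof -
    have linB: "linear B" using B has_derivative_linear by blast
    have "e / (2 * C) > 0" using e C by simp
    then obtain d1 where d1: "d1 > 0"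
      "\<And>y. norm (y - p) < d1 \<Longrightarrow> norm (D y u - D p u - B (y - p)) \<le> e / (2 * C) * norm (y - p)"
      using B unfolding has_derivative_at_alt by blast
    define d where "d = min d0 d1 / C"
    have "d > 0" using d0(1) d1(1) C by (simp add: d_def)
    moreover have "\<bar>\<Delta> u v t - t\<^sup>2 * B v\<bar> \<le> e * t\<^sup>2" if t: "0 < t" "t < d" for t
    proof -
      have tC: "t * C < d0" "t * C < d1" using t C by (auto simp: d_def field_simps)
      have small: "norm (s *\<^sub>R u) \<le> t * C" "norm (s *\<^sub>R u + t *\<^sub>R v) \<le> t * C" if "0 \<le> s" "s \<le> t" for s
      proof -
        have su: "norm (s *\<^sub>R u) \<le> t * norm u" using that by (simp add: mult_right_mono)
        also have "\<dots> \<le> t * C" using t C_eq by (intro mult_left_mono) auto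
        finally show "norm (s *\<^sub>R u) \<le> t * C" .
        have "norm (s *\<^sub>R u + t *\<^sub>R v) \<le> norm (s *\<^sub>R u) + norm (t *\<^sub>R v)" by (rule norm_triangle_ineq)
        also have "\<dots> \<le> t * norm u + t * norm v" using su t by simp
        also have "\<dots> \<le> t * C" using t C_eq by (simp add: distrib_left)
        finally show "norm (s *\<^sub>R u + t *\<^sub>R v) \<le> t * C" .
      qed
      define \<phi> where "\<phi> s = f (p + s *\<^sub>R u + t *\<^sub>R v) - f (p + s *\<^sub>R u)" for s
      define \<phi>' where "\<phi>' s = D (p + s *\<^sub>R u + t *\<^sub>R v) u - D (p + s *\<^sub>R u) u" for s
      have der: "(\<phi> has_real_derivative \<phi>' s) (at s)" if s: "0 \<le> s" "s \<le> t" for s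
      proof -
        have in_U: "p + s *\<^sub>R u + t *\<^sub>R v \<in> U" "p + s *\<^sub>R u \<in> U"
          using small[OF s] tC by (auto intro!: d0(2) simp: algebra_simps)
        have "(f has_derivative D (p + s *\<^sub>R u + t *\<^sub>R v)) (at (p + s *\<^sub>R u + t *\<^sub>R v))" "(f has_derivative D (p + s *\<^sub>R u)) (at (p + s *\<^sub>R u))"
          using D in_U by auto
        then have "(\<phi> has_derivative (\<lambda>h. D (p + s *\<^sub>R u + t *\<^sub>R v) (h *\<^sub>R u) - D (p + s *\<^sub>R u) (h *\<^sub>R u))) (at s)"
          unfolding \<phi>_def
          by (intro has_derivative_diff has_derivative_compose[of "\<lambda>s. p + s *\<^sub>R u + t *\<^sub>R v" _ s UNIV f]
              has_derivative_compose[of "\<lambda>s. p + s *\<^sub>R u" _ s UNIV f]) (auto intro!: derivative_eq_intros)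
        moreover have "linear (D (p + s *\<^sub>R u + t *\<^sub>R v))" "linear (D (p + s *\<^sub>R u))"
          using D in_U has_derivative_linear by blast+
        then have "(\<lambda>h. D (p + s *\<^sub>R u + t *\<^sub>R v) (h *\<^sub>R u) - D (p + s *\<^sub>R u) (h *\<^sub>R u)) = (*) (\<phi>' s)"
          by (intro ext) (simp add: linear_cmul \<phi>'_def algebra_simps)
        ultimately show ?thesis
          unfolding has_field_derivative_def by simp
      qed
      obtain s where s: "0 < s" "s < t" "\<phi> t - \<phi> 0 = (t - 0) * \<phi>' s"
        using MVT2[OF t(1) der] by auto
      have \<Delta>: "\<Delta> u v t = t * \<phi>' s"
        using s(3) by (simp add: \<Delta>_def \<phi>_def)
      have s': "0 \<le> s" "s \<le> t" using s by auto
      let ?y1 = "p + s *\<^sub>R u + t *\<^sub>R v" and ?y2 = "p + s *\<^sub>R u"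
      have n1: "norm (?y1 - p) \<le> t * C" and n2: "norm (?y2 - p) \<le> t * C"
        using small[OF s'] by (simp_all add: algebra_simps)
      have b: "e / (2 * C) * norm (y - p) \<le> e / 2 * t" if "norm (y - p) \<le> t * C" for y
      proof -
        have "e / (2 * C) * norm (y - p) \<le> e / (2 * C) * (t * C)"
          using that e C by (intro mult_left_mono) auto
        then show ?thesis using C by simp
      qed
      have "\<bar>D ?y1 u - D p u - B (?y1 - p)\<bar> \<le> e / 2 * t"
        using order_trans[OF d1(2)[OF le_less_trans[OF n1 tC(2)]] b[OF n1]] by (simp only: real_norm_def)
      moreover have "\<bar>D ?y2 u - D p u - B (?y2 - p)\<bar> \<le> e / 2 * t"
        using order_trans[OF d1(2)[OF le_less_trans[OF n2 tC(2)]] b[OF n2]] by (simp only: real_norm_def)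
      moreover have "B (?y1 - p) - B (?y2 - p) = t * B v"
        using linear_diff[OF linB, of "?y1 - p" "?y2 - p"] linear_cmul[OF linB, of t v] by simp
      ultimately have "\<bar>\<phi>' s - t * B v\<bar> \<le> e * t"
        unfolding \<phi>'_def by linarith
      then have "t * \<bar>\<phi>' s - t * B v\<bar> \<le> t * (e * t)"
        using t by (intro mult_left_mono) auto
      moreover have "t * \<bar>\<phi>' s - t * B v\<bar> = \<bar>t * \<phi>' s - t\<^sup>2 * B v\<bar>"
      proof -
        have "t * \<phi>' s - t\<^sup>2 * B v = t * (\<phi>' s - t * B v)"
          by (simp add: right_diff_distrib power2_eq_square)
        then show ?thesis using t by (simp add: abs_mult)
      qed
      ultimately show ?thesis
        unfolding \<Delta> by (simp add: power2_eq_square mult_ac)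
    qed
    ultimately show ?thesis by blast
  qed
  have "\<bar>Bu v - Bv u\<bar> \<le> e" if e: "e > 0" for e
  proof -
    have e2: "e / 2 > 0" using e by simp
    obtain d where d: "d > 0" "\<And>t. 0 < t \<Longrightarrow> t < d \<Longrightarrow> \<bar>\<Delta> u v t - t\<^sup>2 * Bu v\<bar> \<le> e / 2 * t\<^sup>2"
      using key[OF e2 Bu, of v] C_def by blast
    obtain d' where d': "d' > 0" "\<And>t. 0 < t \<Longrightarrow> t < d' \<Longrightarrow> \<bar>\<Delta> v u t - t\<^sup>2 * Bv u\<bar> \<le> e / 2 * t\<^sup>2"
      using key[OF e2 Bv, of u] C_def by (auto simp: add.commute)
    define t where "t = min d d' / 2"
    have t: "0 < t" "t < d" "t < d'" using d(1) d'(1) by (auto simp: t_def)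
    have "\<Delta> v u t = \<Delta> u v t" by (simp add: \<Delta>_def algebra_simps)
    then have "\<bar>t\<^sup>2 * Bu v - t\<^sup>2 * Bv u\<bar> \<le> e * t\<^sup>2"
      using d(2)[OF t(1,2)] d'(2)[OF t(1,3)] by linarith
    then have "t\<^sup>2 * \<bar>Bu v - Bv u\<bar> \<le> t\<^sup>2 * e"
      by (simp add: abs_mult mult.commute[of e] flip: right_diff_distrib)
    then show ?thesis using t(1) by simp
  qed
  then have "\<bar>Bu v - Bv u\<bar> \<le> 0" by (rule field_le_epsilon[where y = 0, simplified])
  then show ?thesis by simp
qed

lemma has_derivative_wirtinger:
  assumes g: "(g has_derivative g') (at z)"
  shows "g' v = (\<Sum>j\<in>UNIV. d_z j g z * v $ j + d_zbar j g z * cnj (v $ j))"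
proof -
  have fr: "frechet_derivative g (at z) = g'"
    using frechet_derivative_at[OF g] by simp
  have lin: "linear g'" using g by (rule has_derivative_linear)
  have split: "axis j c = Re c *\<^sub>R axis j 1 + Im c *\<^sub>R axis j \<i>" for j :: 'a and c :: complex
    by (simp add: vec_eq_iff axis_def complex_eq_iff)
  have "v = (\<Sum>j\<in>UNIV. axis j (v $ j))"
  proof -
    have "v = (\<Sum>j\<in>UNIV. v $ j *s axis j 1)" by (rule vec_eq_sum_axis)
    also have "\<dots> = (\<Sum>j\<in>UNIV. axis j (v $ j))"
      by (rule sum.cong) (simp_all add: vec_eq_iff axis_def)
    finally show ?thesis .
  qed
  then have "g' v = g' (\<Sum>j\<in>UNIV. axis j (v $ j))" by simp
  also have "\<dots> = (\<Sum>j\<in>UNIV. g' (axis j (v $ j)))"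
    by (rule linear_sum[OF lin])
  also have "\<dots> = (\<Sum>j\<in>UNIV. d_z j g z * v $ j + d_zbar j g z * cnj (v $ j))"
  proof (rule sum.cong[OF refl])
    fix j
    have "g' (axis j (v $ j)) = Re (v $ j) *\<^sub>R g' (axis j 1) + Im (v $ j) *\<^sub>R g' (axis j \<i>)"
      by (subst split) (simp add: linear_add[OF lin] linear_cmul[OF lin])
    also have "\<dots> = d_z j g z * v $ j + d_zbar j g z * cnj (v $ j)"
      unfolding d_z_def d_zbar_def fr by (simp add: complex_eq_iff field_simps)
    finally show "g' (axis j (v $ j)) = d_z j g z * v $ j + d_zbar j g z * cnj (v $ j)" .
  qed
  finally show ?thesis .
qed

lemma d_z_cnj:
  assumes "(g has_derivative g') (at z)"
  shows "d_z j (\<lambda>x. cnj (g x)) z = cnj (d_zbar j g z)"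
    and "d_zbar j (\<lambda>x. cnj (g x)) z = cnj (d_z j g z)"
proof -
  have "((\<lambda>x. cnj (g x)) has_derivative (\<lambda>v. cnj (g' v))) (at z)"
    using assms by (rule bounded_linear.has_derivative[OF bounded_linear_cnj])
  then have "frechet_derivative (\<lambda>x. cnj (g x)) (at z) = (\<lambda>v. cnj (g' v))"
    using frechet_derivative_at by metis
  moreover have "frechet_derivative g (at z) = g'"
    using frechet_derivative_at[OF assms] by simp
  ultimately show "d_z j (\<lambda>x. cnj (g x)) z = cnj (d_zbar j g z)"
    "d_zbar j (\<lambda>x. cnj (g x)) z = cnj (d_z j g z)"
    by (simp_all add: d_z_def d_zbar_def)
qed

locale smooth_real_function =
  fixes \<rho> :: "complex ^ 'n::finite \<Rightarrow> real" and U :: "(complex ^ 'n) set" and p :: "complex ^ 'n"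
  assumes U: "open U" "p \<in> U" and smooth: "smooth_on \<rho> U"
begin

abbreviation G :: "'n \<Rightarrow> complex ^ 'n \<Rightarrow> complex" where
  "G k \<equiv> d_z k (cplx \<rho>)"

lemma C2: "Ck_on (Suc (Suc 0)) \<rho> U"
  using smooth by (simp only: smooth_on_def)

lemma has_derivative_rho: "x \<in> U \<Longrightarrow> (\<rho> has_derivative frechet_derivative \<rho> (at x)) (at x)"
  using C2 by (auto simp: frechet_derivative_works)

lemma has_derivative_cplx:
  "x \<in> U \<Longrightarrow> (cplx \<rho> has_derivative (\<lambda>v. of_real (frechet_derivative \<rho> (at x) v))) (at x)"
  by (rule bounded_linear.has_derivative[OF bounded_linear_of_real has_derivative_rho])

lemma G_eq:
  assumes "x \<in> U"
  shows "G k x = (of_real (frechet_derivative \<rho> (at x) (axis k 1)) - \<i> * of_real (frechet_derivative \<rho> (at x) (axis k \<i>))) / 2"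
proof -
  have "frechet_derivative (cplx \<rho>) (at x) = (\<lambda>v. of_real (frechet_derivative \<rho> (at x) v))"
    using frechet_derivative_at[OF has_derivative_cplx[OF assms]] by simp
  then show ?thesis unfolding d_z_def by simp
qed

lemma d_zbar_rho: "x \<in> U \<Longrightarrow> d_zbar k (cplx \<rho>) x = cnj (G k x)"
  using d_z_cnj(2)[OF has_derivative_cplx, of x k] by simp

lemma derivative_rho_eq:
  assumes "x \<in> U"
  shows "frechet_derivative \<rho> (at x) w = 2 * Re (\<Sum>k\<in>UNIV. w $ k * G k x)"
proof -
  have "complex_of_real (frechet_derivative \<rho> (at x) w) = (\<Sum>j\<in>UNIV. G j x * w $ j + cnj (G j x * w $ j))"
    using has_derivative_wirtinger[OF has_derivative_cplx[OF assms], of w] by (simp add: d_zbar_rho[OF assms])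
  also have "\<dots> = of_real (2 * Re (\<Sum>k\<in>UNIV. w $ k * G k x))"
    by (simp add: complex_add_cnj sum_distrib_left mult.commute[of "w $ _"] del: complex_cnj_mult)
  finally show ?thesis by (simp only: of_real_eq_iff)
qed

lemma differentiable_G: "(G k has_derivative frechet_derivative (G k) (at p)) (at p)"
proof -
  let ?E = "\<lambda>v x. frechet_derivative \<rho> (at x) v"
  have E: "((?E v) has_derivative frechet_derivative (?E v) (at p)) (at p)" for v
    using C2 U(2) by (auto simp: frechet_derivative_works)
  have "((\<lambda>x. (of_real (?E (axis k 1) x) - \<i> * of_real (?E (axis k \<i>) x)) / 2) has_derivative
      (\<lambda>u. (of_real (frechet_derivative (?E (axis k 1)) (at p) u) - \<i> * of_real (frechet_derivative (?E (axis k \<i>)) (at p) u)) / 2)) (at p)"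
    by (rule derivative_eq_intros E refl | simp)+
  then have "(G k has_derivative
      (\<lambda>u. (of_real (frechet_derivative (?E (axis k 1)) (at p) u) - \<i> * of_real (frechet_derivative (?E (axis k \<i>)) (at p) u)) / 2)) (at p)"
    by (rule has_derivative_transform_within_open[OF _ U]) (simp add: G_eq)
  then have "G k differentiable (at p)" unfolding differentiable_def by blast
  then show ?thesis by (simp add: frechet_derivative_works)
qed

definition hess :: "'n \<Rightarrow> 'n \<Rightarrow> complex" where
  "hess j k = d_z j (d_z k (cplx \<rho>)) p"

definition levi :: "'n \<Rightarrow> 'n \<Rightarrow> complex" where
  "levi j k = d_z j (d_zbar k (cplx \<rho>)) p"

lemma levi_eq: "levi j k = cnj (d_zbar j (G k) p)"
proof -
  have "levi j k = d_z j (\<lambda>x. cnj (G k x)) p"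
    unfolding levi_def by (rule d_z_cong_open[OF U d_zbar_rho])
  then show ?thesis using d_z_cnj(1)[OF differentiable_G] by simp
qed

lemma derivative_G: "frechet_derivative (G k) (at p) u = (\<Sum>j\<in>UNIV. hess j k * u $ j + cnj (levi j k) * cnj (u $ j))"
  using has_derivative_wirtinger[OF differentiable_G] by (simp add: hess_def levi_eq)

lemma second_derivative_rho:
  "((\<lambda>x. frechet_derivative \<rho> (at x) w) has_derivative (\<lambda>u. 2 * Re (\<Sum>k\<in>UNIV. w $ k * frechet_derivative (G k) (at p) u))) (at p)"
proof -
  have "((\<lambda>x. 2 * Re (\<Sum>k\<in>UNIV. w $ k * G k x)) has_derivative (\<lambda>u. 2 * Re (\<Sum>k\<in>UNIV. w $ k * frechet_derivative (G k) (at p) u))) (at p)"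
    by (rule derivative_eq_intros differentiable_G refl | simp)+
  then show ?thesis
    by (rule has_derivative_transform_within_open[OF _ U]) (simp add: derivative_rho_eq)
qed

text \<open>
  Symmetry of the real second derivative, tested on the vectors \<open>c e\<^sub>k\<close> and \<open>d e\<^sub>j\<close> with
  \<open>c, d \<in> {1, \<i>}\<close>, is equivalent to the symmetry of the complex Hessian and the Hermitian symmetry of
  the Levi matrix.
\<close>

lemma symmetry:
  shows hess_sym: "hess j k = hess k j" and levi_herm: "levi k j = cnj (levi j k)"
proof -
  have axis_sum: "(\<Sum>k\<in>UNIV. axis i c $ k * f k) = c * f i" for i c and f :: "'n \<Rightarrow> complex"
  proof -
    have "(\<Sum>k\<in>UNIV. axis i c $ k * f k) = (\<Sum>k\<in>UNIV. if k = i then c * f i else 0)"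
      by (rule sum.cong) (auto simp: axis_def)
    then show ?thesis by simp
  qed
  have dG: "frechet_derivative (G k) (at p) (axis j d) = hess j k * d + cnj (levi j k) * cnj d" for j k d
  proof -
    have "frechet_derivative (G k) (at p) (axis j d) = (\<Sum>l\<in>UNIV. if l = j then hess j k * d + cnj (levi j k) * cnj d else 0)"
      unfolding derivative_G by (rule sum.cong) (auto simp: axis_def)
    then show ?thesis by simp
  qed
  have eq: "Re (c * (hess j k * d + cnj (levi j k) * cnj d)) = Re (d * (hess k j * c + cnj (levi k j) * cnj c))" for c d
    using second_derivative_symmetric[OF U has_derivative_rho second_derivative_rho[of "axis k c"] second_derivative_rho[of "axis j d"]]
    by (simp add: axis_sum dG)
  show "hess j k = hess k j" "levi k j = cnj (levi j k)"
    using eq[of 1 1] eq[of 1 \<i>] eq[of \<i> 1] eq[of \<i> \<i>] by (simp_all add: complex_eq_iff)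
qed

text \<open>
  Taylor's formula of order two. The derivative of \<open>\<rho>\<close> along the segment from \<open>p\<close> to \<open>z\<close> is expressed
  through the functions \<open>\<partial>\<rho>/\<partial>z\<^sub>k\<close>, which are differentiable at \<open>p\<close>.
\<close>

lemma expansion:
  assumes e: "e > 0"
  shows "\<exists>s>0. \<forall>z\<in>ball p s. \<bar>\<rho> z - \<rho> p - 2 * Re (\<Sum>j\<in>UNIV. G j p * (z $ j - p $ j))
     - Re (\<Sum>j\<in>UNIV. \<Sum>k\<in>UNIV. hess j k * (z $ j - p $ j) * (z $ k - p $ k)) - Re (sesq levi (z - p) (z - p))\<bar>
     \<le> e * (norm (z - p))\<^sup>2"
proof -
  define n where "n = real CARD('n)"
  have n: "n \<ge> 1" using zero_less_card_finite[where 'a = 'n] unfolding n_def by linarith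
  define e' where "e' = e / (2 * n)"
  have e': "e' > 0" using e n by (simp add: e'_def)
  let ?G' = "\<lambda>k. frechet_derivative (G k) (at p)"
  have "\<forall>\<^sub>F x in nhds p. cmod (G k x - G k p - ?G' k (x - p)) \<le> e' * norm (x - p)" for k
    using differentiable_G[of k, unfolded has_derivative_at_alt] e'
    by (auto simp: eventually_nhds_metric dist_norm)
  then have "\<forall>\<^sub>F x in nhds p. \<forall>k\<in>UNIV. cmod (G k x - G k p - ?G' k (x - p)) \<le> e' * norm (x - p)"
    by (intro eventually_ball_finite) auto
  moreover have "\<forall>\<^sub>F x in nhds p. x \<in> U"
    using U by (rule eventually_nhds_in_open)
  ultimately have "\<forall>\<^sub>F x in nhds p. x \<in> U \<and> (\<forall>k. cmod (G k x - G k p - ?G' k (x - p)) \<le> e' * norm (x - p))"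
    by eventually_elim auto
  then obtain s where s: "s > 0" "\<And>x. dist x p < s \<Longrightarrow> x \<in> U"
    "\<And>x k. dist x p < s \<Longrightarrow> cmod (G k x - G k p - ?G' k (x - p)) \<le> e' * norm (x - p)"
    unfolding eventually_nhds_metric by blast
  have "\<bar>\<rho> z - \<rho> p - 2 * Re (\<Sum>j\<in>UNIV. G j p * (z $ j - p $ j))
     - Re (\<Sum>j\<in>UNIV. \<Sum>k\<in>UNIV. hess j k * (z $ j - p $ j) * (z $ k - p $ k)) - Re (sesq levi (z - p) (z - p))\<bar>
     \<le> e * (norm (z - p))\<^sup>2" if z: "z \<in> ball p s" for z
  proof -
    define w where "w = z - p"
    define Q where "Q = Re (\<Sum>k\<in>UNIV. w $ k * ?G' k w)"
    define \<phi> where "\<phi> t = \<rho> (p + t *\<^sub>R w) - t * frechet_derivative \<rho> (at p) w - t\<^sup>2 * Q" for t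
    define \<phi>' where "\<phi>' t = frechet_derivative \<rho> (at (p + t *\<^sub>R w)) w - frechet_derivative \<rho> (at p) w - 2 * t * Q" for t
    have near: "dist (p + t *\<^sub>R w) p < s" if "0 \<le> t" "t \<le> 1" for t
    proof -
      have "norm (t *\<^sub>R w) \<le> norm w" using that by (simp add: mult_left_le_one_le)
      then show ?thesis using z by (simp add: dist_norm w_def norm_minus_commute)
    qed
    have der: "(\<phi> has_real_derivative \<phi>' t) (at t)" if t: "0 \<le> t" "t \<le> 1" for t
    proof -
      let ?x = "p + t *\<^sub>R w"
      have D: "(\<rho> has_derivative frechet_derivative \<rho> (at ?x)) (at ?x)"
        using has_derivative_rho s(2)[OF near[OF t]] by blast
      have "((\<lambda>t. \<rho> (p + t *\<^sub>R w)) has_derivative (\<lambda>h. frechet_derivative \<rho> (at ?x) (h *\<^sub>R w))) (at t)"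
        by (rule has_derivative_compose[of "\<lambda>t. p + t *\<^sub>R w" _ t UNIV \<rho>, OF _ D])
          (auto intro!: derivative_eq_intros)
      moreover have "(\<lambda>h. frechet_derivative \<rho> (at ?x) (h *\<^sub>R w)) = (*) (frechet_derivative \<rho> (at ?x) w)"
        using linear_cmul[OF has_derivative_linear[OF D]] by (auto simp: mult.commute)
      ultimately have "((\<lambda>t. \<rho> (p + t *\<^sub>R w)) has_real_derivative frechet_derivative \<rho> (at ?x) w) (at t)"
        by (simp add: has_field_derivative_def)
      then show ?thesis
        unfolding \<phi>_def \<phi>'_def by (auto intro!: derivative_eq_intros)
    qed
    have bound: "\<bar>\<phi>' t\<bar> \<le> e * (norm w)\<^sup>2" if t: "0 \<le> t" "t \<le> 1" for t
    proof -
      let ?x = "p + t *\<^sub>R w"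
      have G't: "?G' k (t *\<^sub>R w) = of_real t * ?G' k w" for k
        using linear_cmul[OF has_derivative_linear[OF differentiable_G]] by (simp add: scaleR_conv_of_real)
      have eq: "\<phi>' t = 2 * Re (\<Sum>k\<in>UNIV. w $ k * (G k ?x - G k p - ?G' k (?x - p)))"
        by (simp add: \<phi>'_def Q_def derivative_rho_eq[OF s(2)[OF near[OF t]]] derivative_rho_eq[OF U(2)] G't
            right_diff_distrib sum_subtractf sum_distrib_left mult_ac)
      have "\<bar>\<phi>' t\<bar> \<le> 2 * cmod (\<Sum>k\<in>UNIV. w $ k * (G k ?x - G k p - ?G' k (?x - p)))"
        unfolding eq by (simp only: abs_mult abs_numeral) (intro mult_left_mono abs_Re_le_cmod, simp)
      also have "\<dots> \<le> 2 * (\<Sum>k\<in>(UNIV :: 'n set). norm w * (e' * norm w))"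
      proof (rule mult_left_mono, rule order_trans[OF norm_sum], rule sum_mono)
        fix k
        have "cmod (G k ?x - G k p - ?G' k (?x - p)) \<le> e' * norm (?x - p)"
          by (rule s(3)[OF near[OF t]])
        also have "\<dots> \<le> e' * norm w"
          using e' t by (intro mult_left_mono) (auto simp: mult_left_le_one_le)
        finally show "cmod (w $ k * (G k ?x - G k p - ?G' k (?x - p))) \<le> norm w * (e' * norm w)"
          unfolding norm_mult by (intro mult_mono Finite_Cartesian_Product.norm_nth_le) auto
      qed auto
      also have "\<dots> = e * (norm w)\<^sup>2"
        using n by (simp add: e'_def n_def power2_eq_square)
      finally show ?thesis .
    qed
    obtain t where t: "0 < t" "t < 1" "\<phi> 1 - \<phi> 0 = (1 - 0) * \<phi>' t"
      using MVT2[of 0 1 \<phi> \<phi>', OF zero_less_one der] by auto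
    have "\<bar>\<phi> 1 - \<phi> 0\<bar> \<le> e * (norm w)\<^sup>2" using t bound[of t] by simp
    moreover have "\<phi> 1 - \<phi> 0 = \<rho> z - \<rho> p - 2 * Re (\<Sum>j\<in>UNIV. G j p * w $ j) - Q"
      by (simp add: \<phi>_def derivative_rho_eq[OF U(2)] w_def mult.commute)
    moreover have "Q = Re (\<Sum>j\<in>UNIV. \<Sum>k\<in>UNIV. hess j k * w $ j * w $ k) + Re (sesq levi w w)"
    proof -
      have "(\<Sum>k\<in>UNIV. w $ k * ?G' k w) = (\<Sum>k\<in>UNIV. \<Sum>j\<in>UNIV. hess j k * w $ j * w $ k) +
        (\<Sum>k\<in>UNIV. \<Sum>j\<in>UNIV. cnj (levi j k) * w $ k * cnj (w $ j))"
        by (simp add: derivative_G distrib_left sum.distrib sum_distrib_left mult_ac)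
      also have "(\<Sum>k\<in>UNIV. \<Sum>j\<in>UNIV. hess j k * w $ j * w $ k) = (\<Sum>j\<in>UNIV. \<Sum>k\<in>UNIV. hess j k * w $ j * w $ k)"
        by (rule sum.swap)
      also have "(\<Sum>k\<in>UNIV. \<Sum>j\<in>UNIV. cnj (levi j k) * w $ k * cnj (w $ j)) = sesq levi w w"
        by (simp add: sesq_def levi_herm[symmetric])
      finally show ?thesis by (simp add: Q_def)
    qed
    ultimately show ?thesis by (simp add: w_def algebra_simps)
  qed
  then show ?thesis using s(1) by blast
qed

end

section \<open>The contact of the characteristic hypersurface with the domain\<close>

text \<open>
  A quadratic form that is positive on the kernel of \<open>Z\<close> is bounded below on a conical neighbourhood of
  this kernel, by compactness of the unit sphere.
\<close>

lemma quadratic_positive_near_hyperplane: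
  fixes q :: "'a::euclidean_space \<Rightarrow> real" and Z :: "'a \<Rightarrow> complex"
  assumes q: "continuous_on UNIV q" "\<And>c t. q (c *\<^sub>R t) = c\<^sup>2 * q t"
    and Z: "continuous_on UNIV Z" "\<And>c t. Z (c *\<^sub>R t) = c *\<^sub>R Z t"
    and pos: "\<And>t. t \<noteq> 0 \<Longrightarrow> Z t = 0 \<Longrightarrow> q t > 0"
  obtains c \<eta> where "c > 0" "\<eta> > 0" "\<And>t. cmod (Z t) \<le> \<eta> * norm t \<Longrightarrow> c * (norm t)\<^sup>2 \<le> q t"
proof -
  have min: "\<exists>b>0. \<forall>t\<in>K. b \<le> f t"
    if K: "compact K" "continuous_on K f" and f_pos: "\<And>t. t \<in> K \<Longrightarrow> f t > 0" for K and f :: "'a \<Rightarrow> real"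
  proof (cases "K = {}")
    case False
    then obtain x where "x \<in> K" "\<And>t. t \<in> K \<Longrightarrow> f x \<le> f t"
      using continuous_attains_inf[OF K(1) False K(2)] by blast
    then show ?thesis using f_pos by blast
  qed (auto intro: exI[of _ 1])
  note cont = continuous_on_subset[OF q(1) subset_UNIV] continuous_on_subset[OF Z(1) subset_UNIV]
  have "compact (sphere 0 1 \<inter> {t. q t \<le> 0})"
    using q(1) by (intro compact_Int_closed closed_Collect_le) (auto intro: continuous_intros)
  moreover have "cmod (Z t) > 0" if "t \<in> sphere 0 1 \<inter> {t. q t \<le> 0}" for t
    using that pos[of t] by (cases "t = 0") (auto simp: not_less[symmetric])
  ultimately have "\<exists>b>0. \<forall>t\<in>sphere 0 1 \<inter> {t. q t \<le> 0}. b \<le> cmod (Z t)"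
    by (intro min continuous_on_norm cont(2))
  then obtain b where b: "b > 0" "\<And>t. t \<in> sphere 0 1 \<Longrightarrow> q t \<le> 0 \<Longrightarrow> b \<le> cmod (Z t)"
    by blast
  have "compact (sphere 0 1 \<inter> {t. cmod (Z t) \<le> b / 2})"
    using Z(1) by (intro compact_Int_closed closed_Collect_le) (auto intro!: continuous_intros)
  moreover have "q t > 0" if "t \<in> sphere 0 1 \<inter> {t. cmod (Z t) \<le> b / 2}" for t
    using that b by (force simp: not_le[symmetric])
  ultimately have "\<exists>c>0. \<forall>t\<in>sphere 0 1 \<inter> {t. cmod (Z t) \<le> b / 2}. c \<le> q t"
    by (intro min cont(1))
  then obtain c where c: "c > 0" "\<And>t. t \<in> sphere 0 1 \<Longrightarrow> cmod (Z t) \<le> b / 2 \<Longrightarrow> c \<le> q t"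
    by blast
  show thesis
  proof (rule that[OF c(1), of "b / 2"])
    fix t assume t: "cmod (Z t) \<le> b / 2 * norm t"
    show "c * (norm t)\<^sup>2 \<le> q t"
    proof (cases "t = 0")
      case True
      then show ?thesis using q(2)[of 0 t] by simp
    next
      case False
      define u where "u = (1 / norm t) *\<^sub>R t"
      have "u \<in> sphere 0 1" using False by (simp add: u_def)
      moreover have "cmod (Z u) \<le> b / 2"
        using t False by (simp add: u_def Z(2) field_simps)
      ultimately have "c \<le> q u" by (rule c(2))
      moreover have "q t = (norm t)\<^sup>2 * q u"
        using False by (simp add: u_def q(2) power_divide)
      ultimately show ?thesis using False by (simp add: mult.commute mult_left_mono)
    qed
  qed (use b in simp)
qed

lemma sum_UNIV_option: "(\<Sum>k\<in>UNIV. f k) = f None + (\<Sum>j\<in>UNIV. f (Some j))"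
  for f :: "'n::finite option \<Rightarrow> 'a::comm_monoid_add"
  by (simp add: UNIV_option_conv sum.reindex)


text \<open>
  The two mixed terms of the Hermitian form are conjugate to each other.
\<close>

lemma Re_pos_form:
  fixes \<rho> :: "complex ^ 'n::finite \<Rightarrow> real" and p t :: "complex ^ 'n"
    and m :: nat and a :: "('n \<Rightarrow> nat) \<Rightarrow> complex ^ 'n \<Rightarrow> complex"
  defines "v \<equiv> (\<chi> j. symbol_dzeta m a j p (hol_grad (cplx \<rho>) p))"
    and "b \<equiv> (\<chi> j. pos_coeff m a \<rho> p (Some j) None)"
    and "l \<equiv> \<lambda>j k. d_z j (d_zbar k (cplx \<rho>)) p"
  shows "Re (pos_form m a \<rho> p (\<chi> k. case k of None \<Rightarrow> t0 | Some j \<Rightarrow> t $ j)) =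
    Re (sesq l v v) * (cmod t0)\<^sup>2 + 2 * Re (cnj t0 * (\<Sum>j\<in>UNIV. b $ j * t $ j)) + Re (sesq l t t)"
proof -
  let ?t = "(\<chi> k. case k of None \<Rightarrow> t0 | Some j \<Rightarrow> t $ j) :: complex ^ ('n option)"
  let ?B = "\<Sum>j\<in>UNIV. b $ j * t $ j"
  have bN: "pos_coeff m a \<rho> p None (Some k) = cnj (b $ k)" for k by (simp add: b_def)
  have bS: "pos_coeff m a \<rho> p (Some k) None = b $ k" for k by (simp add: b_def)
  have q00: "pos_coeff m a \<rho> p None None = sesq l v v"
    by (simp add: sesq_def v_def l_def mult_ac)
  have "pos_form m a \<rho> p ?t = sesq l v v * (t0 * cnj t0) + (\<Sum>k\<in>UNIV. cnj (b $ k) * t0 * cnj (t $ k))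
     + ((\<Sum>j\<in>UNIV. b $ j * t $ j * cnj t0) + sesq l t t)"
    unfolding pos_form_def sum_UNIV_option sum.distrib bN bS q00
    by (simp add: sesq_def l_def mult.assoc)
  also have "(\<Sum>j\<in>UNIV. b $ j * t $ j * cnj t0) = cnj t0 * ?B"
    by (simp add: sum_distrib_left mult_ac)
  also have "(\<Sum>k\<in>UNIV. cnj (b $ k) * t0 * cnj (t $ k)) = cnj (cnj t0 * ?B)"
    by (simp add: sum_distrib_left mult_ac)
  finally have "Re (pos_form m a \<rho> p ?t) = Re (sesq l v v * (t0 * cnj t0)) + 2 * Re (cnj t0 * ?B) + Re (sesq l t t)"
    by (simp only: plus_complex.sel cnj.sel mult_2 add_ac)
  then show ?thesis by (simp add: mult_cnj_self flip: of_real_power)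
qed

text \<open>
  With \<open>A\<close> from the symmetric completion, the holomorphic Hessian of \<open>\<rho>\<close> minus \<open>A\<close> is a possible Hessian \<open>H\<close>
  of \<open>f\<close>, because the equation
  \<open>A v = b\<close> is the compatibility condition for \<open>H\<close>. On \<open>f = 0\<close> the linear part of \<open>\<rho>\<close> is of second order, so
  that \<open>z - p\<close> lies in a narrow cone around the complex tangent space, and
  \<open>\<rho>(z) \<ge> q(z - p) - 3 e |z - p|\<^sup>2\<close> with \<open>q(t) = Re A(t, t) + L(t, t)\<close>, for any given \<open>e > 0\<close> and \<open>z\<close>
  close to \<open>p\<close>.
\<close>

theorem theorem2p1:
  fixes \<Omega> :: "(complex ^ 'n) set"
    and p :: "complex ^ 'n"
    and \<rho> :: "complex ^ 'n \<Rightarrow> real"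
    and m :: nat
    and a :: "('n \<Rightarrow> nat) \<Rightarrow> complex ^ 'n \<Rightarrow> complex"
  assumes "strictly_pseudoconvex_domain \<Omega>"
    and "p \<in> frontier \<Omega>"
    and "defining_function_near \<rho> \<Omega> p"
    and "coeffs_holomorphic_near m a p"
    and "simply_characteristic_at m a \<rho> p"
    and "condition_Pos m a \<rho> p"
  shows "strongly_P_convex_at m a \<Omega> p"
proof -
  define \<zeta> where "\<zeta> = hol_grad (cplx \<rho>) p"
  define v where "v = (\<chi> j. symbol_dzeta m a j p \<zeta>)"
  define b where "b = (\<chi> j. pos_coeff m a \<rho> p (Some j) None)"
  obtain U where U: "open U" "p \<in> U" "smooth_on \<rho> U" and \<Omega>U: "\<Omega> \<inter> U = {z\<in>U. \<rho> z < 0}"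
    and grad: "\<forall>z \<in> frontier \<Omega> \<inter> U. hol_grad (cplx \<rho>) z \<noteq> 0"
    using assms(3) unfolding defining_function_near_def by blast
  interpret smooth_real_function \<rho> U p by unfold_locales (rule U)+
  have char: "principal_symbol m a p \<zeta> = 0" and v: "v \<noteq> 0"
    using assms(5) by (simp_all add: simply_characteristic_at_def characteristic_at_def \<zeta>_def v_def)
  have \<zeta>: "\<zeta> \<noteq> 0" using grad assms(2) U(2) by (auto simp: \<zeta>_def)
  have tan: "(\<Sum>j\<in>UNIV. \<zeta> $ j * v $ j) = 0"
    using euler_characteristic[OF char] by (simp add: v_def mult.commute)
  have pos: "0 < Re (sesq levi v v) * (cmod t0)\<^sup>2 + 2 * Re (cnj t0 * (\<Sum>j\<in>UNIV. b $ j * t $ j)) + Re (sesq levi t t)"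
    if "t0 \<noteq> 0 \<or> t \<noteq> 0" "(\<Sum>j\<in>UNIV. \<zeta> $ j * t $ j) = 0" for t0 and t :: "complex ^ 'n"
  proof -
    let ?t = "(\<chi> k. case k of None \<Rightarrow> t0 | Some j \<Rightarrow> t $ j) :: complex ^ ('n option)"
    have "?t \<noteq> 0"
    proof
      assume 0: "?t = 0"
      have "t0 = 0" using arg_cong[OF 0, of "\<lambda>x. x $ None"] by simp
      moreover have "t $ j = 0" for j using arg_cong[OF 0, of "\<lambda>x. x $ Some j"] by simp
      ultimately show False using that(1) by (simp add: vec_eq_iff)
    qed
    moreover have "(\<Sum>j\<in>UNIV. d_z j (cplx \<rho>) p * ?t $ Some j) = 0"
      using that(2) by (simp add: \<zeta>_def hol_grad_def)
    ultimately have "Re (pos_form m a \<rho> p ?t) > 0"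
      using assms(6) unfolding condition_Pos_def by blast
    then show ?thesis
      unfolding Re_pos_form by (simp add: levi_def[abs_def] v_def b_def \<zeta>_def)
  qed
  obtain A where A: "\<And>j k. A j k = A k j" "\<And>k. (\<Sum>j\<in>UNIV. v $ j * A j k) = b $ k"
    "\<And>t. t \<noteq> 0 \<Longrightarrow> (\<Sum>j\<in>UNIV. \<zeta> $ j * t $ j) = 0 \<Longrightarrow>
      0 < Re (\<Sum>j\<in>UNIV. \<Sum>k\<in>UNIV. A j k * t $ j * t $ k) + Re (sesq levi t t)"
    by (rule symmetric_completion[where l = levi and b = b and v = v and \<zeta> = \<zeta>, OF levi_herm v tan pos]) (assumption, assumption, rule that)
  define H where "H j k = hess j k - A j k" for j k
  have H_sym: "H j k = H k j" for j k using hess_sym A(1) by (simp add: H_def)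
  have compat: "symbol_dz m a k p \<zeta> + (\<Sum>j\<in>UNIV. symbol_dzeta m a j p \<zeta> * H j k) = 0" for k
  proof -
    have "(\<Sum>j\<in>UNIV. symbol_dzeta m a j p \<zeta> * H j k) = (\<Sum>j\<in>UNIV. symbol_dzeta m a j p \<zeta> * hess k j) - (\<Sum>j\<in>UNIV. v $ j * A j k)"
      by (simp add: H_def right_diff_distrib sum_subtractf v_def hess_sym[of _ k])
    then show ?thesis
      unfolding A(2) by (simp add: b_def \<zeta>_def hess_def)
  qed
  obtain i where i: "symbol_dzeta m a i p \<zeta> \<noteq> 0"
    using v by (auto simp: v_def vec_eq_iff)
  obtain r f where f: "r > 0" "cholomorphic_on f (ball p r)" "f p = 0" "hol_grad f p = \<zeta>"
    "\<And>z. z \<in> ball p r \<Longrightarrow> principal_symbol m a z (hol_grad f z) = 0"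
    "\<And>e. e > 0 \<Longrightarrow> \<exists>s>0. \<forall>z\<in>ball p s. cmod (f z - quad_poly p \<zeta> H z) \<le> e * (norm (z - p))\<^sup>2"
    by (rule characteristic_function_with_prescribed_jet[OF assms(4) char i H_sym compat]) (rule that)
  define Z where "Z t = (\<Sum>j\<in>UNIV. \<zeta> $ j * t $ j)" for t
  define q where "q t = Re (\<Sum>j\<in>UNIV. \<Sum>k\<in>UNIV. A j k * t $ j * t $ k) + Re (sesq levi t t)" for t
  define HH where "HH t = (\<Sum>j\<in>UNIV. \<Sum>k\<in>UNIV. H j k * t $ j * t $ k)" for t
  obtain c \<eta> where c: "c > 0" "\<eta> > 0" "\<And>t. cmod (Z t) \<le> \<eta> * norm t \<Longrightarrow> c * (norm t)\<^sup>2 \<le> q t"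
  proof (rule quadratic_positive_near_hyperplane[of q Z])
    show "continuous_on UNIV q" "continuous_on UNIV Z"
      unfolding q_def Z_def sesq_def by (auto intro!: continuous_intros)
    show "q (c *\<^sub>R t) = c\<^sup>2 * q t" for c t
      by (simp add: q_def sesq_def scaleR_conv_of_real[where 'a = complex] sum_distrib_left power2_eq_square algebra_simps)
    show "Z (c *\<^sub>R t) = c *\<^sub>R Z t" for c t
      by (simp add: Z_def scaleR_sum_right)
    show "q t > 0" if "t \<noteq> 0" "Z t = 0" for t
      using A(3) that by (simp add: q_def Z_def)
  qed (rule that)
  define C where "C = (\<Sum>j\<in>UNIV. \<Sum>k\<in>UNIV. cmod (H j k))"
  have HH_bound: "cmod (HH t) \<le> C * (norm t)\<^sup>2" for t
    unfolding HH_def C_def sum_distrib_right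
  proof (rule order_trans[OF norm_sum], rule sum_mono, rule order_trans[OF norm_sum], rule sum_mono)
    fix j k
    show "cmod (H j k * t $ j * t $ k) \<le> cmod (H j k) * (norm t)\<^sup>2"
      unfolding norm_mult power2_eq_square mult.assoc
      by (intro mult_left_mono mult_mono Finite_Cartesian_Product.norm_nth_le) auto
  qed
  have C: "C \<ge> 0" unfolding C_def by (intro sum_nonneg) auto
  \<comment> \<open>The error terms add up to \<open>3 e = c / 2\<close>.\<close>
  define e where "e = c / 6"
  have e: "e > 0" using c by (simp add: e_def)
  obtain s1 where s1: "s1 > 0" "\<And>z. z \<in> ball p s1 \<Longrightarrow> cmod (f z - quad_poly p \<zeta> H z) \<le> e * (norm (z - p))\<^sup>2"
    using f(6)[OF e] by blast
  obtain s2 where s2: "s2 > 0" "\<And>z. z \<in> ball p s2 \<Longrightarrow> \<bar>\<rho> z - \<rho> p - 2 * Re (\<Sum>j\<in>UNIV. G j p * (z $ j - p $ j))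
     - Re (\<Sum>j\<in>UNIV. \<Sum>k\<in>UNIV. hess j k * (z $ j - p $ j) * (z $ k - p $ k)) - Re (sesq levi (z - p) (z - p))\<bar>
     \<le> e * (norm (z - p))\<^sup>2"
    using expansion[OF e] by blast
  obtain s3 where s3: "s3 > 0" "ball p s3 \<subseteq> U" using U open_contains_ball by blast
  have cont_rho: "continuous_on U \<rho>"
    using has_derivative_rho by (meson continuous_at_imp_continuous_on has_derivative_continuous)
  have closure_le: "\<rho> z \<le> 0" if "z \<in> closure \<Omega>" "z \<in> U" for z
  proof (rule ccontr)
    assume "\<not> \<rho> z \<le> 0"
    define V where "V = U \<inter> \<rho> -` {0<..}"
    have "open V" unfolding V_def by (rule continuous_open_preimage[OF cont_rho U(1)]) simp
    moreover have "z \<in> V" using \<open>\<not> \<rho> z \<le> 0\<close> that(2) by (simp add: V_def)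
    ultimately have "V \<inter> \<Omega> \<noteq> {}" using that(1) by (meson disjoint_iff open_Int_closure_eq_empty)
    then obtain x where "x \<in> \<Omega> \<inter> U" "0 < \<rho> x" by (auto simp: V_def)
    then show False unfolding \<Omega>U by simp
  qed
  have p_closure: "p \<in> closure \<Omega>" using assms(2) by (simp add: frontier_def)
  have "open \<Omega>" using assms(1) by (simp add: strictly_pseudoconvex_domain_def)
  then have "p \<notin> \<Omega>" using assms(2) by (simp add: frontier_def interior_open)
  then have rho_p: "\<rho> p = 0"
    using closure_le[OF p_closure U(2)] \<Omega>U U(2) by force
  have "isCont (hol_grad f) p"
  proof -
    have "isCont (d_z j f) p" for j
      using continuous_on_d_z[OF open_ball f(2)] f(1) by (simp add: continuous_on_eq_continuous_at)
    then show ?thesis unfolding isCont_def by (intro vec_tendstoI) (simp add: hol_grad_def)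
  qed
  then have "\<forall>\<^sub>F z in nhds p. hol_grad f z \<noteq> 0"
    using \<zeta> f(4) tendsto_imp_eventually_ne[of "hol_grad f" \<zeta> "nhds p" 0] by (simp add: continuous_at tendsto_nhds_iff)
  then obtain s4 where s4: "s4 > 0" "\<And>z. dist z p < s4 \<Longrightarrow> hol_grad f z \<noteq> 0"
    unfolding eventually_nhds_metric by blast
  define s where "s = Min {r, s1, s2, s3, s4, \<eta> / (C + e)}"
  have Ce: "C + e > 0" using C e by linarith
  have s: "s > 0" "s \<le> r" "s \<le> s1" "s \<le> s2" "s \<le> s3" "s \<le> s4" "s \<le> \<eta> / (C + e)"
    using f(1) s1(1) s2(1) s3(1) s4(1) c(2) Ce by (auto simp: s_def)
  have rho_pos: "\<rho> z > 0" if z: "z \<in> ball p s" "f z = 0" "z \<noteq> p" for z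
  proof -
    define w where "w = z - p"
    have wz: "norm w < s" "norm w > 0" using z by (simp_all add: w_def dist_norm norm_minus_commute)
    have "quad_poly p \<zeta> H z = Z w + HH w / 2"
      by (simp add: quad_poly_def Z_def HH_def w_def)
    then have err: "cmod (Z w + HH w / 2) \<le> e * (norm w)\<^sup>2"
      using s1(2)[of z] z s norm_minus_cancel[of "Z w + HH w / 2"] by (simp add: w_def)
    have "cmod (Z w) \<le> cmod (Z w + HH w / 2) + cmod (HH w / 2)"
      using norm_triangle_ineq4[of "Z w + HH w / 2" "HH w / 2"] by simp
    also have "\<dots> \<le> e * (norm w)\<^sup>2 + C * (norm w)\<^sup>2"
    proof -
      have "cmod (HH w / 2) \<le> cmod (HH w)" by (simp add: norm_divide)
      with err HH_bound[of w] show ?thesis by linarith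
    qed
    also have "\<dots> = (C + e) * norm w * norm w" by (simp add: power2_eq_square algebra_simps)
    also have "\<dots> \<le> \<eta> * norm w"
    proof (rule mult_right_mono)
      have "(C + e) * norm w \<le> (C + e) * (\<eta> / (C + e))"
        using wz s(7) Ce by (intro mult_left_mono) auto
      then show "(C + e) * norm w \<le> \<eta>" using Ce by simp
    qed simp
    finally have q: "c * (norm w)\<^sup>2 \<le> q w" by (rule c(3))
    have "\<bar>Re (Z w + HH w / 2)\<bar> \<le> e * (norm w)\<^sup>2"
      using err abs_Re_le_cmod order_trans by blast
    then have "- (2 * e * (norm w)\<^sup>2) \<le> 2 * Re (Z w) + Re (HH w)" by simp
    moreover have "\<bar>\<rho> z - 2 * Re (Z w) - Re (\<Sum>j\<in>UNIV. \<Sum>k\<in>UNIV. hess j k * w $ j * w $ k) - Re (sesq levi w w)\<bar> \<le> e * (norm w)\<^sup>2"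
      using s2(2)[of z] z s by (simp add: w_def rho_p Z_def \<zeta>_def hol_grad_def)
    moreover have "(\<Sum>j\<in>UNIV. \<Sum>k\<in>UNIV. hess j k * w $ j * w $ k) = HH w + (\<Sum>j\<in>UNIV. \<Sum>k\<in>UNIV. A j k * w $ j * w $ k)"
      by (simp add: HH_def H_def left_diff_distrib sum_subtractf)
    ultimately have "q w - 3 * e * (norm w)\<^sup>2 \<le> \<rho> z"
      unfolding q_def by simp
    moreover have "3 * e * (norm w)\<^sup>2 < c * (norm w)\<^sup>2"
      using wz c(1) by (intro mult_strict_right_mono) (auto simp: e_def)
    ultimately show ?thesis using q by linarith
  qed
  define S where "S = {z \<in> ball p s. f z = 0}"
  have sub: "z \<in> ball p r" "z \<in> U" "dist z p < s4" if "z \<in> ball p s" for z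
    using that s s3(2) by (auto simp: dist_commute)
  have "S \<inter> closure \<Omega> \<inter> ball p s = {p}"
  proof
    show "S \<inter> closure \<Omega> \<inter> ball p s \<subseteq> {p}"
    proof
      fix z assume z: "z \<in> S \<inter> closure \<Omega> \<inter> ball p s"
      then have "\<rho> z \<le> 0" using closure_le sub(2) by blast
      then show "z \<in> {p}" using rho_pos[of z] z by (force simp: S_def)
    qed
    show "{p} \<subseteq> S \<inter> closure \<Omega> \<inter> ball p s"
      using p_closure s(1) f(3) by (simp add: S_def)
  qed
  moreover have "everywhere_characteristic_hypersurface m a (ball p s) S"
    unfolding everywhere_characteristic_hypersurface_def
  proof (intro exI conjI ballI)
    show "cholomorphic_on f (ball p s)"
      using f(2) by (rule cholomorphic_on_subset) (use sub in blast)
    show "S = {z \<in> ball p s. f z = 0}" by (rule S_def)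
  qed (use s4(2) f(5) sub in \<open>auto simp: S_def\<close>)
  ultimately show ?thesis
    unfolding strongly_P_convex_at_def using s(1) by (intro exI[of _ "ball p s"] exI[of _ S]) simp
qed

end
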